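(* With the arrangements $W^{k,\ell}_{i,j}$ given explicitly in the context, the pairs $$(W^{3,0}_{5,1},W^{3,0}_{5,2}),\qquad (W^{3,0}_{8,1},W^{3,0}_{8,2}),\qquad (W^{2,2}_{4,1},W^{2,2}_{4,2})$$ are strong Ziegler pairs.
   Context: Let $S=\mathbb C[x,y,z]$. For a reduced curve $C:f=0$ in $\mathbb P^2_{\mathbb C}$, the Milnor algebra is $M(C)=S/\langle\partial_xf,\partial_yf,\partial_zf\rangle$. The strong combinatorial type of a reduced curve $C$ records: the set $\mathbf i$ indexing its irreducible components with the degree function $\bar d:\mathbf i\to\mathbb N$; the set ${\rm Sing}(C)$ of singular points with the map $\delta$ sending each singular point to its topological type; for each singular point $p$ the set $\iota(p)\subseteq\mathbf i$ of components passing through $p$; and the vector $\mathbf r=(r_j)_j$, where $r_j$ is the number of irreducible components containing exactly $j$ singular points of $C$. Two reduced curves $C_1,C_2$ have the same strong combinatorial type if there are bijections $\phi_r:\mathbf i_1\to\mathbf i_2$ and $\phi_S:{\rm Sing}(C_1)\to{\rm Sing}(C_2)$ such that $\bar d_1=\bar d_2\circ\phi_r$, $\delta_1=\delta_2\circ\phi_S$, $\phi_r(\iota_1(p))=\iota_2(\phi_S(p))$ for every $p\in{\rm Sing}(C_1)$, and $\mathbf r_1=\mathbf r_2$. $(C_1,C_2)$ is a strong Ziegler pair if $C_1$ and $C_2$ have the same strong combinatorial type but $M(C_1)$ and $M(C_2)$ have different minimal graded free resolutions over $S$ (i.e. different graded Betti numbers). Defining polynomials: $W^{3,0}_{5,1}$: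 $(x^2+2y^2-3z^2)(x^2+y^2-2z^2)(x^2+yz-2z^2)$. $W^{3,0}_{5,2}$: $(x^2+2y^2-3z^2)(x^2+y^2-2z^2)(x^2+2xz+2yz-z^2)$. $W^{3,0}_{8,1}$: $(x^2-y^2-z^2)(x^2+y^2+xz-2z^2)(x^2+3y^2-6z^2)$. $W^{3,0}_{8,2}$: $(x^2+3y^2-3z^2)(6x^2+6y^2-2\sqrt3\,xz+6\sqrt3\,yz-15z^2)(x^2-y^2-2z^2)$. $W^{2,2}_{4,1}$: $(x^2+3y^2-4z^2)(3x^2+y^2-4z^2)(x-y+z)(x-y)$. $W^{2,2}_{4,2}$: $(x^2+3y^2-4z^2)(3x^2+y^2-4z^2)(x+z)x$. *)

theory Defs
  imports
    "HOL-Analysis.Analysis"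
    "HOL-Library.Poly_Mapping"
    "HOL-Computational_Algebra.Squarefree"
begin

section \<open>The graded polynomial ring in three variables\<close>

text \<open>
  Exponent vectors are indexed by the three-element type \<open>3\<close>, whose elements are written
  1, 2, 3 (the last one being 0), as is usual for the coordinates of a vector in
  \<open>complex ^ 3\<close>.
\<close>

type_synonym poly3 = "(3 \<Rightarrow>\<^sub>0 nat) \<Rightarrow>\<^sub>0 complex"

definition Const :: "complex \<Rightarrow> poly3" where
  "Const c = Poly_Mapping.single 0 c"

definition Var :: "3 \<Rightarrow> poly3" where
  "Var i = Poly_Mapping.single (Poly_Mapping.single i 1) 1"

abbreviation X :: poly3 where "X \<equiv> Var 1"
abbreviation Y :: poly3 where "Y \<equiv> Var 2"
abbreviation Z :: poly3 where "Z \<equiv> Var 3"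

definition mon_deg :: "(3 \<Rightarrow>\<^sub>0 nat) \<Rightarrow> nat" where
  "mon_deg m = (\<Sum>i\<in>UNIV. Poly_Mapping.lookup m i)"

text \<open>Degrees are integers, so that a nonzero polynomial is never homogeneous of negative degree.\<close>

definition homogeneous :: "int \<Rightarrow> poly3 \<Rightarrow> bool" where
  "homogeneous d f \<longleftrightarrow> (\<forall>m\<in>Poly_Mapping.keys f. int (mon_deg m) = d)"

definition total_degree :: "poly3 \<Rightarrow> nat" where
  "total_degree f = Max (mon_deg ` Poly_Mapping.keys f)"

definition eval3 :: "poly3 \<Rightarrow> complex ^ 3 \<Rightarrow> complex" where
  "eval3 f v = (\<Sum>m\<in>Poly_Mapping.keys f.
     Poly_Mapping.lookup f m * (\<Prod>i\<in>UNIV. (v $ i) ^ Poly_Mapping.lookup m i))"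

text \<open>The subtraction of exponents truncates only where the coefficient is zero.\<close>

definition pdiff :: "3 \<Rightarrow> poly3 \<Rightarrow> poly3" where
  "pdiff i f = (\<Sum>m\<in>Poly_Mapping.keys f.
     Poly_Mapping.single (m - Poly_Mapping.single i 1)
       (of_nat (Poly_Mapping.lookup m i) * Poly_Mapping.lookup f m))"


section \<open>The complex projective plane\<close>

definition proportional :: "complex ^ 3 \<Rightarrow> complex ^ 3 \<Rightarrow> bool" where
  "proportional v w \<longleftrightarrow> v \<noteq> 0 \<and> w \<noteq> 0 \<and> (\<exists>c. w = c *s v)"

quotient_type cp2 = "complex ^ 3" / partial: proportional
proof (rule part_equivpI)
  show "\<exists>x. proportional x x"
    by (rule exI[of _ "axis 1 1"]) (auto simp: proportional_def axis_eq_0_iff intro: exI[of _ 1])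
  show "symp proportional"
  proof (rule sympI)
    fix v w assume "proportional v w"
    then obtain c where c: "v \<noteq> 0" "w \<noteq> 0" "w = c *s v"
      by (auto simp: proportional_def)
    then have "c \<noteq> 0" by auto
    then have "v = inverse c *s w" using c by (simp add: vector_smult_assoc)
    then show "proportional w v" using c(1,2) unfolding proportional_def by blast
  qed
  show "transp proportional"
    by (rule transpI) (auto simp: proportional_def vector_smult_assoc)
qed

text \<open>The quotient topology.\<close>

instantiation cp2 :: topological_space
begin

definition open_cp2 :: "cp2 set \<Rightarrow> bool" where
  "open_cp2 U \<longleftrightarrow> open {v. v \<noteq> 0 \<and> abs_cp2 v \<in> U}"

instance
proof
  have "{v::complex^3. v \<noteq> 0 \<and> abs_cp2 v \<in> UNIV} = - {0}" by auto
  then show "open (UNIV :: cp2 set)" by (simp add: open_cp2_def open_Compl)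
next
  fix S T :: "cp2 set"
  assume "open S" "open T"
  moreover have "{v. v \<noteq> 0 \<and> abs_cp2 v \<in> S \<inter> T}
      = {v. v \<noteq> 0 \<and> abs_cp2 v \<in> S} \<inter> {v. v \<noteq> 0 \<and> abs_cp2 v \<in> T}" by auto
  ultimately show "open (S \<inter> T)" by (simp add: open_cp2_def open_Int)
next
  fix K :: "cp2 set set"
  assume "\<forall>S\<in>K. open S"
  moreover have "{v. v \<noteq> 0 \<and> abs_cp2 v \<in> \<Union>K}
      = (\<Union>S\<in>K. {v. v \<noteq> 0 \<and> abs_cp2 v \<in> S})" by auto
  ultimately show "open (\<Union>K)" by (simp only: open_cp2_def) (rule open_UN)
qed

end


section \<open>Plane curves and their strong combinatorial type\<close>

text \<open>A curve is represented by a defining polynomial.\<close>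

definition reduced_curve :: "poly3 \<Rightarrow> bool" where
  "reduced_curve f \<longleftrightarrow> (\<exists>d>0. homogeneous d f) \<and> squarefree f"

definition vanishes_at :: "poly3 \<Rightarrow> cp2 \<Rightarrow> bool" where
  "vanishes_at f p \<longleftrightarrow> (\<forall>v. v \<noteq> 0 \<and> abs_cp2 v = p \<longrightarrow> eval3 f v = 0)"

definition curve_points :: "poly3 \<Rightarrow> cp2 set" where
  "curve_points f = {p. vanishes_at f p}"

definition Sing :: "poly3 \<Rightarrow> cp2 set" where
  "Sing f = {p \<in> curve_points f. \<forall>i. vanishes_at (pdiff i f) p}"

text \<open>
  The irreducible components of \<open>f = 0\<close> are indexed by the irreducible factors of \<open>f\<close> up to
  units, that is, by classes of associated polynomials. Degree and zero set do not depend on the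
  representative.
\<close>

definition components :: "poly3 \<Rightarrow> poly3 set set" where
  "components f = {{h. h dvd g \<and> g dvd h} | g. irreducible g \<and> g dvd f}"

definition comp_degree :: "poly3 set \<Rightarrow> nat" where
  "comp_degree K = the_elem (total_degree ` K)"

definition comp_points :: "poly3 set \<Rightarrow> cp2 set" where
  "comp_points K = (\<Inter>g\<in>K. curve_points g)"

definition components_through :: "poly3 \<Rightarrow> cp2 \<Rightarrow> poly3 set set" where
  "components_through f p = {K \<in> components f. p \<in> comp_points K}"

definition r_vec :: "poly3 \<Rightarrow> nat \<Rightarrow> nat" where
  "r_vec f j = card {K \<in> components f. card (Sing f \<inter> comp_points K) = j}"

text \<open>
  The topological type of \<open>f = 0\<close> at \<open>p\<close> is the class of the germ of the pair (plane, curve) at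
  \<open>p\<close> under local homeomorphisms of the ambient plane.
\<close>

definition same_topological_type :: "poly3 \<Rightarrow> cp2 \<Rightarrow> poly3 \<Rightarrow> cp2 \<Rightarrow> bool" where
  "same_topological_type f p g q \<longleftrightarrow>
     (\<exists>U V \<phi> \<psi>. open U \<and> p \<in> U \<and> open V \<and> q \<in> V \<and> homeomorphism U V \<phi> \<psi> \<and>
        \<phi> p = q \<and> \<phi> ` (U \<inter> curve_points f) = V \<inter> curve_points g)"

definition same_strong_combinatorial_type :: "poly3 \<Rightarrow> poly3 \<Rightarrow> bool" where
  "same_strong_combinatorial_type f g \<longleftrightarrow>
     (\<exists>\<phi>\<^sub>r \<phi>\<^sub>S. bij_betw \<phi>\<^sub>r (components f) (components g) \<and> bij_betw \<phi>\<^sub>S (Sing f) (Sing g) \<and>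
        (\<forall>K\<in>components f. comp_degree K = comp_degree (\<phi>\<^sub>r K)) \<and>
        (\<forall>p\<in>Sing f. same_topological_type f p g (\<phi>\<^sub>S p)) \<and>
        (\<forall>p\<in>Sing f. \<phi>\<^sub>r ` components_through f p = components_through g (\<phi>\<^sub>S p)) \<and>
        r_vec f = r_vec g)"


section \<open>Milnor algebras and minimal graded free resolutions\<close>

text \<open>The Milnor algebra of \<open>f\<close> is the quotient of the polynomial ring \<open>S\<close> by this ideal.\<close>

definition jacobian_ideal :: "poly3 \<Rightarrow> poly3 set" where
  "jacobian_ideal f = module.span (*) (range (\<lambda>i. pdiff i f))"

text \<open>
  \<open>min_graded_free_resolution I a e D\<close>: the data \<open>a, e, D\<close> are a minimal graded free resolution
  \<open>\<dots> \<rightarrow> F 2 \<rightarrow> F 1 \<rightarrow> F 0 \<rightarrow> S/I \<rightarrow> 0\<close> of the graded \<open>S\<close>-module \<open>S/I\<close>. The list \<open>a i\<close> contains the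
  degrees of the basis elements of \<open>F i\<close>, so \<open>F i\<close> is the direct sum of the modules
  \<open>S(- a i ! k)\<close> for \<open>k < length (a i)\<close>, and an element of \<open>F i\<close> is given by its coordinates at
  these \<open>k\<close>. The augmentation \<open>F 0 \<rightarrow> S/I\<close> sends the \<open>k\<close>-th basis element to the class of \<open>e k\<close>,
  and \<open>F (i + 1) \<rightarrow> F i\<close> has the matrix \<open>D i\<close> with rows \<open>k < length (a i)\<close> and columns
  \<open>l < length (a (i + 1))\<close>. The six conjuncts are: the augmentation and the differentials preserve
  degrees; exactness at \<open>S/I\<close>, at \<open>F 0\<close> and at \<open>F (i + 1)\<close>; and minimality, the image of each
  differential lying in the product of \<open>F i\<close> with the ideal of the three variables.
\<close>

definition min_graded_free_resolution ::
    "poly3 set \<Rightarrow> (nat \<Rightarrow> int list) \<Rightarrow> (nat \<Rightarrow> poly3) \<Rightarrow> (nat \<Rightarrow> nat \<Rightarrow> nat \<Rightarrow> poly3) \<Rightarrow> bool" where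
  "min_graded_free_resolution I a e D \<longleftrightarrow>
     (\<forall>k<length (a 0). homogeneous (a 0 ! k) (e k)) \<and>
     (\<forall>i. \<forall>k<length (a i). \<forall>l<length (a (Suc i)).
        homogeneous (a (Suc i) ! l - a i ! k) (D i k l)) \<and>
     (\<forall>g. \<exists>u. g - (\<Sum>k<length (a 0). u k * e k) \<in> I) \<and>
     (\<forall>u. (\<Sum>k<length (a 0). u k * e k) \<in> I \<longleftrightarrow>
        (\<exists>w. \<forall>k<length (a 0). u k = (\<Sum>l<length (a 1). D 0 k l * w l))) \<and>
     (\<forall>i u. (\<forall>k<length (a i). (\<Sum>l<length (a (Suc i)). D i k l * u l) = 0) \<longleftrightarrow>
        (\<exists>w. \<forall>l<length (a (Suc i)).
           u l = (\<Sum>m<length (a (Suc (Suc i))). D (Suc i) l m * w m))) \<and>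
     (\<forall>i. \<forall>k<length (a i). \<forall>l<length (a (Suc i)). Poly_Mapping.lookup (D i k l) 0 = 0)"

text \<open>
  The graded Betti number at \<open>(i, j)\<close> is the number of basis elements of degree \<open>j\<close> of \<open>F i\<close>.
  Every finitely generated graded \<open>S\<close>-module has a minimal graded free resolution, unique up to
  isomorphism, so two modules have the same graded Betti numbers iff some (equivalently, any)
  minimal resolutions of the two have the same ones.
\<close>

definition same_graded_betti_numbers :: "poly3 set \<Rightarrow> poly3 set \<Rightarrow> bool" where
  "same_graded_betti_numbers I J \<longleftrightarrow>
     (\<exists>a e D b e' D'. min_graded_free_resolution I a e D \<and> min_graded_free_resolution J b e' D' \<and>
        (\<forall>i j. count_list (a i) j = count_list (b i) j))"

definition strong_ziegler_pair :: "poly3 \<Rightarrow> poly3 \<Rightarrow> bool" where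
  "strong_ziegler_pair f g \<longleftrightarrow>
     reduced_curve f \<and> reduced_curve g \<and>
     same_strong_combinatorial_type f g \<and>
     \<not> same_graded_betti_numbers (jacobian_ideal f) (jacobian_ideal g)"


section \<open>The arrangements\<close>

definition W30_51 :: poly3 where
  "W30_51 = (X^2 + 2*Y^2 - 3*Z^2) * (X^2 + Y^2 - 2*Z^2) * (X^2 + Y*Z - 2*Z^2)"

definition W30_52 :: poly3 where
  "W30_52 = (X^2 + 2*Y^2 - 3*Z^2) * (X^2 + Y^2 - 2*Z^2) * (X^2 + 2*X*Z + 2*Y*Z - Z^2)"

definition W30_81 :: poly3 where
  "W30_81 = (X^2 - Y^2 - Z^2) * (X^2 + Y^2 + X*Z - 2*Z^2) * (X^2 + 3*Y^2 - 6*Z^2)"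

definition W30_82 :: poly3 where
  "W30_82 = (X^2 + 3*Y^2 - 3*Z^2)
     * (6*X^2 + 6*Y^2 - 2 * Const (complex_of_real (sqrt 3)) * X*Z
          + 6 * Const (complex_of_real (sqrt 3)) * Y*Z - 15*Z^2)
     * (X^2 - Y^2 - 2*Z^2)"

definition W22_41 :: poly3 where
  "W22_41 = (X^2 + 3*Y^2 - 4*Z^2) * (3*X^2 + Y^2 - 4*Z^2) * (X - Y + Z) * (X - Y)"

definition W22_42 :: poly3 where
  "W22_42 = (X^2 + 3*Y^2 - 4*Z^2) * (3*X^2 + Y^2 - 4*Z^2) * (X + Z) * X"

end

(*
The graded Betti number beta_{3,10} separates the two curves of each pair. Computing
Tor(S/J, C) with the Koszul complex instead of a resolution identifies the third Betti
numbers with the dimensions of the socle of the Milnor algebra S/J: beta_{3,d+3} is the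
dimension of the space of classes g in degree d with xg = yg = zg = 0. In degree 7 this space
vanishes for the first curve of each pair and not for the second. Vanishing is witnessed by
functionals killing J in degree 8, nonvanishing by an explicit g, cofactors writing its
multiples by the variables as elements of J, and a functional killing J but not g.

The combinatorial types agree because all components are smooth conics or lines, so that the
singular points are the points on at least two components, which are found by solving the
equations. At such a point the curve is a node (two transversal branches), an ordinary triple
point (a relation cC = aA + bB with units a, b, c turns the third branch into the line
u + v = 0), or a tacnode (a relation bB = aA + cL^2 with units turns two tangent branches into
a line and a parabola). In each case u and v are local coordinates by the inverse function
theorem, which gives a homeomorphism onto a neighbourhood of the origin in one of three model
curves.
*)
theory Submission
  imports
    Defs
    "HOL-Computational_Algebra.Field_as_Ring"
    "HOL-Computational_Algebra.Polynomial_Factorial"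
begin

section \<open>Polynomials in three variables\<close>

text \<open>Only the occurrence of the degree 10 in \<open>a 3\<close> is compared, inside whatever
  resolutions are given, so each curve uses one of two implications. The harder half is the absence
  of socle elements, a claim about all complex forms of degree 7. A functional that kills J in
  degree 8, composed with multiplication by a variable, gives a functional on degree 7 that kills J
  and every socle element. Such contractions yield coordinates on the 18-dimensional space S_7/J_7,
  so a socle element must be zero there. This is checked on the 36 monomials of degree 7 in integer
  arithmetic, for which the equation must have integer coefficients. The relations behind triple
  points and tacnodes come from restriction to a line. Conics through both triple points are
  proportional on the line joining these, so suitable differences are divisible by its equation, and
  eliminating it leaves linear cofactors. Tangent conics restrict to the common tangent as multiples
  of the square of one linear form. A line through both triple points is part of a reducible member
  of the pencil of the two conics.\<close>

lemma poly_mapping_add_induct [case_names single add]: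
  fixes f :: "'a \<Rightarrow>\<^sub>0 'b::comm_monoid_add"
  assumes single: "\<And>m c. P (Poly_Mapping.single m c)"
    and add: "\<And>f g. P f \<Longrightarrow> P g \<Longrightarrow> P (f + g)"
  shows "P f"
proof (induction f rule: Poly_Mapping.update_induct)
  case const
  show ?case using single[of undefined 0] by simp
next
  case (update f a b)
  have "Poly_Mapping.update a b f = f + Poly_Mapping.single a b"
    using update by (intro poly_mapping_eqI)
      (auto simp: lookup_update lookup_add lookup_single when_def in_keys_iff)
  with update add single show ?case by metis
qed

lemma prod_3: "prod f (UNIV :: 3 set) = f 1 * f 2 * f 3"
  unfolding UNIV_3 by (simp add: mult.assoc)

lemma exponent_eq_sum:
  "(m :: 3 \<Rightarrow>\<^sub>0 nat) = (\<Sum>i\<in>UNIV. Poly_Mapping.single i (Poly_Mapping.lookup m i))"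
  by (rule poly_mapping_eqI) (auto simp: lookup_sum lookup_single when_def)

lemma Const_0 [simp]: "Const 0 = 0" by (simp add: Const_def)
lemma Const_1 [simp]: "Const 1 = 1" by (simp add: Const_def)
lemma Const_add: "Const (a + b) = Const a + Const b" by (simp add: Const_def single_add)
lemma Const_mult: "Const (a * b) = Const a * Const b" by (simp add: Const_def mult_single)
lemma Const_numeral [simp]: "Const (numeral n) = numeral n"
  by (simp add: Const_def)
lemma Const_of_int: "Const (of_int n) = of_int n"
  by (simp add: Const_def)

lemma Var_power: "Var i ^ n = Poly_Mapping.single (Poly_Mapping.single i n) 1"
proof (induction n)
  case (Suc n)
  have "Poly_Mapping.single i (Suc 0) + Poly_Mapping.single i n = Poly_Mapping.single i (Suc n)"
    by (simp flip: single_add)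
  with Suc show ?case by (simp add: Var_def mult_single)
qed simp

lemma single_eq_Const_Var:
  "(Poly_Mapping.single m c :: poly3) = Const c * (\<Prod>i\<in>UNIV. Var i ^ Poly_Mapping.lookup m i)"
proof -
  have "Poly_Mapping.single (\<Sum>i\<in>UNIV. Poly_Mapping.single i (Poly_Mapping.lookup m i)) c
      = Const c * (X ^ Poly_Mapping.lookup m 1
      * (Y ^ Poly_Mapping.lookup m 2 * Z ^ Poly_Mapping.lookup m 3))"
    unfolding Var_power Const_def mult_single
    by (simp add: sum_3 add.assoc)
  then show ?thesis unfolding exponent_eq_sum[symmetric] by (simp add: prod_3 mult.assoc)
qed

lemma poly3_induct [case_names Const Var add mult]:
  assumes "\<And>c. P (Const c)" "\<And>i. P (Var i)" "\<And>f g. P f \<Longrightarrow> P g \<Longrightarrow> P (f + g)"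
    "\<And>f g. P f \<Longrightarrow> P g \<Longrightarrow> P (f * g)"
  shows "P (f :: poly3)"
proof (induction f rule: poly_mapping_add_induct)
  case (single m c)
  have *: "P (Var i ^ n)" for i n
    by (induction n) (use assms(1)[of 1] assms(2,4) in auto)
  show ?case by (simp add: single_eq_Const_Var prod_3 assms *)
qed (use assms in auto)


subsection \<open>Substitution\<close>

text \<open>The coefficient map \<open>h\<close> lets one construction serve three purposes: the
  identity gives evaluation at a point, \<open>Const\<close> gives substitution of polynomials, and
  nested constants give the passage to iterated univariate polynomials.\<close>

definition insertion ::
    "(complex \<Rightarrow> 'a::comm_ring_1) \<Rightarrow> (3 \<Rightarrow> 'a) \<Rightarrow> poly3 \<Rightarrow> 'a" where
  "insertion h \<sigma> f = (\<Sum>m\<in>Poly_Mapping.keys f.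
     h (Poly_Mapping.lookup f m) * (\<Prod>i\<in>UNIV. \<sigma> i ^ Poly_Mapping.lookup m i))"

locale scalar_embedding =
  fixes h :: "complex \<Rightarrow> 'a::comm_ring_1"
  assumes h_add: "h (a + b) = h a + h b" and h_mult: "h (a * b) = h a * h b"
    and h_1: "h 1 = 1"
begin

lemma h_0: "h 0 = 0"
  using h_add[of 0 0] by simp

lemma insertion_single:
  "insertion h \<sigma> (Poly_Mapping.single m c) = h c * (\<Prod>i\<in>UNIV. \<sigma> i ^ Poly_Mapping.lookup m i)"
  by (cases "c = 0") (simp_all add: insertion_def h_0)

lemma insertion_supset:
  assumes "finite A" "Poly_Mapping.keys f \<subseteq> A"
  shows "insertion h \<sigma> f = (\<Sum>m\<in>A.
     h (Poly_Mapping.lookup f m) * (\<Prod>i\<in>UNIV. \<sigma> i ^ Poly_Mapping.lookup m i))"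
  unfolding insertion_def using assms
  by (intro sum.mono_neutral_left) (auto simp: in_keys_iff h_0)

lemma insertion_add: "insertion h \<sigma> (f + g) = insertion h \<sigma> f + insertion h \<sigma> g"
proof -
  let ?A = "Poly_Mapping.keys f \<union> Poly_Mapping.keys g"
  show ?thesis
    using keys_add[of f g]
    by (subst (1 2 3) insertion_supset[of ?A])
      (auto simp: lookup_add h_add distrib_right sum.distrib)
qed

lemma insertion_mult: "insertion h \<sigma> (f * g) = insertion h \<sigma> f * insertion h \<sigma> g"
proof (induction f rule: poly_mapping_add_induct)
  case (single m c)
  show ?case
  proof (induction g rule: poly_mapping_add_induct)
    case (single n d)
    show ?case
      by (simp add: mult_single insertion_single h_mult lookup_add power_add prod.distrib mult_ac)
  next
    case (add g1 g2)
    then show ?case by (simp add: insertion_add distrib_left)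
  qed
next
  case (add f1 f2)
  then show ?case by (simp add: insertion_add distrib_right)
qed

lemma insertion_Const: "insertion h \<sigma> (Const c) = h c"
  by (simp add: Const_def insertion_single)

lemma insertion_Var: "insertion h \<sigma> (Var i) = \<sigma> i"
  by (simp add: Var_def insertion_single h_1 lookup_single when_def
      if_distrib[of "\<lambda>n. a ^ n" for a] cong: if_cong)

lemma insertion_0: "insertion h \<sigma> 0 = 0"
  using insertion_Const[of \<sigma> 0] h_0 by simp

lemma insertion_uminus: "insertion h \<sigma> (- f) = - insertion h \<sigma> f"
  using insertion_add[of \<sigma> f "- f"] insertion_0[of \<sigma>] by (simp add: eq_neg_iff_add_eq_0 add.commute)

lemma insertion_diff: "insertion h \<sigma> (f - g) = insertion h \<sigma> f - insertion h \<sigma> g"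
  using insertion_add[of \<sigma> f "- g"] insertion_uminus[of \<sigma> g] by simp

lemma insertion_sum: "insertion h \<sigma> (sum F A) = (\<Sum>a\<in>A. insertion h \<sigma> (F a))"
  by (induction A rule: infinite_finite_induct) (auto simp: insertion_0 insertion_add)

lemma insertion_power: "insertion h \<sigma> (f ^ n) = insertion h \<sigma> f ^ n"
  using insertion_Const[of \<sigma> 1] h_1 by (induction n) (auto simp: insertion_mult)

lemma insertion_numeral: "insertion h \<sigma> (numeral n) = h (numeral n)"
  using insertion_Const[of \<sigma> "numeral n"] by simp

end

interpretation eval3: scalar_embedding "\<lambda>c::complex. c"
  by unfold_locales auto

lemma eval3_eq_insertion: "eval3 f v = insertion (\<lambda>c. c) (\<lambda>i. v $ i) f"
  by (simp add: eval3_def insertion_def)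

lemma eval3_simps [simp]:
  "eval3 (f + g) v = eval3 f v + eval3 g v"
  "eval3 (f - g) v = eval3 f v - eval3 g v"
  "eval3 (- f) v = - eval3 f v"
  "eval3 (f * g) v = eval3 f v * eval3 g v"
  "eval3 (f ^ n) v = eval3 f v ^ n"
  "eval3 (Const c) v = c"
  "eval3 (Var i) v = v $ i"
  "eval3 (numeral k) v = numeral k"
  "eval3 0 v = 0"
  "eval3 1 v = 1"
  using eval3.insertion_Const[of "\<lambda>i. v $ i" 1]
  by (simp_all add: eval3_eq_insertion eval3.insertion_add eval3.insertion_diff
      eval3.insertion_uminus eval3.insertion_mult eval3.insertion_power eval3.insertion_Const
      eval3.insertion_Var eval3.insertion_numeral eval3.insertion_0)

lemma eval3_sum: "eval3 (sum F A) v = (\<Sum>a\<in>A. eval3 (F a) v)"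
  by (simp add: eval3_eq_insertion eval3.insertion_sum)

lemma eval3_prod_list: "eval3 (prod_list Ps) v = prod_list (map (\<lambda>P. eval3 P v) Ps)"
  by (induction Ps) auto

interpretation Const: scalar_embedding Const
  by unfold_locales (auto simp: Const_add Const_mult)


subsection \<open>Partial derivatives\<close>

lemma pdiff_single:
  "pdiff i (Poly_Mapping.single m c) = Poly_Mapping.single (m - Poly_Mapping.single i 1)
     (of_nat (Poly_Mapping.lookup m i) * c)"
  by (cases "c = 0") (simp_all add: pdiff_def)

lemma pdiff_add [simp]: "pdiff i (f + g) = pdiff i f + pdiff i g"
proof -
  have *: "pdiff i F = (\<Sum>m\<in>A. Poly_Mapping.single (m - Poly_Mapping.single i 1)
       (of_nat (Poly_Mapping.lookup m i) * Poly_Mapping.lookup F m))"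
    if "finite A" "Poly_Mapping.keys F \<subseteq> A" for F A
    unfolding pdiff_def using that
    by (intro sum.mono_neutral_left) (auto simp: in_keys_iff)
  show ?thesis
    using keys_add[of f g]
    by (subst (1 2 3) *[of "Poly_Mapping.keys f \<union> Poly_Mapping.keys g"])
      (auto simp: lookup_add distrib_left single_add sum.distrib)
qed

lemma pdiff_mult [simp]: "pdiff i (f * g) = pdiff i f * g + f * pdiff i g"
proof (induction f rule: poly_mapping_add_induct)
  case (single m c)
  show ?case
  proof (induction g rule: poly_mapping_add_induct)
    case (single n d)
    let ?e = "Poly_Mapping.single i (1::nat)"
    have 1: "n + (m - ?e) = m + n - ?e" if "Poly_Mapping.lookup m i \<noteq> 0"
      using that by (intro poly_mapping_eqI) (auto simp: lookup_add lookup_minus lookup_single when_def)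
    have 2: "m + (n - ?e) = m + n - ?e" if "Poly_Mapping.lookup n i \<noteq> 0"
      using that by (intro poly_mapping_eqI) (auto simp: lookup_add lookup_minus lookup_single when_def)
    consider "Poly_Mapping.lookup m i = 0" "Poly_Mapping.lookup n i = 0"
      | "Poly_Mapping.lookup m i = 0" "Poly_Mapping.lookup n i \<noteq> 0"
      | "Poly_Mapping.lookup m i \<noteq> 0" "Poly_Mapping.lookup n i = 0"
      | "Poly_Mapping.lookup m i \<noteq> 0" "Poly_Mapping.lookup n i \<noteq> 0" by blast
    then show ?case
      by cases (use 1 2 in \<open>simp_all add: mult_single pdiff_single lookup_add distrib_left
          distrib_right single_add mult_ac add.commute[of _ n]\<close>)
  next
    case (add g1 g2)
    then show ?case by (simp add: distrib_left add_ac)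
  qed
next
  case (add f1 f2)
  then show ?case by (simp add: distrib_right add_ac)
qed

lemma pdiff_Const [simp]: "pdiff i (Const c) = 0"
  by (simp add: Const_def pdiff_single)

lemma pdiff_numeral [simp]: "pdiff i (numeral n) = 0"
  using pdiff_Const[of i "numeral n"] by simp

lemma pdiff_0 [simp]: "pdiff i 0 = 0"
  using pdiff_Const[of i 0] by simp

lemma pdiff_1 [simp]: "pdiff i 1 = 0"
  using pdiff_Const[of i 1] by simp

lemma pdiff_uminus [simp]: "pdiff i (- f) = - pdiff i f"
  using pdiff_add[of i f "- f"] by (simp add: eq_neg_iff_add_eq_0 add.commute)

lemma pdiff_diff [simp]: "pdiff i (f - g) = pdiff i f - pdiff i g"
  using pdiff_add[of i f "- g"] by simp

lemma pdiff_Var: "pdiff i (Var j) = (if i = j then 1 else 0)"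
  by (simp add: Var_def pdiff_single lookup_single when_def)

lemma pdiff_Var_simps [simp]:
  "pdiff 1 X = 1" "pdiff 2 X = 0" "pdiff 3 X = 0"
  "pdiff 1 Y = 0" "pdiff 2 Y = 1" "pdiff 3 Y = 0"
  "pdiff 1 Z = 0" "pdiff 2 Z = 0" "pdiff 3 Z = 1"
  by (simp_all add: pdiff_Var)

lemma pdiff_power2 [simp]: "pdiff i (f ^ 2) = 2 * f * pdiff i f"
  by (simp add: power2_eq_square)

text \<open>Links the formal derivatives, on which singular points and the Jacobian ideal rest, with
  the analytic derivative that the local coordinates at a singular point require.\<close>

lemma has_derivative_eval3:
  "((\<lambda>w. eval3 f w) has_derivative (\<lambda>h. \<Sum>i\<in>UNIV. eval3 (pdiff i f) w * h $ i)) (at w)"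
proof (induction f rule: poly3_induct)
  case (Var i)
  have "((\<lambda>w::complex^3. w $ i) has_derivative (\<lambda>h. h $ i)) (at w)"
    by (rule bounded_linear.has_derivative[OF bounded_linear_vec_nth]) (rule has_derivative_ident)
  moreover have "(\<Sum>j\<in>UNIV. eval3 (pdiff j (Var i)) w * h $ j) = h $ i" for h
  proof -
    have "(\<Sum>j\<in>UNIV. eval3 (pdiff j (Var i)) w * h $ j) = (\<Sum>j\<in>UNIV. if j = i then h $ j else 0)"
      by (intro sum.cong) (auto simp: pdiff_Var)
    then show ?thesis by simp
  qed
  ultimately show ?case by simp
next
  case (add f g)
  then show ?case
    by (auto intro!: derivative_eq_intros simp: distrib_right sum.distrib)
next
  case (mult f g)
  then show ?case
    by (auto intro!: derivative_eq_intros
        simp: distrib_left distrib_right sum.distrib sum_distrib_left fun_eq_iff mult_ac)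
qed auto

lemma continuous_on_eval3: "continuous_on A (eval3 f)"
  by (intro continuous_at_imp_continuous_on ballI has_derivative_continuous[OF has_derivative_eval3])


subsection \<open>Homogeneous polynomials\<close>

lemma mon_deg_add: "mon_deg (m + n) = mon_deg m + mon_deg n"
  by (simp add: mon_deg_def lookup_add sum.distrib)

lemma mon_deg_single [simp]: "mon_deg (Poly_Mapping.single i n) = n"
  by (simp add: mon_deg_def lookup_single when_def)

lemma mon_deg_0 [simp]: "mon_deg 0 = 0"
  by (simp add: mon_deg_def)

lemma homogeneous_0 [simp]: "homogeneous d 0"
  by (simp add: homogeneous_def)

lemma homogeneous_Const [simp]: "homogeneous 0 (Const c)"
  by (auto simp: homogeneous_def Const_def)

lemma homogeneous_numeral [simp]: "homogeneous 0 (numeral n)"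
  using homogeneous_Const[of "numeral n"] by simp

lemma homogeneous_1 [simp]: "homogeneous 0 1"
  using homogeneous_Const[of 1] by simp

lemma homogeneous_Var [simp]: "homogeneous 1 (Var i)"
  by (auto simp: homogeneous_def Var_def)

lemma homogeneous_add: "homogeneous d f \<Longrightarrow> homogeneous d g \<Longrightarrow> homogeneous d (f + g)"
  using keys_add[of f g] by (auto simp: homogeneous_def)

lemma homogeneous_uminus: "homogeneous d f \<Longrightarrow> homogeneous d (- f)"
  by (auto simp: homogeneous_def in_keys_iff)

lemma homogeneous_diff: "homogeneous d f \<Longrightarrow> homogeneous d g \<Longrightarrow> homogeneous d (f - g)"
  using homogeneous_add[of d f "- g"] homogeneous_uminus[of d g] by simp

lemma homogeneous_mult: "homogeneous d f \<Longrightarrow> homogeneous e g \<Longrightarrow> homogeneous (d + e) (f * g)"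
  using keys_mult[of f g] by (force simp: homogeneous_def mon_deg_add)

lemma homogeneous_sum: "(\<And>a. a \<in> A \<Longrightarrow> homogeneous d (F a)) \<Longrightarrow> homogeneous d (sum F A)"
  by (induction A rule: infinite_finite_induct) (auto intro: homogeneous_add)

lemma homogeneous_power: "homogeneous d f \<Longrightarrow> homogeneous (int n * d) (f ^ n)"
proof (induction n)
  case (Suc n)
  then show ?case using homogeneous_mult[of d f "int n * d" "f ^ n"] by (simp add: algebra_simps)
qed simp

lemma homogeneous_unique:
  assumes "homogeneous d f" "homogeneous e f" "f \<noteq> 0"
  shows "d = e"
proof -
  obtain m where "m \<in> Poly_Mapping.keys f"
    using assms(3) by (metis keys_eq_empty all_not_in_conv)
  with assms show ?thesis by (auto simp: homogeneous_def)
qed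

lemma homogeneous_nonneg: "homogeneous d f \<Longrightarrow> f \<noteq> 0 \<Longrightarrow> d \<ge> 0"
  by (metis keys_eq_empty all_not_in_conv homogeneous_def of_nat_0_le_iff)

lemma total_degree_homogeneous:
  assumes "homogeneous d f" "f \<noteq> 0"
  shows "int (total_degree f) = d"
proof -
  have "mon_deg ` Poly_Mapping.keys f = {nat d}"
    using assms by (auto simp: homogeneous_def) (metis keys_eq_empty all_not_in_conv image_eqI nat_int)
  then show ?thesis using homogeneous_nonneg[OF assms] by (simp add: total_degree_def)
qed

lemma eval3_scale:
  assumes "homogeneous (int d) f"
  shows "eval3 f (c *s v) = c ^ d * eval3 f v"
proof -
  have "Poly_Mapping.lookup f m * (\<Prod>i\<in>UNIV. (c *s v) $ i ^ Poly_Mapping.lookup m i)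
      = c ^ d * (Poly_Mapping.lookup f m * (\<Prod>i\<in>UNIV. v $ i ^ Poly_Mapping.lookup m i))"
    if "m \<in> Poly_Mapping.keys f" for m
  proof -
    have "mon_deg m = d" using assms that by (auto simp: homogeneous_def)
    then have "(\<Prod>i\<in>UNIV. c ^ Poly_Mapping.lookup m i) = c ^ d"
      by (simp add: mon_deg_def flip: power_sum)
    then show ?thesis by (simp add: power_mult_distrib prod.distrib)
  qed
  then show ?thesis unfolding eval3_def sum_distrib_left by (intro sum.cong) auto
qed

section \<open>Homogeneous components\<close>

definition hcomp :: "int \<Rightarrow> poly3 \<Rightarrow> poly3" where
  "hcomp d f = (\<Sum>m\<in>{m \<in> Poly_Mapping.keys f. int (mon_deg m) = d}.
     Poly_Mapping.single m (Poly_Mapping.lookup f m))"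

lemma lookup_hcomp:
  "Poly_Mapping.lookup (hcomp d f) m = (if int (mon_deg m) = d then Poly_Mapping.lookup f m else 0)"
  by (auto simp: hcomp_def lookup_sum lookup_single when_def in_keys_iff)

lemma hcomp_add: "hcomp d (f + g) = hcomp d f + hcomp d g"
  by (rule poly_mapping_eqI) (auto simp: lookup_hcomp lookup_add)

lemma hcomp_0 [simp]: "hcomp d 0 = 0"
  by (rule poly_mapping_eqI) (auto simp: lookup_hcomp)

lemma hcomp_diff: "hcomp d (f - g) = hcomp d f - hcomp d g"
  by (rule poly_mapping_eqI) (auto simp: lookup_hcomp lookup_minus)

lemma hcomp_sum: "hcomp d (sum F A) = (\<Sum>a\<in>A. hcomp d (F a))"
  by (induction A rule: infinite_finite_induct) (auto simp: hcomp_add)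

lemma homogeneous_hcomp [simp]: "homogeneous d (hcomp d f)"
  by (auto simp: homogeneous_def in_keys_iff lookup_hcomp split: if_splits)

lemma hcomp_homogeneous: "homogeneous d f \<Longrightarrow> hcomp d f = f"
  by (rule poly_mapping_eqI) (auto simp: lookup_hcomp homogeneous_def in_keys_iff)

lemma hcomp_homogeneous_other: "homogeneous d f \<Longrightarrow> e \<noteq> d \<Longrightarrow> hcomp e f = 0"
  by (rule poly_mapping_eqI) (auto simp: lookup_hcomp homogeneous_def in_keys_iff)

lemma hcomp_single:
  "hcomp d (Poly_Mapping.single m c) = (if int (mon_deg m) = d then Poly_Mapping.single m c else 0)"
  by (rule poly_mapping_eqI) (auto simp: lookup_hcomp lookup_single when_def)

text \<open>Multiplication by a monomial of degree e shifts all degrees by e. With this, cofactors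
  and preimages can always be replaced by homogeneous ones.\<close>

lemma hcomp_mult_left:
  assumes "homogeneous e h"
  shows "hcomp d (h * f) = h * hcomp (d - e) f"
proof -
  have h: "h = (\<Sum>m\<in>Poly_Mapping.keys h. Poly_Mapping.single m (Poly_Mapping.lookup h m))"
    by (rule poly_mapping_eqI) (auto simp: lookup_sum lookup_single when_def in_keys_iff)
  have "hcomp d (Poly_Mapping.single m c * f) = Poly_Mapping.single m c * hcomp (d - e) f"
    if "m \<in> Poly_Mapping.keys h" for m c
  proof -
    have e: "int (mon_deg m) = e" using that assms by (auto simp: homogeneous_def)
    show ?thesis
    proof (induction f rule: poly_mapping_add_induct)
      case (single n a)
      have "int (mon_deg (m + n)) = d \<longleftrightarrow> int (mon_deg n) = d - e"
        using e by (auto simp: mon_deg_add)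
      then show ?case by (simp add: mult_single hcomp_single)
    qed (simp add: distrib_left hcomp_add)
  qed
  then have "hcomp d ((\<Sum>m\<in>Poly_Mapping.keys h. Poly_Mapping.single m (Poly_Mapping.lookup h m)) * f)
      = (\<Sum>m\<in>Poly_Mapping.keys h. Poly_Mapping.single m (Poly_Mapping.lookup h m)) * hcomp (d - e) f"
    by (simp add: sum_distrib_right hcomp_sum)
  then show ?thesis by (simp flip: h)
qed

text \<open>In a domain the extreme components of two factors have a nonzero product. So the largest
  degrees of the factors add up to d, and so do the least ones, which leaves no gap between largest
  and least degree of either factor.\<close>

lemma homogeneous_factor:
  assumes "homogeneous d (f * g)" "f * g \<noteq> 0"
  obtains e where "homogeneous e f" "homogeneous (d - e) g" "0 \<le> e" "e \<le> d"
proof -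
  have fg: "f \<noteq> 0" "g \<noteq> 0" using assms(2) by auto
  have extreme: "\<exists>a\<in>A. \<forall>b\<in>A. r * int b \<le> r * int a" if "finite A" "A \<noteq> {}" "r = 1 \<or> r = -1"
    for A :: "nat set" and r :: int
  proof (cases "r = 1")
    case True
    then show ?thesis using that(1,2) by (intro bexI[of _ "Max A"]) auto
  next
    case False
    then show ?thesis using that by (intro bexI[of _ "Min A"]) auto
  qed
  text \<open>For r = 1 the components of largest degree are multiplied, for r = -1 those of least degree.\<close>
  have top: "\<exists>a\<in>mon_deg ` Poly_Mapping.keys f. \<exists>b\<in>mon_deg ` Poly_Mapping.keys g.
      int a + int b = d \<and> (\<forall>a'\<in>mon_deg ` Poly_Mapping.keys f. r * int a' \<le> r * int a)
      \<and> (\<forall>b'\<in>mon_deg ` Poly_Mapping.keys g. r * int b' \<le> r * int b)" if r: "r = 1 \<or> r = -1" for r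
  proof -
    obtain a where a: "a \<in> mon_deg ` Poly_Mapping.keys f"
      "\<And>a'. a' \<in> mon_deg ` Poly_Mapping.keys f \<Longrightarrow> r * int a' \<le> r * int a"
      using extreme[of "mon_deg ` Poly_Mapping.keys f" r] fg r by auto
    obtain b where b: "b \<in> mon_deg ` Poly_Mapping.keys g"
      "\<And>b'. b' \<in> mon_deg ` Poly_Mapping.keys g \<Longrightarrow> r * int b' \<le> r * int b"
      using extreme[of "mon_deg ` Poly_Mapping.keys g" r] fg r by auto
    have nz: "hcomp (int a) f \<noteq> 0" "hcomp (int b) g \<noteq> 0"
    proof -
      from a obtain m where "m \<in> Poly_Mapping.keys f" "mon_deg m = a" by auto
      then have "Poly_Mapping.lookup (hcomp (int a) f) m \<noteq> 0" by (simp add: lookup_hcomp in_keys_iff)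
      then show "hcomp (int a) f \<noteq> 0" by auto
      from b obtain m where "m \<in> Poly_Mapping.keys g" "mon_deg m = b" by auto
      then have "Poly_Mapping.lookup (hcomp (int b) g) m \<noteq> 0" by (simp add: lookup_hcomp in_keys_iff)
      then show "hcomp (int b) g \<noteq> 0" by auto
    qed
    have split: "F = (\<Sum>k\<in>mon_deg ` Poly_Mapping.keys F. hcomp (int k) F)" for F
    proof (rule poly_mapping_eqI)
      fix m
      show "Poly_Mapping.lookup F m
          = Poly_Mapping.lookup (\<Sum>k\<in>mon_deg ` Poly_Mapping.keys F. hcomp (int k) F) m"
        by (cases "m \<in> Poly_Mapping.keys F") (auto simp: lookup_sum lookup_hcomp in_keys_iff)
    qed
    have "hcomp (int a + int b) (f * g) = (\<Sum>k\<in>mon_deg ` Poly_Mapping.keys f.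
        hcomp (int a + int b) (hcomp (int k) f * g))"
      by (subst (1) split[of f]) (simp add: sum_distrib_right hcomp_sum)
    also have "\<dots> = (\<Sum>k\<in>mon_deg ` Poly_Mapping.keys f.
        if k = a then hcomp (int a) f * hcomp (int b) g else 0)"
    proof (intro sum.cong refl)
      fix k assume k: "k \<in> mon_deg ` Poly_Mapping.keys f"
      have *: "hcomp (int a + int b) (hcomp (int k) f * g)
          = hcomp (int k) f * hcomp (int a + int b - int k) g"
        by (rule hcomp_mult_left) simp
      have "hcomp (int a + int b - int k) g = 0" if "k \<noteq> a"
      proof (rule poly_mapping_eqI)
        fix m
        have "r * int k < r * int a" using a(2)[OF k] that r by auto
        then have "int (mon_deg m) = int a + int b - int k \<Longrightarrow> r * int b < r * int (mon_deg m)"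
          using r by auto
        then show "Poly_Mapping.lookup (hcomp (int a + int b - int k) g) m = Poly_Mapping.lookup 0 m"
          using b(2)[of "mon_deg m"] by (force simp: lookup_hcomp in_keys_iff)
      qed
      with * show "hcomp (int a + int b) (hcomp (int k) f * g)
          = (if k = a then hcomp (int a) f * hcomp (int b) g else 0)" by auto
    qed
    also have "\<dots> = hcomp (int a) f * hcomp (int b) g" using a(1) by simp
    finally have "hcomp (int a + int b) (f * g) \<noteq> 0" using nz by simp
    then have "int a + int b = d"
      using hcomp_homogeneous_other[OF assms(1)] by metis
    with a b show ?thesis by blast
  qed
  obtain a b where ab: "int a + int b = d" "\<And>a'. a' \<in> mon_deg ` Poly_Mapping.keys f \<Longrightarrow> int a' \<le> int a"
      "\<And>b'. b' \<in> mon_deg ` Poly_Mapping.keys g \<Longrightarrow> int b' \<le> int b"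
    using top[of 1] by auto
  obtain a2 b2 where ab2: "a2 \<in> mon_deg ` Poly_Mapping.keys f" "b2 \<in> mon_deg ` Poly_Mapping.keys g"
      "int a2 + int b2 = d" "\<And>a'. a' \<in> mon_deg ` Poly_Mapping.keys f \<Longrightarrow> int a2 \<le> int a'"
      "\<And>b'. b' \<in> mon_deg ` Poly_Mapping.keys g \<Longrightarrow> int b2 \<le> int b'"
    using top[of "-1"] by auto
  have eq: "a2 = a" "b2 = b" using ab(1) ab(2)[OF ab2(1)] ab(3)[OF ab2(2)] ab2(3) by auto
  have "homogeneous (int a) f"
    unfolding homogeneous_def using ab(2) ab2(4) eq by (metis antisym image_eqI)
  moreover have "homogeneous (d - int a) g"
    unfolding homogeneous_def using ab(1,3) ab2(5) eq by (metis add_diff_cancel_left' antisym image_eqI)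
  ultimately show thesis using that[of "int a"] ab(1) by auto
qed

lemma homogeneous_pdiff:
  assumes "homogeneous d f"
  shows "homogeneous (d - 1) (pdiff i f)"
  unfolding pdiff_def
proof (rule homogeneous_sum)
  fix m assume m: "m \<in> Poly_Mapping.keys f"
  show "homogeneous (d - 1) (Poly_Mapping.single (m - Poly_Mapping.single i 1)
      (of_nat (Poly_Mapping.lookup m i) * Poly_Mapping.lookup f m))"
  proof (cases "Poly_Mapping.lookup m i = 0")
    case False
    then have "m = (m - Poly_Mapping.single i 1) + Poly_Mapping.single i 1"
      by (intro poly_mapping_eqI) (auto simp: lookup_add lookup_minus lookup_single when_def)
    then have "mon_deg m = mon_deg (m - Poly_Mapping.single i 1) + 1"
      by (metis mon_deg_add mon_deg_single)
    then show ?thesis using m assms by (auto simp: homogeneous_def)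
  qed simp
qed


section \<open>The Koszul complex of the three variables\<close>

text \<open>Division by \<open>Var i\<close> that discards the terms without \<open>Var i\<close>: a
  left inverse of multiplication by \<open>Var i\<close> that commutes with multiplication by the
  other variables.\<close>

definition lower :: "3 \<Rightarrow> poly3 \<Rightarrow> poly3" where
  "lower i f = Poly_Mapping.map_key (\<lambda>m. m + Poly_Mapping.single i 1) f"

lemma lookup_lower: "Poly_Mapping.lookup (lower i f) m = Poly_Mapping.lookup f (m + Poly_Mapping.single i 1)"
  unfolding lower_def by (subst map_key.rep_eq) (auto simp: inj_def)

lemma lookup_Var_mult:
  "Poly_Mapping.lookup (Var i * f) m = (if Poly_Mapping.lookup m i = 0 then 0
     else Poly_Mapping.lookup f (m - Poly_Mapping.single i 1))"
proof (induction f rule: poly_mapping_add_induct)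
  case (single n c)
  have "Poly_Mapping.single i 1 + n = m \<longleftrightarrow> Poly_Mapping.lookup m i \<noteq> 0 \<and> n = m - Poly_Mapping.single i 1"
  proof
    assume "Poly_Mapping.single i 1 + n = m"
    then show "Poly_Mapping.lookup m i \<noteq> 0 \<and> n = m - Poly_Mapping.single i 1"
      by (auto simp: lookup_add)
  next
    assume *: "Poly_Mapping.lookup m i \<noteq> 0 \<and> n = m - Poly_Mapping.single i 1"
    show "Poly_Mapping.single i 1 + n = m"
      by (rule poly_mapping_eqI) (use * in \<open>auto simp: lookup_add lookup_minus lookup_single when_def\<close>)
  qed
  then show ?case by (auto simp: Var_def mult_single lookup_single when_def)
next
  case (add f g)
  then show ?case by (auto simp: distrib_left lookup_add)
qed

lemma lower_add: "lower i (f + g) = lower i f + lower i g"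
  by (rule poly_mapping_eqI) (simp add: lookup_lower lookup_add)

lemma lower_0 [simp]: "lower i 0 = 0"
  by (rule poly_mapping_eqI) (simp add: lookup_lower)

lemma lower_Var_mult_same [simp]: "lower i (Var i * f) = f"
  by (rule poly_mapping_eqI) (simp add: lookup_lower lookup_Var_mult lookup_add)

lemma lower_Var_mult_other: "i \<noteq> j \<Longrightarrow> lower i (Var j * f) = Var j * lower i f"
proof (rule poly_mapping_eqI)
  fix m :: "3 \<Rightarrow>\<^sub>0 nat" assume ij: "i \<noteq> j"
  moreover have "m + Poly_Mapping.single i 1 - Poly_Mapping.single j 1
      = m - Poly_Mapping.single j 1 + Poly_Mapping.single i 1" if "Poly_Mapping.lookup m j \<noteq> 0"
    using that ij by (intro poly_mapping_eqI) (auto simp: lookup_add lookup_minus lookup_single when_def)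
  ultimately show "Poly_Mapping.lookup (lower i (Var j * f)) m = Poly_Mapping.lookup (Var j * lower i f) m"
    by (auto simp: lookup_lower lookup_Var_mult lookup_add lookup_single when_def)
qed

lemma Var_neq_0 [simp]: "Var i \<noteq> 0"
  using lookup_single_eq[of "Poly_Mapping.single i (1::nat)" "1::complex"]
  by (metis Var_def lookup_zero zero_neq_one)

text \<open>Distinct variables are coprime: \<open>lower i\<close> cancels \<open>Var i\<close> on
  the left and passes \<open>Var j\<close> on the right, which exhibits the common cofactor.\<close>

lemma Var_mult_eq_Var_mult:
  assumes "Var i * a = Var j * b" "i \<noteq> j"
  obtains h where "a = Var j * h" "b = Var i * h"
proof
  have "a = lower i (Var i * a)" by simp
  also have "\<dots> = Var j * lower i b" using assms by (simp add: lower_Var_mult_other)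
  finally show a: "a = Var j * lower i b" .
  from assms(1) a have "Var j * (Var i * lower i b) = Var j * b" by (simp add: mult_ac)
  then show "b = Var i * lower i b" by (simp only: mult_cancel_left Var_neq_0) auto
qed

lemma three_neq [simp]: "(1::3) \<noteq> 2" "(1::3) \<noteq> 3" "(2::3) \<noteq> 3" "(2::3) \<noteq> 1" "(3::3) \<noteq> 1" "(3::3) \<noteq> 2"
  by auto

text \<open>Coprimality of X and Y gives \<open>a\<close> and \<open>b\<close> a common cofactor,
  and cancelling Y in the first equation passes it on to \<open>c\<close>.\<close>

lemma koszul_exact_1:
  assumes "Y * c = Z * b" "Z * a = X * c" "X * b = Y * a"
  shows "\<exists>h. a = X * h \<and> b = Y * h \<and> c = Z * h"
proof -
  obtain h where h: "b = Y * h" "a = X * h"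
    using Var_mult_eq_Var_mult[OF assms(3)] by auto
  have "Y * c = Y * (Z * h)" using assms(1) h by (simp add: mult_ac)
  with h show ?thesis by (simp only: mult_cancel_left Var_neq_0) auto
qed

text \<open>Applying \<open>lower 1\<close> solves for \<open>a\<close> in terms of the quotients
  \<open>b1\<close> and \<open>c1\<close> of \<open>b\<close> and \<open>c\<close> by X. What
  remains is a relation between Y and Z alone, and these are coprime.\<close>

lemma koszul_exact_2:
  assumes "X * a + Y * b + Z * c = 0"
  shows "\<exists>p q r. a = Y * r - Z * q \<and> b = Z * p - X * r \<and> c = X * q - Y * p"
proof -
  define b1 c1 where "b1 = lower 1 b" and "c1 = lower 1 c"
  have "lower 1 (X * a + Y * b + Z * c) = 0" using assms by simp
  then have "a + Y * b1 + Z * c1 = 0"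
    by (simp add: lower_add lower_Var_mult_other b1_def c1_def)
  then have a: "a = - (Y * b1) - Z * c1" by algebra
  have "Y * (b - X * b1) = Z * - (c - X * c1)"
    using assms a by (simp add: algebra_simps)
  then obtain k where k: "b - X * b1 = Z * k" "- (c - X * c1) = Y * k"
    by (rule Var_mult_eq_Var_mult) auto
  have "a = Y * - b1 - Z * c1" using a by simp
  moreover have "b = Z * k - X * - b1" using k(1) by (simp add: algebra_simps)
  moreover have "c = X * c1 - Y * k" using k(2) by (simp add: algebra_simps)
  ultimately show ?thesis by blast
qed

lemma in_ideal_of_variables:
  assumes "Poly_Mapping.lookup f 0 = 0"
  shows "\<exists>a b c. f = X * a + Y * b + Z * c"
proof -
  have "\<exists>a b c. f - Const (Poly_Mapping.lookup f 0) = X * a + Y * b + Z * c"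
  proof (induction f rule: poly_mapping_add_induct)
    case (single m c)
    show ?case
    proof (cases "m = 0")
      case True
      then show ?thesis by (auto simp: Const_def intro!: exI[of _ 0])
    next
      case False
      then obtain i where i: "Poly_Mapping.lookup m i \<noteq> 0"
        by (metis poly_mapping_eqI lookup_zero)
      then have "Poly_Mapping.single i 1 + (m - Poly_Mapping.single i 1) = m"
        by (intro poly_mapping_eqI) (auto simp: lookup_add lookup_minus lookup_single when_def)
      then have "Poly_Mapping.single m c - Const (Poly_Mapping.lookup (Poly_Mapping.single m c) 0)
          = Var i * Poly_Mapping.single (m - Poly_Mapping.single i 1) c"
        using False by (simp add: Var_def mult_single lookup_single Const_def)
      moreover have "\<exists>a b c. Var i * f = X * a + Y * b + Z * c" for f
        using exhaust_3[of i] by (metis add_0 add.right_neutral mult_zero_right)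
      ultimately show ?thesis by presburger
    qed
  next
    case (add f g)
    then obtain a b c a' b' c' where
      *: "f - Const (Poly_Mapping.lookup f 0) = X * a + Y * b + Z * c"
         "g - Const (Poly_Mapping.lookup g 0) = X * a' + Y * b' + Z * c'" by blast
    have "f + g - Const (Poly_Mapping.lookup (f + g) 0)
        = (f - Const (Poly_Mapping.lookup f 0)) + (g - Const (Poly_Mapping.lookup g 0))"
      by (simp add: lookup_add Const_add)
    also have "\<dots> = X * (a + a') + Y * (b + b') + Z * (c + c')"
      unfolding * by (simp add: algebra_simps)
    finally show ?case by blast
  qed
  then show ?thesis using assms by simp
qed

lemma lookup_homogeneous_eq_0:
  "homogeneous d f \<Longrightarrow> int (mon_deg m) \<noteq> d \<Longrightarrow> Poly_Mapping.lookup f m = 0"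
  by (auto simp: homogeneous_def in_keys_iff)

lemma homogeneous_Var_mult: "homogeneous d f \<Longrightarrow> homogeneous (d + 1) (Var i * f)"
  using homogeneous_mult[OF homogeneous_Var, of d f i] by (metis add.commute)

lemma hcomp_Var_mult: "hcomp d (Var i * f) = Var i * hcomp (d - 1) f"
  by (rule hcomp_mult_left) simp

lemma lookup_Var_mult_0 [simp]: "Poly_Mapping.lookup (Var i * f) 0 = 0"
  by (simp add: lookup_Var_mult)


section \<open>The socle and the last graded Betti numbers\<close>

definition socle_elem :: "int \<Rightarrow> poly3 set \<Rightarrow> poly3 \<Rightarrow> bool" where
  "socle_elem d I g \<longleftrightarrow> homogeneous d g \<and> g \<notin> I \<and> (\<forall>i. Var i * g \<in> I)"

locale graded_ideal =
  fixes I :: "poly3 set"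
  assumes zero_I: "0 \<in> I"
    and add_I: "f \<in> I \<Longrightarrow> g \<in> I \<Longrightarrow> f + g \<in> I"
    and mult_I: "f \<in> I \<Longrightarrow> h * f \<in> I"
    and hcomp_I: "f \<in> I \<Longrightarrow> hcomp d f \<in> I"
begin

lemma diff_I: "f \<in> I \<Longrightarrow> g \<in> I \<Longrightarrow> f - g \<in> I"
  using add_I[of f "(-1) * g"] mult_I[of g "-1"] by simp

end

locale minimal_resolution = graded_ideal I for I +
  fixes a :: "nat \<Rightarrow> int list" and e :: "nat \<Rightarrow> poly3" and D :: "nat \<Rightarrow> nat \<Rightarrow> nat \<Rightarrow> poly3"
  assumes resolution: "min_graded_free_resolution I a e D"
begin

abbreviation rk :: "nat \<Rightarrow> nat" where "rk i \<equiv> length (a i)"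

definition dif :: "nat \<Rightarrow> (nat \<Rightarrow> poly3) \<Rightarrow> nat \<Rightarrow> poly3" where
  "dif i u k = (\<Sum>l<rk (Suc i). D i k l * u l)"

definition aug :: "(nat \<Rightarrow> poly3) \<Rightarrow> poly3" where
  "aug u = (\<Sum>k<rk 0. u k * e k)"

definition hvec :: "nat \<Rightarrow> int \<Rightarrow> (nat \<Rightarrow> poly3) \<Rightarrow> bool" where
  "hvec i d u \<longleftrightarrow> (\<forall>k<rk i. homogeneous (d - a i ! k) (u k))"

lemma e_hom: "k < rk 0 \<Longrightarrow> homogeneous (a 0 ! k) (e k)"
  and D_hom: "k < rk i \<Longrightarrow> l < rk (Suc i) \<Longrightarrow> homogeneous (a (Suc i) ! l - a i ! k) (D i k l)"
  and aug_surj: "\<exists>u. g - aug u \<in> I"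
  and aug_exact: "aug u \<in> I \<longleftrightarrow> (\<exists>w. \<forall>k<rk 0. u k = dif 0 w k)"
  and dif_exact: "(\<forall>k<rk i. dif i u k = 0) \<longleftrightarrow> (\<exists>w. \<forall>l<rk (Suc i). u l = dif (Suc i) w l)"
  and D_min: "k < rk i \<Longrightarrow> l < rk (Suc i) \<Longrightarrow> Poly_Mapping.lookup (D i k l) 0 = 0"
  using resolution unfolding min_graded_free_resolution_def aug_def dif_def by auto

lemma dif_Var: "dif i (\<lambda>l. Var j * u l) k = Var j * dif i u k"
  by (simp add: dif_def sum_distrib_left mult_ac)

lemma dif_add: "dif i (\<lambda>l. u l + w l) k = dif i u k + dif i w k"
  by (simp add: dif_def sum.distrib distrib_left)

lemma dif_diff: "dif i (\<lambda>l. u l - w l) k = dif i u k - dif i w k"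
  by (simp add: dif_def sum_subtractf right_diff_distrib)

lemma dif_cong: "(\<And>l. l < rk (Suc i) \<Longrightarrow> u l = w l) \<Longrightarrow> dif i u k = dif i w k"
  by (simp add: dif_def)

lemma aug_Var: "aug (\<lambda>l. Var j * u l) = Var j * aug u"
  by (simp add: aug_def sum_distrib_left mult_ac)

lemma dif_dif: "l < rk i \<Longrightarrow> dif i (dif (Suc i) w) l = 0"
  using dif_exact[of i "dif (Suc i) w"] by auto

lemma dif_hom:
  assumes "hvec (Suc i) d u" "k < rk i"
  shows "homogeneous (d - a i ! k) (dif i u k)"
  unfolding dif_def
proof (rule homogeneous_sum)
  fix l assume "l \<in> {..<rk (Suc i)}"
  then show "homogeneous (d - a i ! k) (D i k l * u l)"
    using homogeneous_mult[OF D_hom[of k i l], of "d - a (Suc i) ! l" "u l"] assms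
    by (auto simp: hvec_def)
qed

lemma hvec_dif: "hvec (Suc i) d u \<Longrightarrow> hvec i d (dif i u)"
  using dif_hom by (auto simp: hvec_def)

lemma hvec_Var: "hvec i d u \<Longrightarrow> hvec i (d + 1) (\<lambda>k. Var j * u k)"
  unfolding hvec_def using homogeneous_Var_mult by (metis (no_types, lifting) diff_add_eq)

lemma hvec_add: "hvec i d u \<Longrightarrow> hvec i d w \<Longrightarrow> hvec i d (\<lambda>k. u k + w k)"
  unfolding hvec_def by (auto intro: homogeneous_add)

lemma hvec_diff: "hvec i d u \<Longrightarrow> hvec i d w \<Longrightarrow> hvec i d (\<lambda>k. u k - w k)"
  unfolding hvec_def by (auto intro: homogeneous_diff)

text \<open>The differentials preserve degrees, so the components of the right degrees of any
  preimage still form a preimage. It keeps the lifts of the chases homogeneous, so that degrees can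
  be compared in F 3.\<close>

lemma homogeneous_preimage:
  assumes "hvec i d u" "\<forall>k<rk i. u k = dif i w k"
  obtains w' where "hvec (Suc i) d w'" "\<And>k. k < rk i \<Longrightarrow> dif i w' k = u k"
proof
  define w' where "w' = (\<lambda>l. hcomp (d - a (Suc i) ! l) (w l))"
  show "hvec (Suc i) d w'" by (simp add: hvec_def w'_def)
  fix k assume k: "k < rk i"
  have "D i k l * w' l = hcomp (d - a i ! k) (D i k l * w l)" if "l < rk (Suc i)" for l
    using hcomp_mult_left[OF D_hom[OF k that], of "d - a i ! k" "w l"] by (simp add: w'_def)
  then have "dif i w' k = hcomp (d - a i ! k) (dif i w k)"
    by (simp add: dif_def hcomp_sum)
  also have "\<dots> = u k" using assms k by (simp add: hvec_def hcomp_homogeneous)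
  finally show "dif i w' k = u k" .
qed

lemma lift_aug:
  assumes "hvec 0 d u" "aug u \<in> I"
  obtains w where "hvec 1 d w" "\<And>k. k < rk 0 \<Longrightarrow> dif 0 w k = u k"
  using assms aug_exact homogeneous_preimage[of 0 d u] by (metis One_nat_def)

lemma lift_dif:
  assumes "hvec (Suc i) d u" "\<And>k. k < rk i \<Longrightarrow> dif i u k = 0"
  obtains w where "hvec (Suc (Suc i)) d w" "\<And>k. k < rk (Suc i) \<Longrightarrow> dif (Suc i) w k = u k"
  using assms dif_exact homogeneous_preimage[of "Suc i" d u] by metis

lemma aug_hom:
  assumes "hvec 0 d u"
  shows "homogeneous d (aug u)"
  unfolding aug_def
proof (rule homogeneous_sum)
  fix k assume "k \<in> {..<rk 0}"
  then show "homogeneous d (u k * e k)"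
    using homogeneous_mult[OF _ e_hom[of k], of "d - a 0 ! k" "u k"] assms by (auto simp: hvec_def)
qed

lemma aug_lift:
  assumes "homogeneous d g"
  obtains u where "hvec 0 d u" "g - aug u \<in> I"
proof -
  obtain w where w: "g - aug w \<in> I" using aug_surj by blast
  define u where "u = (\<lambda>k. hcomp (d - a 0 ! k) (w k))"
  have "w k * e k = e k * w k" for k by (simp add: mult.commute)
  have "u k * e k = hcomp d (w k * e k)" if "k < rk 0" for k
    using hcomp_mult_left[OF e_hom[OF that], of d "w k"] by (simp add: u_def mult.commute)
  then have "aug u = hcomp d (aug w)" by (simp add: aug_def hcomp_sum)
  then have "g - aug u = hcomp d (g - aug w)"
    by (simp add: hcomp_diff hcomp_homogeneous assms)
  with w hcomp_I have "g - aug u \<in> I" by simp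
  moreover have "hvec 0 d u" by (simp add: hvec_def u_def)
  ultimately show thesis by (rule that[rotated])
qed

lemma koszul_exact_1_vec:
  assumes "\<And>k. k < rk i \<Longrightarrow> Y * c k = Z * b k" "\<And>k. k < rk i \<Longrightarrow> Z * a' k = X * c k"
    "\<And>k. k < rk i \<Longrightarrow> X * b k = Y * a' k" "hvec i (d + 1) a'"
  obtains h where "hvec i d h"
    "\<And>k. k < rk i \<Longrightarrow> a' k = X * h k \<and> b k = Y * h k \<and> c k = Z * h k"
proof -
  have "\<exists>h. k < rk i \<longrightarrow> a' k = X * h \<and> b k = Y * h \<and> c k = Z * h" for k
    using koszul_exact_1[of "c k" "b k" "a' k"] assms by blast
  then obtain h where h: "\<And>k. k < rk i \<Longrightarrow> a' k = X * h k \<and> b k = Y * h k \<and> c k = Z * h k"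
    by metis
  have "hvec i d h"
    unfolding hvec_def
  proof (intro allI impI)
    fix k assume k: "k < rk i"
    have "X * hcomp (d - a i ! k) (h k) = hcomp (d + 1 - a i ! k) (a' k)"
      using h[OF k] by (simp add: hcomp_Var_mult algebra_simps)
    also have "\<dots> = X * h k" using assms(4) h k by (simp add: hvec_def hcomp_homogeneous)
    finally have "hcomp (d - a i ! k) (h k) = h k" by (simp only: mult_cancel_left Var_neq_0) auto
    then show "homogeneous (d - a i ! k) (h k)" by (metis homogeneous_hcomp)
  qed
  then show thesis using h by (rule that)
qed

lemma koszul_exact_2_vec:
  assumes "\<And>k. k < rk i \<Longrightarrow> X * a' k + Y * b k + Z * c k = 0"
    and "hvec i (d + 1) a'" "hvec i (d + 1) b" "hvec i (d + 1) c"
  shows "\<exists>p q r. hvec i d p \<and> hvec i d q \<and> hvec i d r \<and> (\<forall>k<rk i.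
    a' k = Y * r k - Z * q k \<and> b k = Z * p k - X * r k \<and> c k = X * q k - Y * p k)"
proof -
  have "\<exists>p q r. k < rk i \<longrightarrow> a' k = Y * r - Z * q \<and> b k = Z * p - X * r \<and> c k = X * q - Y * p" for k
    using koszul_exact_2[of "a' k" "b k" "c k"] assms(1) by metis
  then obtain p q r where
    pqr: "\<And>k. k < rk i \<Longrightarrow> a' k = Y * r k - Z * q k \<and> b k = Z * p k - X * r k \<and> c k = X * q k - Y * p k"
    by metis
  define H where "H = (\<lambda>u k. hcomp (d - a i ! k) (u k :: poly3))"
  have H: "hvec i d (H u)" for u by (simp add: hvec_def H_def)
  have shift: "Var j * H u k = hcomp (d + 1 - a i ! k) (Var j * u k)" for j u k
    by (simp add: H_def hcomp_Var_mult algebra_simps)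
  have "a' k = Y * H r k - Z * H q k \<and> b k = Z * H p k - X * H r k \<and> c k = X * H q k - Y * H p k"
    if k: "k < rk i" for k
    unfolding shift hcomp_diff[symmetric]
    using pqr[OF k] assms(2-4) k by (metis hcomp_homogeneous hvec_def)
  then show ?thesis using H by blast
qed

lemma in_ideal_of_variables_vec:
  assumes "\<And>k. k < rk i \<Longrightarrow> Poly_Mapping.lookup (u k) 0 = 0" "hvec i (d + 1) u"
  shows "\<exists>p q r. hvec i d p \<and> hvec i d q \<and> hvec i d r \<and>
    (\<forall>k<rk i. u k = X * p k + Y * q k + Z * r k)"
proof -
  have "\<exists>p q r. k < rk i \<longrightarrow> u k = X * p + Y * q + Z * r" for k
    using in_ideal_of_variables[of "u k"] assms(1) by metis
  then obtain p q r where pqr: "\<And>k. k < rk i \<Longrightarrow> u k = X * p k + Y * q k + Z * r k"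
    by metis
  define H where "H = (\<lambda>u k. hcomp (d - a i ! k) (u k :: poly3))"
  have H: "hvec i d (H u)" for u by (simp add: hvec_def H_def)
  have shift: "Var j * H u k = hcomp (d + 1 - a i ! k) (Var j * u k)" for j u k
    by (simp add: H_def hcomp_Var_mult algebra_simps)
  have "u k = X * H p k + Y * H q k + Z * H r k" if k: "k < rk i" for k
    unfolding shift hcomp_add[symmetric]
    using pqr[OF k] assms(2) k by (metis hcomp_homogeneous hvec_def)
  then show ?thesis using H by blast
qed

text \<open>Both directions chase the double complex of the resolution and the Koszul complex, which
  computes Tor from either side: its third homology is the socle of \<open>S/I\<close>, shifted by three.\<close>

lemma betti_of_socle:
  assumes "socle_elem d I g"
  shows "d + 3 \<in> set (a 3)"
proof (rule ccontr)
  assume no: "d + 3 \<notin> set (a 3)"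
  have g: "homogeneous d g" "g \<notin> I" "\<And>i. Var i * g \<in> I"
    using assms by (auto simp: socle_elem_def)
  \<comment> \<open>The ascending zigzag: \<open>u\<close> lies over g, \<open>p i\<close> over
    \<open>Var i * u\<close>, \<open>Q i j\<close> over the relation between \<open>p i\<close> and
    \<open>p j\<close>, and \<open>t\<close>, of degree d + 3 in F 3, over the last
    relation.\<close>
  obtain u where u: "hvec 0 d u" "g - aug u \<in> I" using aug_lift[OF g(1)] .
  have "aug (\<lambda>k. Var i * u k) \<in> I" for i
  proof -
    have "Var i * g - Var i * (g - aug u) \<in> I" using g(3) u(2) diff_I mult_I by blast
    then show ?thesis by (simp add: aug_Var right_diff_distrib)
  qed
  then have "\<exists>p. hvec 1 (d + 1) p \<and> (\<forall>k<rk 0. dif 0 p k = Var i * u k)" for i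
    using lift_aug[OF hvec_Var[OF u(1), of i]] by metis
  then obtain p where p: "\<And>i. hvec 1 (d + 1) (p i)" "\<And>i k. k < rk 0 \<Longrightarrow> dif 0 (p i) k = Var i * u k"
    by metis
  have "\<exists>q. hvec 2 (d + 2) q \<and> (\<forall>k<rk 1. dif 1 q k = Var i * p j k - Var j * p i k)" for i j
  proof (rule lift_dif[of 0 "d + 2" "\<lambda>k. Var i * p j k - Var j * p i k"])
    show "hvec (Suc 0) (d + 2) (\<lambda>k. Var i * p j k - Var j * p i k)"
      using hvec_diff[OF hvec_Var[OF p(1)[of j], of i] hvec_Var[OF p(1)[of i], of j]]
      by (simp add: add.commute)
    show "dif 0 (\<lambda>k. Var i * p j k - Var j * p i k) k = 0" if "k < rk 0" for k
      using that p(2) by (simp add: dif_diff dif_Var mult_ac)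
  qed (auto simp: numeral_2_eq_2)
  then obtain Q where Q: "\<And>i j. hvec 2 (d + 2) (Q i j)"
    "\<And>i j k. k < rk 1 \<Longrightarrow> dif 1 (Q i j) k = Var i * p j k - Var j * p i k" by metis
  \<comment> \<open>The cyclic order of indices fixes the signs for which X q1 + Y q2 + Z q3 is a
    cycle.\<close>
  define q1 q2 q3 where "q1 = Q 2 3" and "q2 = Q 3 1" and "q3 = Q 1 2"
  have q: "hvec 2 (d + 2) q1" "hvec 2 (d + 2) q2" "hvec 2 (d + 2) q3"
    "\<And>k. k < rk 1 \<Longrightarrow> dif 1 q1 k = Y * p 3 k - Z * p 2 k"
    "\<And>k. k < rk 1 \<Longrightarrow> dif 1 q2 k = Z * p 1 k - X * p 3 k"
    "\<And>k. k < rk 1 \<Longrightarrow> dif 1 q3 k = X * p 2 k - Y * p 1 k"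
    using Q by (auto simp: q1_def q2_def q3_def)
  obtain t where t: "hvec 3 (d + 3) t"
    "\<And>k. k < rk 2 \<Longrightarrow> dif 2 t k = X * q1 k + Y * q2 k + Z * q3 k"
  proof (rule lift_dif[of 1 "d + 3" "\<lambda>k. X * q1 k + Y * q2 k + Z * q3 k"])
    show "hvec (Suc 1) (d + 3) (\<lambda>k. X * q1 k + Y * q2 k + Z * q3 k)"
      using hvec_add[OF hvec_add[OF hvec_Var[OF q(1), of 1] hvec_Var[OF q(2), of 2]] hvec_Var[OF q(3), of 3]]
      by (simp add: numeral_2_eq_2 add.commute[of _ d])
    show "dif 1 (\<lambda>k. X * q1 k + Y * q2 k + Z * q3 k) k = 0" if "k < rk 1" for k
      unfolding dif_add dif_Var q(4)[OF that] q(5)[OF that] q(6)[OF that] by (simp add: algebra_simps)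
  qed (auto simp: numeral_2_eq_2 numeral_3_eq_3)
  \<comment> \<open>A nonzero constant term of \<open>t k\<close> would force \<open>a 3 ! k\<close>
    to be d + 3.\<close>
  have lk: "Poly_Mapping.lookup (t k) 0 = 0" if "k < rk 3" for k
  proof (rule lookup_homogeneous_eq_0[of "d + 3 - a 3 ! k"])
    show "homogeneous (d + 3 - a 3 ! k) (t k)" using t(1) that by (simp add: hvec_def)
    show "int (mon_deg 0) \<noteq> d + 3 - a 3 ! k" using no nth_mem[OF that] by auto
  qed
  have hv: "hvec 3 (d + 2 + 1) t" using t(1) by (simp add: add.assoc)
  obtain s1 s2 s3 where "hvec 3 (d + 2) s1" "hvec 3 (d + 2) s2" "hvec 3 (d + 2) s3"
    and s: "\<And>k. k < rk 3 \<Longrightarrow> t k = X * s1 k + Y * s2 k + Z * s3 k"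
    using in_ideal_of_variables_vec[OF lk hv] by blast
  \<comment> \<open>The descent begins: \<open>t\<close> has entries in the ideal of the variables,
    so changing the lifts by boundaries makes X q1' + Y q2' + Z q3' zero, and Koszul exactness
    applies.\<close>
  define q1' q2' q3' where "q1' = (\<lambda>k. q1 k - dif 2 s1 k)" and "q2' = (\<lambda>k. q2 k - dif 2 s2 k)"
    and "q3' = (\<lambda>k. q3 k - dif 2 s3 k)"
  have ds: "dif 2 t k = X * dif 2 s1 k + Y * dif 2 s2 k + Z * dif 2 s3 k" for k
  proof -
    have "dif 2 t k = dif 2 (\<lambda>k. X * s1 k + Y * s2 k + Z * s3 k) k"
      using s by (intro dif_cong) (auto simp: numeral_2_eq_2 numeral_3_eq_3)
    then show ?thesis by (simp add: dif_add dif_Var)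
  qed
  have dq': "dif 1 q1' k = Y * p 3 k - Z * p 2 k" "dif 1 q2' k = Z * p 1 k - X * p 3 k"
    "dif 1 q3' k = X * p 2 k - Y * p 1 k" if "k < rk 1" for k
    using q(4-6)[OF that] dif_dif[of k 1, OF that]
    by (simp_all add: q1'_def q2'_def q3'_def dif_diff numeral_2_eq_2)
  have "\<exists>p q r. k < rk 2 \<longrightarrow> q1' k = Y * r - Z * q \<and> q2' k = Z * p - X * r \<and> q3' k = X * q - Y * p" for k
    using koszul_exact_2[of "q1' k" "q2' k" "q3' k"] ds[of k] t(2)[of k]
    by (cases "k < rk 2") (auto simp: q1'_def q2'_def q3'_def algebra_simps)
  then obtain r1 r2 r3 where
    r: "\<And>k. k < rk 2 \<Longrightarrow> q1' k = Y * r3 k - Z * r2 k \<and> q2' k = Z * r1 k - X * r3 k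
        \<and> q3' k = X * r2 k - Y * r1 k" by metis
  have dq: "dif 1 q1' k = Y * dif 1 r3 k - Z * dif 1 r2 k" "dif 1 q2' k = Z * dif 1 r1 k - X * dif 1 r3 k"
    "dif 1 q3' k = X * dif 1 r2 k - Y * dif 1 r1 k" for k
  proof -
    have "dif 1 q1' k = dif 1 (\<lambda>k. Y * r3 k - Z * r2 k) k" "dif 1 q2' k = dif 1 (\<lambda>k. Z * r1 k - X * r3 k) k"
      "dif 1 q3' k = dif 1 (\<lambda>k. X * r2 k - Y * r1 k) k"
      using r by (auto intro!: dif_cong simp: numeral_2_eq_2)
    then show "dif 1 q1' k = Y * dif 1 r3 k - Z * dif 1 r2 k" "dif 1 q2' k = Z * dif 1 r1 k - X * dif 1 r3 k"
      "dif 1 q3' k = X * dif 1 r2 k - Y * dif 1 r1 k" by (simp_all add: dif_diff dif_Var)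
  qed
  \<comment> \<open>After this second correction the three lifts have vanishing minors with (X, Y,
    Z), hence a common cofactor \<open>h\<close>; dividing by X shows that \<open>u\<close> is the
    image of \<open>h\<close>.\<close>
  define p1 p2 p3 where "p1 = (\<lambda>k. p 1 k - dif 1 r1 k)" and "p2 = (\<lambda>k. p 2 k - dif 1 r2 k)"
    and "p3 = (\<lambda>k. p 3 k - dif 1 r3 k)"
  have "\<exists>h. k < rk 1 \<longrightarrow> p1 k = X * h \<and> p2 k = Y * h \<and> p3 k = Z * h" for k
  proof (cases "k < rk 1")
    case True
    have "Y * p 3 k - Z * p 2 k = Y * dif 1 r3 k - Z * dif 1 r2 k"
      "Z * p 1 k - X * p 3 k = Z * dif 1 r1 k - X * dif 1 r3 k"
      "X * p 2 k - Y * p 1 k = X * dif 1 r2 k - Y * dif 1 r1 k"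
      using dq'[OF True] dq[of k] by simp_all
    then have "Y * p3 k = Z * p2 k" "Z * p1 k = X * p3 k" "X * p2 k = Y * p1 k"
      unfolding p1_def p2_def p3_def by algebra+
    then show ?thesis using koszul_exact_1 by blast
  qed auto
  then obtain h where h: "\<And>k. k < rk 1 \<Longrightarrow> p1 k = X * h k" by metis
  have "u k = dif 0 h k" if k: "k < rk 0" for k
  proof -
    have "X * u k = dif 0 p1 k"
      using k p(2) dif_dif[of k 0 r1] by (simp add: p1_def dif_diff)
    also have "\<dots> = X * dif 0 h k"
      unfolding dif_Var[symmetric] by (rule dif_cong) (simp add: h)
    finally show ?thesis by (simp only: mult_cancel_left Var_neq_0) auto
  qed
  then have "aug u \<in> I" using aug_exact by blast
  then have "g \<in> I" using u(2) add_I[of "g - aug u" "aug u"] by simp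
  with g(2) show False by simp
qed

lemma socle_of_betti:
  assumes "d + 3 \<in> set (a 3)"
  shows "\<exists>g. socle_elem d I g"
proof -
  obtain m where m: "m < rk 3" "a 3 ! m = d + 3" using assms by (metis in_set_conv_nth)
  \<comment> \<open>The basis element of F 3 of degree d + 3. Minimality puts the entries of its
    image \<open>c\<close> into the ideal of the variables, which starts the descent to F 0.\<close>
  define \<epsilon> where "\<epsilon> = (\<lambda>l. if l = m then 1 else 0 :: poly3)"
  define c where "c = dif 2 \<epsilon>"
  have c_eq: "c k = D 2 k m" for k
    using m(1) by (simp add: c_def dif_def \<epsilon>_def numeral_2_eq_2 numeral_3_eq_3 if_distrib cong: if_cong)
  have dc: "dif 1 c k = 0" if "k < rk 1" for k
    using dif_dif[of k 1 \<epsilon>] that by (simp add: c_def numeral_2_eq_2)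
  have "hvec 3 (d + 3) \<epsilon>" using m by (auto simp: hvec_def \<epsilon>_def)
  then have hc: "hvec 2 (d + 3) c"
    using hvec_dif[of 2 "d + 3" \<epsilon>] by (simp add: c_def numeral_2_eq_2 numeral_3_eq_3)
  have lk: "Poly_Mapping.lookup (c k) 0 = 0" if "k < rk 2" for k
    using that m(1) D_min[of k 2 m] by (simp add: c_eq numeral_2_eq_2 numeral_3_eq_3)
  have hv: "hvec 2 (d + 2 + 1) c" using hc by (simp add: add.assoc)
  obtain c1 c2 c3 where c: "hvec 2 (d + 2) c1" "hvec 2 (d + 2) c2" "hvec 2 (d + 2) c3"
    "\<And>k. k < rk 2 \<Longrightarrow> c k = X * c1 k + Y * c2 k + Z * c3 k"
    using in_ideal_of_variables_vec[OF lk hv] by blast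
  have d0: "X * dif 1 c1 k + Y * dif 1 c2 k + Z * dif 1 c3 k = 0" if k: "k < rk 1" for k
  proof -
    have "dif 1 c k = dif 1 (\<lambda>k. X * c1 k + Y * c2 k + Z * c3 k) k"
      using c(4) by (intro dif_cong) (auto simp: numeral_2_eq_2)
    then show ?thesis using dc[OF k] by (simp add: dif_add dif_Var)
  qed
  have hd: "hvec 1 (d + 1 + 1) (dif 1 c1)" "hvec 1 (d + 1 + 1) (dif 1 c2)" "hvec 1 (d + 1 + 1) (dif 1 c3)"
    using hvec_dif[of 1 "d + 2"] c(1-3) by (simp_all add: numeral_2_eq_2 add.assoc)
  obtain b1 b2 b3 where b: "hvec 1 (d + 1) b1" "hvec 1 (d + 1) b2" "hvec 1 (d + 1) b3"
    "\<And>k. k < rk 1 \<Longrightarrow> dif 1 c1 k = Y * b3 k - Z * b2 k \<and> dif 1 c2 k = Z * b1 k - X * b3 k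
       \<and> dif 1 c3 k = X * b2 k - Y * b1 k"
    using koszul_exact_2_vec[OF d0 hd] by blast
  have dd: "dif 0 (dif 1 w) k = 0" if "k < rk 0" for k w
    using dif_dif[of k 0 w] that by simp
  have B: "Y * dif 0 b3 k = Z * dif 0 b2 k" "Z * dif 0 b1 k = X * dif 0 b3 k"
      "X * dif 0 b2 k = Y * dif 0 b1 k" if k: "k < rk 0" for k
  proof -
    have "dif 0 (dif 1 c1) k = dif 0 (\<lambda>k. Y * b3 k - Z * b2 k) k"
      "dif 0 (dif 1 c2) k = dif 0 (\<lambda>k. Z * b1 k - X * b3 k) k"
      "dif 0 (dif 1 c3) k = dif 0 (\<lambda>k. X * b2 k - Y * b1 k) k"
      using b(4) by (auto intro!: dif_cong)
    then show "Y * dif 0 b3 k = Z * dif 0 b2 k" "Z * dif 0 b1 k = X * dif 0 b3 k"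
      "X * dif 0 b2 k = Y * dif 0 b1 k"
      using dd[OF k] by (simp_all add: dif_diff dif_Var)
  qed
  \<comment> \<open>The products of \<open>u\<close> with the three variables are boundaries, so
    \<open>aug u\<close> is the candidate for the socle element.\<close>
  obtain u where u: "hvec 0 d u"
    "\<And>k. k < rk 0 \<Longrightarrow> dif 0 b1 k = X * u k \<and> dif 0 b2 k = Y * u k \<and> dif 0 b3 k = Z * u k"
    using koszul_exact_1_vec[of 0 "dif 0 b3" "dif 0 b2" "dif 0 b1" d] B hvec_dif[of 0 "d + 1" b1] b(1)
    by (metis One_nat_def)
  have "Var i * aug u \<in> I" for i
  proof -
    have "\<exists>w. \<forall>k<rk 0. Var i * u k = dif 0 w k"
      using exhaust_3[of i] u(2) by metis
    then show ?thesis using aug_exact[of "\<lambda>k. Var i * u k"] by (simp add: aug_Var)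
  qed
  moreover have "aug u \<notin> I"
  proof
    \<comment> \<open>If \<open>u\<close> were itself a boundary, every choice could be corrected by
      boundaries on the way back up, until \<open>\<epsilon>\<close> became a boundary modulo the
      variables.\<close>
    assume "aug u \<in> I"
    then obtain q where q: "\<And>k. k < rk 0 \<Longrightarrow> u k = dif 0 q k" using aug_exact by blast
    have "\<exists>w. \<forall>k<rk 1. b k - Var i * q k = dif 1 w k"
      if "\<And>k. k < rk 0 \<Longrightarrow> dif 0 b k = Var i * u k" for b i
    proof -
      have "\<forall>k<rk 0. dif 0 (\<lambda>k. b k - Var i * q k) k = 0"
        using that q by (simp add: dif_diff dif_Var)
      then show ?thesis using dif_exact[of 0 "\<lambda>k. b k - Var i * q k"] by simp
    qed
    then obtain w1 w2 w3 where w: "\<And>k. k < rk 1 \<Longrightarrow> b1 k - X * q k = dif 1 w1 k"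
      "\<And>k. k < rk 1 \<Longrightarrow> b2 k - Y * q k = dif 1 w2 k" "\<And>k. k < rk 1 \<Longrightarrow> b3 k - Z * q k = dif 1 w3 k"
      using u(2) by metis
    define c1' c2' c3' where "c1' = (\<lambda>k. c1 k - (Y * w3 k - Z * w2 k))"
      and "c2' = (\<lambda>k. c2 k - (Z * w1 k - X * w3 k))" and "c3' = (\<lambda>k. c3 k - (X * w2 k - Y * w1 k))"
    have "dif 1 c1' k = 0 \<and> dif 1 c2' k = 0 \<and> dif 1 c3' k = 0" if k: "k < rk 1" for k
      using b(4)[OF k] unfolding c1'_def c2'_def c3'_def dif_diff dif_Var w(1-3)[OF k, symmetric]
      by (simp add: algebra_simps)
    then obtain t1 t2 t3 where t: "\<And>k. k < rk 2 \<Longrightarrow> c1' k = dif 2 t1 k"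
      "\<And>k. k < rk 2 \<Longrightarrow> c2' k = dif 2 t2 k" "\<And>k. k < rk 2 \<Longrightarrow> c3' k = dif 2 t3 k"
      using dif_exact[of 1 c1'] dif_exact[of 1 c2'] dif_exact[of 1 c3'] by (auto simp: numeral_2_eq_2)
    have "dif 2 (\<lambda>l. \<epsilon> l - (X * t1 l + Y * t2 l + Z * t3 l)) k = 0" if k: "k < rk 2" for k
    proof -
      have "c k = X * c1' k + Y * c2' k + Z * c3' k"
        unfolding c(4)[OF k] by (simp add: c1'_def c2'_def c3'_def algebra_simps)
      then show ?thesis using t k by (simp add: dif_diff dif_add dif_Var c_def)
    qed
    then obtain s where s: "\<And>l. l < rk 3 \<Longrightarrow> \<epsilon> l - (X * t1 l + Y * t2 l + Z * t3 l) = dif 3 s l"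
      using dif_exact[of 2 "\<lambda>l. \<epsilon> l - (X * t1 l + Y * t2 l + Z * t3 l)"]
      by (auto simp: numeral_2_eq_2 numeral_3_eq_3)
    have low: "Poly_Mapping.lookup (f * g) 0 = 0" if f: "Poly_Mapping.lookup f 0 = 0" for f g :: poly3
    proof -
      obtain p q r where "f = X * p + Y * q + Z * r" using in_ideal_of_variables[OF f] by blast
      then have "f * g = X * (p * g) + Y * (q * g) + Z * (r * g)" by (simp add: algebra_simps)
      then show ?thesis by (simp add: lookup_add)
    qed
    \<comment> \<open>The contradiction lies in the constant term of the entry m: minimality makes
      it 0 for a boundary, while \<open>\<epsilon>\<close> contributes 1.\<close>
    have "Poly_Mapping.lookup (dif 3 s m) 0 = 0"
      unfolding dif_def lookup_sum using m(1) D_min[of m 3] by (intro sum.neutral) (auto intro: low)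
    moreover have "Poly_Mapping.lookup (\<epsilon> m - (X * t1 m + Y * t2 m + Z * t3 m)) 0 = 1"
      by (simp add: \<epsilon>_def lookup_minus lookup_add)
    ultimately show False using s[OF m(1)] by simp
  qed
  ultimately show ?thesis using aug_hom[OF u(1)] by (auto simp: socle_elem_def)
qed

end

theorem not_same_graded_betti_numbers:
  assumes "graded_ideal I" "graded_ideal J"
    and "\<nexists>g. socle_elem d I g" "socle_elem d J h"
  shows "\<not> same_graded_betti_numbers I J"
proof
  assume "same_graded_betti_numbers I J"
  then obtain a e D b e' D' where *: "min_graded_free_resolution I a e D"
    "min_graded_free_resolution J b e' D'" "\<And>i j. count_list (a i) j = count_list (b i) j"
    unfolding same_graded_betti_numbers_def by blast
  interpret A: minimal_resolution I a e D
    using assms(1) *(1) by (simp add: minimal_resolution_def minimal_resolution_axioms_def)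
  interpret B: minimal_resolution J b e' D'
    using assms(2) *(2) by (simp add: minimal_resolution_def minimal_resolution_axioms_def)
  have "d + 3 \<in> set (b 3)" using B.betti_of_socle assms(4) .
  then have "d + 3 \<in> set (a 3)" using *(3)[of 3 "d + 3"] by (metis count_list_0_iff)
  then show False using A.socle_of_betti assms(3) by blast
qed


section \<open>Unique factorization\<close>

lemma pCons_pCons_power: "[:p:] ^ n = [:p ^ n :: 'a::comm_ring_1:]"
  by (induction n) (auto simp: mult_ac)

interpretation iterated: scalar_embedding "\<lambda>c. [:[:[:c::complex:]:]:]"
  by unfold_locales (auto simp: one_pCons)

definition iterated_var :: "3 \<Rightarrow> complex poly poly poly" where
  "iterated_var i = (if i = 1 then [:0, 1:] else if i = 2 then [:[:0, 1:]:] else [:[:[:0, 1:]:]:])"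

text \<open>An isomorphism onto C[z][y][x]; \<open>coeff_iterate\<close> recovers each coefficient
  and so gives injectivity. It serves to transport unique factorization from iterated univariate
  polynomials.\<close>

definition iterate :: "poly3 \<Rightarrow> complex poly poly poly" where
  "iterate = insertion (\<lambda>c. [:[:[:c:]:]:]) iterated_var"

lemma iterate_add: "iterate (f + g) = iterate f + iterate g"
  and iterate_mult: "iterate (f * g) = iterate f * iterate g"
  and iterate_Const: "iterate (Const c) = [:[:[:c:]:]:]"
  and iterate_Var: "iterate (Var i) = iterated_var i"
  by (simp_all add: iterate_def iterated.insertion_add iterated.insertion_mult
      iterated.insertion_Const iterated.insertion_Var)

lemma iterate_1: "iterate 1 = 1"
  using iterate_Const[of 1] by (simp add: one_pCons)

lemma coeff_iterate:
  "coeff (coeff (coeff (iterate f) (Poly_Mapping.lookup m 1)) (Poly_Mapping.lookup m 2))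
     (Poly_Mapping.lookup m 3) = Poly_Mapping.lookup f m"
proof (induction f rule: poly_mapping_add_induct)
  case (single n c)
  have x: "[:0, 1:] ^ i = (monom 1 i :: 'a::comm_ring_1 poly)" for i
    by (simp add: monom_altdef)
  have "iterate (Poly_Mapping.single n c) = monom (monom (monom c (Poly_Mapping.lookup n 3))
      (Poly_Mapping.lookup n 2)) (Poly_Mapping.lookup n 1)"
    by (simp add: iterate_def iterated.insertion_single prod_3 iterated_var_def pCons_pCons_power
        x smult_monom)
  moreover have "n = m \<longleftrightarrow> Poly_Mapping.lookup n 1 = Poly_Mapping.lookup m 1
      \<and> Poly_Mapping.lookup n 2 = Poly_Mapping.lookup m 2 \<and> Poly_Mapping.lookup n 3 = Poly_Mapping.lookup m 3"
    unfolding poly_mapping_eq_iff fun_eq_iff forall_3 ..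
  ultimately show ?case by (auto simp: lookup_single when_def)
qed (simp add: iterate_add lookup_add)

lemma inj_iterate: "iterate f = iterate g \<Longrightarrow> f = g"
  by (rule poly_mapping_eqI) (metis coeff_iterate)

lemma surj_iterate: "\<exists>f. iterate f = p"
proof -
  have split: "pCons a q = [:a:] + [:0, 1:] * q" for a and q :: "'a::comm_ring_1 poly" by simp
  have 1: "\<exists>f. iterate f = [:[:q:]:]" for q
  proof (induction q)
    case 0
    show ?case using iterate_Const[of 0] by auto
  next
    case (pCons a q)
    then obtain f where "iterate f = [:[:q:]:]" by blast
    then have "iterate (Const a + Z * f) = [:[:pCons a q:]:]"
      by (simp add: iterate_add iterate_mult iterate_Const iterate_Var iterated_var_def)
    then show ?case by blast
  qed
  have 2: "\<exists>f. iterate f = [:q:]" for q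
  proof (induction q)
    case 0
    show ?case using iterate_Const[of 0] by auto
  next
    case (pCons a q)
    obtain f g where "iterate f = [:[:a:]:]" "iterate g = [:q:]" using pCons 1 by blast
    then have "iterate (f + Y * g) = [:pCons a q:]"
      by (simp add: iterate_add iterate_mult iterate_Var iterated_var_def)
    then show ?case by blast
  qed
  show ?thesis
  proof (induction p)
    case 0
    show ?case using iterate_Const[of 0] by auto
  next
    case (pCons a q)
    obtain f g where "iterate f = [:a:]" "iterate g = q" using pCons 2 by blast
    then have "iterate (f + X * g) = pCons a q"
      by (simp add: iterate_add iterate_mult iterate_Var iterated_var_def)
    then show ?case by blast
  qed
qed

lemma iterate_dvd_iff: "iterate f dvd iterate g \<longleftrightarrow> f dvd g"
proof
  assume "iterate f dvd iterate g"
  then obtain k where "iterate g = iterate f * k" by (rule dvdE)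
  then obtain h where "iterate g = iterate (f * h)" using surj_iterate[of k] by (auto simp: iterate_mult)
  then have "g = f * h" by (rule inj_iterate)
  then show "f dvd g" by (rule dvdI)
next
  assume "f dvd g"
  then obtain k where "g = f * k" by (rule dvdE)
  then have "iterate g = iterate f * iterate k" by (simp add: iterate_mult)
  then show "iterate f dvd iterate g" by (rule dvdI)
qed

text \<open>Irreducibility is carried by \<open>iterate\<close> into a factorial ring, where it
  implies primality; \<open>iterate_dvd_iff\<close> brings primality back.\<close>

lemma irreducible_imp_prime_poly3:
  assumes "irreducible (f :: poly3)"
  shows "prime_elem f"
proof -
  have f: "f \<noteq> 0" "\<not> f dvd 1" "\<And>a b. f = a * b \<Longrightarrow> a dvd 1 \<or> b dvd 1"
    using assms by (auto simp: irreducible_def)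
  have "irreducible (iterate f)"
  proof (rule irreducibleI)
    show "iterate f \<noteq> 0" using f(1) inj_iterate[of f 0] iterate_Const[of 0] by auto
    show "\<not> is_unit (iterate f)" using f(2) iterate_dvd_iff[of f 1] by (simp add: iterate_1)
    fix p q assume pq: "iterate f = p * q"
    obtain a b where ab: "iterate a = p" "iterate b = q" using surj_iterate by blast
    with pq have "f = a * b" by (intro inj_iterate) (simp add: iterate_mult)
    then show "is_unit p \<or> is_unit q"
      using f(3)[OF \<open>f = a * b\<close>] ab iterate_dvd_iff[of _ 1] by (metis iterate_1)
  qed
  then have "prime_elem (iterate f)" by (rule irreducible_imp_prime_elem)
  then have "iterate f dvd iterate a * iterate b \<Longrightarrow> iterate f dvd iterate a \<or> iterate f dvd iterate b" for a b
    by (rule prime_elem_dvd_multD)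
  then show ?thesis
    using f by (auto simp: prime_elem_def iterate_dvd_iff simp flip: iterate_mult)
qed

section \<open>Units, linear forms and irreducible components\<close>

lemma mon_deg_eq_0: "mon_deg m = 0 \<Longrightarrow> m = 0"
  by (rule poly_mapping_eqI) (simp add: mon_deg_def)

lemma mon_deg_eq_1:
  assumes "mon_deg m = 1"
  shows "\<exists>i. m = Poly_Mapping.single i 1"
proof -
  have "m \<noteq> 0" using assms by auto
  then obtain i where i: "Poly_Mapping.lookup m i \<noteq> 0" by (metis poly_mapping_eqI lookup_zero)
  then have m: "m = Poly_Mapping.single i 1 + (m - Poly_Mapping.single i 1)"
    by (intro poly_mapping_eqI) (auto simp: lookup_add lookup_minus lookup_single when_def)
  then have "mon_deg (m - Poly_Mapping.single i 1) = 0"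
    using assms mon_deg_add[of "Poly_Mapping.single i 1" "m - Poly_Mapping.single i 1"] by simp
  then have "m - Poly_Mapping.single i 1 = 0" by (rule mon_deg_eq_0)
  then show ?thesis using m by (metis add.right_neutral)
qed

lemma homogeneous_0_Const: "homogeneous 0 f \<Longrightarrow> f = Const (Poly_Mapping.lookup f 0)"
  by (rule poly_mapping_eqI)
    (auto simp: Const_def lookup_single when_def homogeneous_def in_keys_iff dest!: mon_deg_eq_0)

lemma homogeneous_0_is_unit:
  assumes "homogeneous 0 f" "f \<noteq> 0"
  shows "f dvd 1"
proof -
  obtain c where c: "f = Const c" using homogeneous_0_Const[OF assms(1)] by blast
  then have "c \<noteq> 0" using assms(2) by auto
  then have "1 = f * Const (inverse c)" using c by (simp flip: Const_mult)
  then show ?thesis by (rule dvdI)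
qed

lemma unit_is_homogeneous_0: "f dvd 1 \<Longrightarrow> homogeneous 0 (f :: poly3)"
proof -
  assume "f dvd 1"
  then obtain g where g: "1 = f * g" by (rule dvdE)
  then obtain e where "homogeneous e f" "0 \<le> e" "e \<le> 0"
    using homogeneous_factor[of 0 f g] by (metis homogeneous_1 zero_neq_one)
  then show ?thesis by simp
qed

lemma linear_form:
  assumes "homogeneous 1 f"
  shows "f = (\<Sum>i\<in>UNIV. Const (Poly_Mapping.lookup f (Poly_Mapping.single i 1)) * Var i)"
proof (rule poly_mapping_eqI)
  fix m
  let ?s = "\<lambda>i. Poly_Mapping.single i (1::nat)"
  have eq: "?s i = ?s j \<longleftrightarrow> i = j" for i j :: 3
    by (metis lookup_single_eq lookup_single_not_eq zero_neq_one)
  have *: "Poly_Mapping.lookup (\<Sum>i\<in>UNIV. Const (Poly_Mapping.lookup f (?s i)) * Var i) m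
      = (\<Sum>i\<in>UNIV. if ?s i = m then Poly_Mapping.lookup f (?s i) else 0)"
    by (simp add: lookup_sum Const_def Var_def mult_single lookup_single when_def cong: if_cong)
  show "Poly_Mapping.lookup f m = Poly_Mapping.lookup (\<Sum>i\<in>UNIV. Const (Poly_Mapping.lookup f (?s i)) * Var i) m"
  proof (cases "mon_deg m = 1")
    case True
    then obtain j where j: "m = ?s j" using mon_deg_eq_1 by blast
    show ?thesis unfolding * unfolding j eq by simp
  next
    case False
    then have "?s i \<noteq> m" for i by auto
    moreover have "Poly_Mapping.lookup f m = 0"
      using assms False by (intro lookup_homogeneous_eq_0[of 1]) auto
    ultimately show ?thesis unfolding * by simp
  qed
qed

lemma linear_forms_common_zero:
  assumes "homogeneous 1 f" "homogeneous 1 g" "f \<noteq> 0"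
  obtains v where "v \<noteq> 0" "eval3 f v = 0" "eval3 g v = 0"
proof -
  define a b where "a = (\<lambda>i. Poly_Mapping.lookup f (Poly_Mapping.single i 1))"
    and "b = (\<lambda>i. Poly_Mapping.lookup g (Poly_Mapping.single i 1))"
  have f: "f = (\<Sum>i\<in>UNIV. Const (a i) * Var i)" and g: "g = (\<Sum>i\<in>UNIV. Const (b i) * Var i)"
    using linear_form assms(1,2) by (auto simp: a_def b_def)
  have ev: "eval3 f v = a 1 * v $ 1 + a 2 * v $ 2 + a 3 * v $ 3"
    "eval3 g v = b 1 * v $ 1 + b 2 * v $ 2 + b 3 * v $ 3" for v
    by (simp_all add: f g eval3_sum sum_3)
  have "\<not> (a 1 = 0 \<and> a 2 = 0 \<and> a 3 = 0)" using f assms(3) by (auto simp: sum_3)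
  \<comment> \<open>The cross product of the coefficient vectors. If it vanishes, the forms are
    proportional and any nonzero zero of \<open>f\<close> works; the two alternatives in
    \<open>v\<close> cover the possible positions of a nonzero coefficient of
    \<open>f\<close>.\<close>
  define w where "w = (vector [a 2 * b 3 - a 3 * b 2, a 3 * b 1 - a 1 * b 3, a 1 * b 2 - a 2 * b 1] :: complex^3)"
  define v where "v = (if w \<noteq> 0 then w else if a 1 = 0 \<and> a 2 = 0 then vector [a 3, 0, - a 1]
    else vector [a 2, - a 1, 0])"
  have w0: "w = 0 \<longleftrightarrow> a 2 * b 3 - a 3 * b 2 = 0 \<and> a 3 * b 1 - a 1 * b 3 = 0 \<and> a 1 * b 2 - a 2 * b 1 = 0"
    by (simp add: w_def vec_eq_iff forall_3)
  have "v \<noteq> 0"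
    using \<open>\<not> (a 1 = 0 \<and> a 2 = 0 \<and> a 3 = 0)\<close> by (auto simp: v_def vec_eq_iff forall_3)
  moreover have "eval3 f v = 0" "eval3 g v = 0"
    using w0 by (auto simp: v_def w_def ev algebra_simps)
  ultimately show thesis by (rule that)
qed

definition smooth :: "poly3 \<Rightarrow> bool" where
  "smooth f \<longleftrightarrow> (\<forall>v. v \<noteq> 0 \<longrightarrow> eval3 f v = 0 \<longrightarrow> (\<exists>i. eval3 (pdiff i f) v \<noteq> 0))"

lemma smooth_nonzero: "smooth f \<Longrightarrow> f \<noteq> 0"
  unfolding smooth_def by (auto dest!: spec[of _ "axis 1 1"] simp: axis_eq_0_iff)

text \<open>A reducible conic is singular at the intersection of its two lines.\<close>

lemma smooth_imp_irreducible:
  assumes "homogeneous d f" "d = 1 \<or> d = 2" "smooth f"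
  shows "irreducible f"
proof (rule irreducibleI)
  show f0: "f \<noteq> 0" using smooth_nonzero assms(3) .
  show "\<not> f dvd 1"
    using unit_is_homogeneous_0[of f] homogeneous_unique[OF assms(1) _ f0] assms(2) by fastforce
  fix g h assume f: "f = g * h"
  obtain e where e: "homogeneous e g" "homogeneous (d - e) h" "0 \<le> e" "e \<le> d"
    using homogeneous_factor[of d g h] assms(1) f f0 by metis
  have gh: "g \<noteq> 0" "h \<noteq> 0" using f f0 by auto
  have "e \<noteq> 1 \<or> d - e \<noteq> 1"
  proof (rule ccontr)
    assume "\<not> (e \<noteq> 1 \<or> d - e \<noteq> 1)"
    then have "homogeneous 1 g" "homogeneous 1 h" using e by auto
    then obtain v where "v \<noteq> 0" "eval3 g v = 0" "eval3 h v = 0"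
      using linear_forms_common_zero gh by metis
    then show False using assms(3) by (auto simp: smooth_def f)
  qed
  then have "e = 0 \<or> d - e = 0" using e assms(2) by auto
  then show "g dvd 1 \<or> h dvd 1" using e gh homogeneous_0_is_unit by metis
qed

lemma prime_elem_dvd_prod_list:
  assumes "prime_elem p" "p dvd prod_list Ps"
  shows "\<exists>P\<in>set Ps. p dvd P"
  using assms(2)
proof (induction Ps)
  case Nil
  then show ?case using assms(1) by (simp add: prime_elem_def)
next
  case (Cons P Ps)
  then show ?case using assms(1) by (auto simp: prime_elem_def)
qed

lemma irreducible_dvd_irreducible:
  assumes "irreducible p" "irreducible q" "p dvd q"
  shows "q dvd p"
proof -
  obtain k where k: "q = p * k" using assms(3) by (rule dvdE)
  then have "k dvd 1" using assms(1,2) by (auto simp: irreducible_def)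
  then obtain l where "1 = k * l" by (rule dvdE)
  then have "p = q * l" using k by (simp add: mult.assoc)
  then show ?thesis by (rule dvdI)
qed

text \<open>Induction on the list. If the head \<open>P\<close> divides x, then its square divides
  the product, so \<open>P\<close> divides a later factor, which is excluded. Otherwise
  \<open>P\<close> divides y and cancels, leaving the square in the tail.\<close>

lemma squarefree_prod_list:
  assumes "\<forall>P\<in>set Ps. irreducible (P::poly3)" "sorted_wrt (\<lambda>P Q. \<not> P dvd Q) Ps"
  shows "squarefree (prod_list Ps)"
proof -
  have "x dvd 1" if "prod_list Ps = x * x * y" for x y
    using assms that
  proof (induction Ps arbitrary: x y)
    case Nil
    then have "1 = x * (x * y)" by (simp add: mult.assoc)
    then show ?case by (rule dvdI)
  next
    case (Cons P Ps)
    have P: "prime_elem P" "P \<noteq> 0" using Cons.prems(1) irreducible_imp_prime_poly3 by (auto simp: irreducible_def)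
    have "P dvd x * x * y" using Cons.prems(3) by (metis dvd_triv_left prod_list.Cons)
    then consider "P dvd x" | "P dvd y" using P(1) by (auto simp: prime_elem_def)
    then show ?case
    proof cases
      case 1
      then obtain k where k: "x = P * k" by (rule dvdE)
      then have "P * prod_list Ps = P * (P * (k * k * y))" using Cons.prems(3) by (simp add: mult_ac)
      then have "P dvd prod_list Ps" using P(2) by (auto simp: mult_cancel_left)
      then obtain Q where "Q \<in> set Ps" "P dvd Q" using prime_elem_dvd_prod_list[OF P(1)] by blast
      then show ?thesis using Cons.prems(2) by auto
    next
      case 2
      then obtain k where k: "y = P * k" by (rule dvdE)
      then have "P * prod_list Ps = P * (x * x * k)" using Cons.prems(3) by (simp add: mult_ac)
      then have "prod_list Ps = x * x * k" using P(2) by (auto simp: mult_cancel_left)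
      then show ?thesis using Cons by auto
    qed
  qed
  then show ?thesis by (auto simp: squarefree_def power2_eq_square elim!: dvdE)
qed

definition assoc_class :: "poly3 \<Rightarrow> poly3 set" where
  "assoc_class g = {h. h dvd g \<and> g dvd h}"

lemma components_prod_list:
  assumes "\<forall>P\<in>set Ps. irreducible P"
  shows "components (prod_list Ps) = assoc_class ` set Ps"
proof -
  have "assoc_class g \<in> assoc_class ` set Ps" if irr: "irreducible g" and dvd: "g dvd prod_list Ps" for g
  proof -
    obtain P where P: "P \<in> set Ps" "g dvd P"
      using prime_elem_dvd_prod_list[OF irreducible_imp_prime_poly3[OF irr]] dvd by blast
    then have "P dvd g" using irreducible_dvd_irreducible irr assms by blast
    with P have "assoc_class g = assoc_class P" unfolding assoc_class_def by (auto intro: dvd_trans)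
    with P show ?thesis by blast
  qed
  moreover have "P dvd prod_list Ps" if "P \<in> set Ps" for P
    using that by (induction Ps) auto
  ultimately show ?thesis
    using assms unfolding components_def assoc_class_def[symmetric] by blast
qed

text \<open>Associates divide each other, which bounds their degrees from both sides. The image
  under \<open>total_degree\<close> is thus a singleton, as \<open>the_elem\<close>
  requires.\<close>

lemma comp_degree_assoc_class:
  assumes "homogeneous (int d) f" "f \<noteq> 0"
  shows "comp_degree (assoc_class f) = d"
proof -
  have "total_degree h = d" if hf: "h dvd f" and fh: "f dvd h" for h
  proof -
    obtain k where k: "f = h * k" using hf by (rule dvdE)
    then obtain e where e: "homogeneous e h" "0 \<le> e" "e \<le> int d"
      using homogeneous_factor[of "int d" h k] assms by metis
    obtain l where l: "h = f * l" using fh by (rule dvdE)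
    have h0: "h \<noteq> 0" using k assms(2) by auto
    then obtain e' where "homogeneous e' f" "e' \<le> e"
      using homogeneous_factor[of e f l] e(1) l by metis
    then have "e = int d" using homogeneous_unique[OF assms(1)] assms(2) e(3) by fastforce
    then show ?thesis using total_degree_homogeneous[OF e(1) h0] by simp
  qed
  then have "total_degree ` assoc_class f = (\<lambda>_. d) ` assoc_class f"
    by (intro image_cong refl) (simp add: assoc_class_def)
  moreover have "f \<in> assoc_class f" by (simp add: assoc_class_def)
  ultimately have "total_degree ` assoc_class f = {d}" by auto
  then show ?thesis by (simp add: comp_degree_def)
qed

lemma comp_points_assoc_class: "comp_points (assoc_class f) = curve_points f"
proof -
  have "curve_points f \<subseteq> curve_points h" if "f dvd h" for h
    using that by (auto simp: curve_points_def vanishes_at_def elim!: dvdE)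
  then show ?thesis by (auto simp: comp_points_def assoc_class_def)
qed


section \<open>Points of the projective plane\<close>

lemma abs_cp2_eq_iff: "v \<noteq> 0 \<Longrightarrow> w \<noteq> 0 \<Longrightarrow> abs_cp2 v = abs_cp2 w \<longleftrightarrow> (\<exists>c. w = c *s v)"
proof -
  assume "v \<noteq> 0" "w \<noteq> 0"
  then have "proportional v v" "proportional w w"
    by (auto simp: proportional_def intro: exI[of _ 1])
  then have "abs_cp2 v = abs_cp2 w \<longleftrightarrow> proportional v w"
    using Quotient3_rel[OF Quotient3_cp2] by blast
  then show ?thesis using \<open>v \<noteq> 0\<close> \<open>w \<noteq> 0\<close> by (simp add: proportional_def)
qed

lemma cp2_cases:
  obtains v where "v \<noteq> 0" "p = abs_cp2 v"
proof
  have "proportional (rep_cp2 p) (rep_cp2 p)" using Quotient3_rep_reflp[OF Quotient3_cp2] .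
  then show "rep_cp2 p \<noteq> 0" by (simp add: proportional_def)
  show "p = abs_cp2 (rep_cp2 p)" using Quotient3_abs_rep[OF Quotient3_cp2] by metis
qed

lemma vanishes_at_iff:
  assumes "homogeneous (int d) f" "v \<noteq> 0"
  shows "vanishes_at f (abs_cp2 v) \<longleftrightarrow> eval3 f v = 0"
proof
  assume "eval3 f v = 0"
  then show "vanishes_at f (abs_cp2 v)"
    using assms by (auto simp: vanishes_at_def abs_cp2_eq_iff[OF assms(2)] eval3_scale eq_commute[of _ "abs_cp2 v"])
qed (use assms in \<open>auto simp: vanishes_at_def\<close>)

lemma curve_points_iff:
  "homogeneous (int d) f \<Longrightarrow> v \<noteq> 0 \<Longrightarrow> abs_cp2 v \<in> curve_points f \<longleftrightarrow> eval3 f v = 0"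
  by (simp add: curve_points_def vanishes_at_iff)

lemma Sing_iff:
  assumes "homogeneous (int d) f" "d > 0" "v \<noteq> 0"
  shows "abs_cp2 v \<in> Sing f \<longleftrightarrow> eval3 f v = 0 \<and> (\<forall>i. eval3 (pdiff i f) v = 0)"
proof -
  have "homogeneous (int (d - 1)) (pdiff i f)" for i
    using homogeneous_pdiff[OF assms(1), of i] assms(2) by (simp add: of_nat_diff)
  then have "vanishes_at (pdiff i f) (abs_cp2 v) \<longleftrightarrow> eval3 (pdiff i f) v = 0" for i
    using assms(3) by (rule vanishes_at_iff)
  then show ?thesis
    using assms by (simp add: Sing_def curve_points_iff)
qed

text \<open>At a zero of the head \<open>P\<close> the product rule leaves the nonzero gradient of
  \<open>P\<close> times the value of the remaining product, so the point is singular iff that value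
  vanishes. Away from the zeros of \<open>P\<close> this factor is a unit and the induction
  hypothesis applies.\<close>

lemma singular_prod_list_iff:
  assumes "\<forall>P\<in>set Ps. smooth P" "v \<noteq> 0"
  shows "eval3 (prod_list Ps) v = 0 \<and> (\<forall>i. eval3 (pdiff i (prod_list Ps)) v = 0)
    \<longleftrightarrow> (\<exists>i j. i < j \<and> j < length Ps \<and> eval3 (Ps ! i) v = 0 \<and> eval3 (Ps ! j) v = 0)"
  using assms(1)
proof (induction Ps)
  case (Cons P Ps)
  let ?two = "\<lambda>Ps. \<exists>i j. i < j \<and> j < length Ps \<and> eval3 (Ps ! i) v = 0 \<and> eval3 (Ps ! j) v = 0"
  have two: "?two (P # Ps) \<longleftrightarrow> (eval3 P v = 0 \<and> (\<exists>j<length Ps. eval3 (Ps ! j) v = 0)) \<or> ?two Ps"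
  proof
    assume "?two (P # Ps)"
    then obtain i j where ij: "i < j" "j < length (P # Ps)" "eval3 ((P # Ps) ! i) v = 0" "eval3 ((P # Ps) ! j) v = 0"
      by blast
    then obtain j' where j': "j = Suc j'" by (cases j) auto
    show "(eval3 P v = 0 \<and> (\<exists>j<length Ps. eval3 (Ps ! j) v = 0)) \<or> ?two Ps"
      using ij unfolding j' by (cases i) auto
  next
    assume "(eval3 P v = 0 \<and> (\<exists>j<length Ps. eval3 (Ps ! j) v = 0)) \<or> ?two Ps"
    then show "?two (P # Ps)"
    proof
      assume "eval3 P v = 0 \<and> (\<exists>j<length Ps. eval3 (Ps ! j) v = 0)"
      then obtain j where "j < length Ps" "eval3 P v = 0" "eval3 (Ps ! j) v = 0" by blast
      then show ?thesis by (intro exI[of _ 0] exI[of _ "Suc j"]) auto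
    next
      assume "?two Ps"
      then obtain i j where "i < j" "j < length Ps" "eval3 (Ps ! i) v = 0" "eval3 (Ps ! j) v = 0" by blast
      then show ?thesis by (intro exI[of _ "Suc i"] exI[of _ "Suc j"]) auto
    qed
  qed
  have "eval3 (prod_list Ps) v = 0 \<longleftrightarrow> (\<exists>j<length Ps. eval3 (Ps ! j) v = 0)"
    by (auto simp: eval3_prod_list prod_list_zero_iff in_set_conv_nth image_iff) (metis nth_mem)?
  then have "eval3 (prod_list Ps) v \<noteq> 0 \<Longrightarrow> \<not> ?two Ps" by auto
  moreover have "eval3 P v = 0 \<Longrightarrow> \<exists>i. eval3 (pdiff i P) v \<noteq> 0"
    using Cons.prems assms(2) by (auto simp: smooth_def)
  ultimately show ?case
    unfolding two using Cons \<open>eval3 (prod_list Ps) v = 0 \<longleftrightarrow> _\<close>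
    by (cases "eval3 P v = 0"; cases "eval3 (prod_list Ps) v = 0") auto
qed auto


section \<open>Arrangements of smooth conics and lines\<close>

text \<open>\<open>vs\<close> lists representatives of the singular points, and \<open>inc ! k\<close> the positions in \<open>Ps\<close> of
  the components through \<open>vs ! k\<close>.\<close>

locale arrangement =
  fixes Ps :: "poly3 list" and ds :: "nat list" and vs :: "(complex ^ 3) list" and inc :: "nat set list"
  assumes nonempty: "Ps \<noteq> []"
    and degrees: "list_all2 (\<lambda>P d. homogeneous (int d) P \<and> smooth P \<and> (d = 1 \<or> d = 2)) Ps ds"
    and vs_nonzero: "\<forall>v\<in>set vs. v \<noteq> 0"
    and incidence: "list_all2 (\<lambda>v A. A = {i. i < length Ps \<and> eval3 (Ps ! i) v = 0}) vs inc"
    and inc_two: "\<forall>A\<in>set inc. \<exists>i\<in>A. \<exists>j\<in>A. i \<noteq> j"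
    and complete: "\<And>i j v. i < j \<Longrightarrow> j < length Ps \<Longrightarrow> v \<noteq> 0 \<Longrightarrow> eval3 (Ps ! i) v = 0 \<Longrightarrow> eval3 (Ps ! j) v = 0
       \<Longrightarrow> \<exists>w\<in>set vs. \<exists>c. v = c *s w"
    and distinct_vs: "sorted_wrt (\<lambda>v w. \<not> (\<exists>c. w = c *s v)) vs"
    and separated: "\<And>i j. i < length Ps \<Longrightarrow> j < length Ps \<Longrightarrow> i \<noteq> j \<Longrightarrow> \<exists>A\<in>set inc. i \<in> A \<and> j \<notin> A"
begin

lemma length_ds: "length ds = length Ps"
  using degrees by (simp add: list_all2_lengthD)

lemma length_inc: "length inc = length vs"
  using incidence by (simp add: list_all2_lengthD)

lemma
  assumes "i < length Ps"
  shows Ps_hom: "homogeneous (int (ds ! i)) (Ps ! i)" and Ps_smooth: "smooth (Ps ! i)"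
    and ds_cases: "ds ! i = 1 \<or> ds ! i = 2"
  using degrees assms by (auto simp: list_all2_conv_all_nth)

lemma Ps_irreducible: "\<forall>P\<in>set Ps. irreducible P"
  using smooth_imp_irreducible[OF Ps_hom _ Ps_smooth] ds_cases by (fastforce simp: in_set_conv_nth)

lemma inc_nth: "k < length vs \<Longrightarrow> inc ! k = {i. i < length Ps \<and> eval3 (Ps ! i) (vs ! k) = 0}"
  using incidence by (auto simp: list_all2_conv_all_nth)

text \<open>A singular point on component i but off component j is a witness, since divisibility
  would make every zero of \<open>Ps ! i\<close> a zero of \<open>Ps ! j\<close>.\<close>

lemma not_dvd:
  assumes "i < length Ps" "j < length Ps" "i \<noteq> j"
  shows "\<not> Ps ! i dvd Ps ! j"
proof
  assume "Ps ! i dvd Ps ! j"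
  then obtain h where h: "Ps ! j = Ps ! i * h" by (rule dvdE)
  obtain k where "k < length vs" "i \<in> inc ! k" "j \<notin> inc ! k"
    using separated[OF assms] length_inc by (metis in_set_conv_nth)
  then show False using inc_nth[of k] h assms(2) by auto
qed

definition curve :: poly3 where "curve = prod_list Ps"

lemma curve_hom: "homogeneous (int (sum_list ds)) curve"
proof -
  have "homogeneous (int (sum_list ds)) (prod_list Ps)"
    using degrees by (induction rule: list_all2_induct) (auto intro: homogeneous_mult)
  then show ?thesis by (simp add: curve_def)
qed

lemma degree_pos: "sum_list ds > 0"
proof -
  have "ds \<noteq> []" using length_ds nonempty by auto
  then have "hd ds \<in> set ds" "0 < length Ps" using nonempty by auto
  moreover have "hd ds = ds ! 0" using \<open>ds \<noteq> []\<close> by (rule hd_conv_nth)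
  ultimately show ?thesis
    using ds_cases[of 0] member_le_sum_list[of "hd ds" ds] by auto
qed

lemma reduced: "reduced_curve curve"
proof -
  have "sorted_wrt (\<lambda>P Q. \<not> P dvd Q) Ps"
    by (auto simp: sorted_wrt_iff_nth_less not_dvd)
  then show ?thesis
    unfolding reduced_curve_def using squarefree_prod_list[OF Ps_irreducible] curve_hom degree_pos
    by (auto simp: curve_def intro!: exI[of _ "int (sum_list ds)"])
qed

lemma Sing_curve: "Sing curve = abs_cp2 ` set vs"
proof -
  have *: "abs_cp2 v \<in> Sing curve \<longleftrightarrow> (\<exists>i j. i < j \<and> j < length Ps \<and> eval3 (Ps ! i) v = 0 \<and> eval3 (Ps ! j) v = 0)"
    if "v \<noteq> 0" for v
    unfolding Sing_iff[OF curve_hom degree_pos that] unfolding curve_def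
    using singular_prod_list_iff[OF _ that] Ps_smooth by (auto simp: in_set_conv_nth Ball_def)
  show ?thesis
  proof (intro equalityI subsetI)
    fix p assume p: "p \<in> Sing curve"
    obtain v where v: "v \<noteq> 0" "p = abs_cp2 v" by (rule cp2_cases)
    then obtain i j where "i < j" "j < length Ps" "eval3 (Ps ! i) v = 0" "eval3 (Ps ! j) v = 0"
      using p * by blast
    then obtain w c where w: "w \<in> set vs" "v = c *s w" using complete v(1) by blast
    then have "abs_cp2 w = abs_cp2 v" using v(1) vs_nonzero by (auto simp: abs_cp2_eq_iff)
    then show "p \<in> abs_cp2 ` set vs" using v(2) w(1) by (metis imageI)
  next
    fix p assume "p \<in> abs_cp2 ` set vs"
    then obtain k where k: "k < length vs" "p = abs_cp2 (vs ! k)" by (auto simp: in_set_conv_nth)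
    obtain i j where "i \<in> inc ! k" "j \<in> inc ! k" "i \<noteq> j"
      using inc_two length_inc k(1) by (metis nth_mem)
    then have ij: "i < length Ps" "j < length Ps" "i \<noteq> j" "eval3 (Ps ! i) (vs ! k) = 0" "eval3 (Ps ! j) (vs ! k) = 0"
      using inc_nth[OF k(1)] by auto
    then have "\<exists>i j. i < j \<and> j < length Ps \<and> eval3 (Ps ! i) (vs ! k) = 0 \<and> eval3 (Ps ! j) (vs ! k) = 0"
      by (metis linorder_neqE_nat)
    then show "p \<in> Sing curve" using * k vs_nonzero by (metis nth_mem)
  qed
qed

lemma abs_vs_inj:
  assumes "k < length vs" "l < length vs" "abs_cp2 (vs ! k) = abs_cp2 (vs ! l)"
  shows "k = l"
proof -
  have "\<not> abs_cp2 (vs ! k) = abs_cp2 (vs ! l)" if "k < l" "l < length vs" for k l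
    using that distinct_vs vs_nonzero by (simp add: abs_cp2_eq_iff sorted_wrt_iff_nth_less)
  then show ?thesis using assms by (metis linorder_neqE_nat)
qed

lemma components_curve: "components curve = assoc_class ` set Ps"
  unfolding curve_def by (rule components_prod_list[OF Ps_irreducible])

lemma assoc_class_inj:
  assumes "i < length Ps" "j < length Ps" "assoc_class (Ps ! i) = assoc_class (Ps ! j)"
  shows "i = j"
proof -
  have "Ps ! i \<in> assoc_class (Ps ! j)" using assms(3) by (metis (mono_tags) assoc_class_def dvd_refl mem_Collect_eq)
  then show ?thesis using not_dvd[OF assms(1,2)] by (auto simp: assoc_class_def)
qed

lemma on_component_iff:
  assumes "k < length vs" "i < length Ps"
  shows "abs_cp2 (vs ! k) \<in> comp_points (assoc_class (Ps ! i)) \<longleftrightarrow> i \<in> inc ! k"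
  using assms vs_nonzero curve_points_iff[OF Ps_hom] inc_nth
  by (simp add: comp_points_assoc_class)

lemma components_through_curve:
  "k < length vs \<Longrightarrow> components_through curve (abs_cp2 (vs ! k)) = (\<lambda>i. assoc_class (Ps ! i)) ` (inc ! k)"
  unfolding components_through_def components_curve
  using on_component_iff inc_nth by (force simp: in_set_conv_nth)

lemma components_nth: "components curve = (\<lambda>i. assoc_class (Ps ! i)) ` {..<length Ps}"
  unfolding components_curve by (force simp: in_set_conv_nth)

lemma Sing_nth: "Sing curve = (\<lambda>k. abs_cp2 (vs ! k)) ` {..<length vs}"
  unfolding Sing_curve by (force simp: in_set_conv_nth)

lemma bij_components: "bij_betw (\<lambda>i. assoc_class (Ps ! i)) {..<length Ps} (components curve)"
  using assoc_class_inj by (auto simp: bij_betw_def inj_on_def components_nth)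

lemma bij_Sing: "bij_betw (\<lambda>k. abs_cp2 (vs ! k)) {..<length vs} (Sing curve)"
  using abs_vs_inj by (auto simp: bij_betw_def inj_on_def Sing_nth)

lemma r_vec_curve:
  "r_vec curve j = card {i. i < length Ps \<and> card {k. k < length vs \<and> i \<in> inc ! k} = j}"
proof -
  have "card (Sing curve \<inter> comp_points (assoc_class (Ps ! i))) = card {k. k < length vs \<and> i \<in> inc ! k}"
    if "i < length Ps" for i
  proof -
    have "Sing curve \<inter> comp_points (assoc_class (Ps ! i)) = (\<lambda>k. abs_cp2 (vs ! k)) ` {k. k < length vs \<and> i \<in> inc ! k}"
      using on_component_iff[OF _ that] by (auto simp: Sing_nth)
    moreover have "inj_on (\<lambda>k. abs_cp2 (vs ! k)) {k. k < length vs \<and> i \<in> inc ! k}"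
      using abs_vs_inj by (auto simp: inj_on_def)
    ultimately show ?thesis by (simp add: card_image)
  qed
  then have "{K \<in> components curve. card (Sing curve \<inter> comp_points K) = j}
      = (\<lambda>i. assoc_class (Ps ! i)) ` {i. i < length Ps \<and> card {k. k < length vs \<and> i \<in> inc ! k} = j}"
    by (auto simp: components_nth)
  moreover have "inj_on (\<lambda>i. assoc_class (Ps ! i)) {i. i < length Ps \<and> card {k. k < length vs \<and> i \<in> inc ! k} = j}"
    using assoc_class_inj by (auto simp: inj_on_def)
  ultimately show ?thesis by (simp add: r_vec_def card_image)
qed

end

text \<open>With one list of degrees and one list of incidences for both curves, matching components
  and singular points by position preserves degrees and incidences, and \<open>r_vec\<close> is
  computed from \<open>inc\<close> alone. The topological types are the remaining input.\<close>

lemma same_strong_combinatorial_typeI: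
  assumes "arrangement Ps ds vs inc" "arrangement Qs ds ws inc"
    and top: "list_all2 (\<lambda>v w. same_topological_type (prod_list Ps) (abs_cp2 v) (prod_list Qs) (abs_cp2 w)) vs ws"
  shows "same_strong_combinatorial_type (prod_list Ps) (prod_list Qs)"
proof -
  interpret A: arrangement Ps ds vs inc by fact
  interpret B: arrangement Qs ds ws inc by fact
  have len: "length Ps = length Qs" "length vs = length ws"
    using A.length_ds B.length_ds A.length_inc B.length_inc by auto
  let ?a = "\<lambda>i. assoc_class (Ps ! i)" and ?b = "\<lambda>i. assoc_class (Qs ! i)"
  let ?p = "\<lambda>k. abs_cp2 (vs ! k)" and ?q = "\<lambda>k. abs_cp2 (ws ! k)"
  define \<phi>r where "\<phi>r = ?b \<circ> inv_into {..<length Ps} ?a"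
  define \<phi>S where "\<phi>S = ?q \<circ> inv_into {..<length vs} ?p"
  have \<phi>r: "\<phi>r (?a i) = ?b i" if "i < length Ps" for i
    using that A.bij_components inv_into_f_f[of ?a "{..<length Ps}" i] by (simp add: \<phi>r_def bij_betw_def)
  have \<phi>S: "\<phi>S (?p k) = ?q k" if "k < length vs" for k
    using that A.bij_Sing inv_into_f_f[of ?p "{..<length vs}" k] by (simp add: \<phi>S_def bij_betw_def)
  have "bij_betw \<phi>r (components A.curve) (components B.curve)"
    unfolding \<phi>r_def using A.bij_components B.bij_components
    by (metis bij_betw_inv_into bij_betw_trans len(1))
  moreover have "bij_betw \<phi>S (Sing A.curve) (Sing B.curve)"
    unfolding \<phi>S_def using A.bij_Sing B.bij_Sing
    by (metis bij_betw_inv_into bij_betw_trans len(2))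
  moreover have "comp_degree K = comp_degree (\<phi>r K)" if K: "K \<in> components A.curve" for K
  proof -
    obtain i where i: "i < length Ps" "K = ?a i" using K by (auto simp: A.components_nth)
    have "Ps ! i \<noteq> 0" "Qs ! i \<noteq> 0"
      using A.Ps_smooth[OF i(1)] B.Ps_smooth[of i] i(1) len by (auto dest: smooth_nonzero)
    then show ?thesis
      using i len comp_degree_assoc_class[OF A.Ps_hom] comp_degree_assoc_class[OF B.Ps_hom] by (simp add: \<phi>r)
  qed
  moreover have "same_topological_type A.curve p B.curve (\<phi>S p)" if p: "p \<in> Sing A.curve" for p
  proof -
    obtain k where "k < length vs" "p = ?p k" using p by (auto simp: A.Sing_nth)
    then show ?thesis
      using top by (simp add: \<phi>S list_all2_conv_all_nth A.curve_def B.curve_def)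
  qed
  moreover have "\<phi>r ` components_through A.curve p = components_through B.curve (\<phi>S p)" if p: "p \<in> Sing A.curve" for p
  proof -
    obtain k where k: "k < length vs" "p = ?p k" using p by (auto simp: A.Sing_nth)
    have "inc ! k \<subseteq> {..<length Ps}" using A.inc_nth[OF k(1)] by auto
    then show ?thesis
      using k len A.components_through_curve[OF k(1)] B.components_through_curve[of k]
      by (force simp: \<phi>S image_image \<phi>r intro!: image_cong)
  qed
  moreover have "r_vec A.curve = r_vec B.curve"
    by (simp add: fun_eq_iff A.r_vec_curve B.r_vec_curve len)
  ultimately show ?thesis
    unfolding same_strong_combinatorial_type_def A.curve_def B.curve_def by blast
qed


section \<open>Topological types of plane curve singularities\<close>

lemma same_topological_type_sym:
  assumes "same_topological_type f p g q"
  shows "same_topological_type g q f p"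
proof -
  obtain U V \<phi> \<psi> where *: "open U" "p \<in> U" "open V" "q \<in> V" "homeomorphism U V \<phi> \<psi>"
      "\<phi> p = q" "\<phi> ` (U \<inter> curve_points f) = V \<inter> curve_points g"
    using assms unfolding same_topological_type_def by blast
  have "\<psi> ` (V \<inter> curve_points g) = \<psi> ` \<phi> ` (U \<inter> curve_points f)" using * by simp
  also have "\<dots> = U \<inter> curve_points f"
    using homeomorphism_apply1[OF *(5)] by (force simp: image_iff)
  finally have "\<psi> ` (V \<inter> curve_points g) = U \<inter> curve_points f" .
  moreover have "\<psi> q = p" using homeomorphism_apply1[OF *(5)] * by auto
  ultimately show ?thesis
    unfolding same_topological_type_def
    by (intro exI[of _ V] exI[of _ U] exI[of _ \<psi>] exI[of _ \<phi>])
      (simp add: * homeomorphism_symD)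
qed

text \<open>The two local homeomorphisms live on unrelated neighbourhoods \<open>V\<close> and
  \<open>V'\<close> of q, so both are restricted to the parts corresponding to the intersection of
  these before they are composed.\<close>

lemma same_topological_type_trans:
  assumes "same_topological_type f p g q" "same_topological_type g q h r"
  shows "same_topological_type f p h r"
proof -
  obtain U V \<phi> \<psi> where 1: "open U" "p \<in> U" "open V" "q \<in> V" "homeomorphism U V \<phi> \<psi>"
      "\<phi> p = q" "\<phi> ` (U \<inter> curve_points f) = V \<inter> curve_points g"
    using assms unfolding same_topological_type_def by blast
  obtain V' W \<phi>' \<psi>' where 2: "open V'" "q \<in> V'" "open W" "r \<in> W" "homeomorphism V' W \<phi>' \<psi>'"
      "\<phi>' q = r" "\<phi>' ` (V' \<inter> curve_points g) = W \<inter> curve_points h"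
    using assms unfolding same_topological_type_def by blast
  define U2 W2 where "U2 = U \<inter> \<phi> -` (V \<inter> V')" and "W2 = W \<inter> \<psi>' -` (V \<inter> V')"
  have "open U2"
    unfolding U2_def using continuous_open_preimage[OF homeomorphism_cont1[OF 1(5)] 1(1)] 1 2 by blast
  have "open W2"
    unfolding W2_def using continuous_open_preimage[OF homeomorphism_cont2[OF 2(5)] 2(3)] 1 2 by blast
  have im1: "\<phi> ` U2 = V \<inter> V'"
    unfolding U2_def using homeomorphism_image1[OF 1(5)] by blast
  have im2: "\<phi>' ` (V \<inter> V') = W2"
  proof (intro equalityI subsetI)
    fix x assume "x \<in> \<phi>' ` (V \<inter> V')"
    then show "x \<in> W2"
      unfolding W2_def using homeomorphism_image1[OF 2(5)] homeomorphism_apply1[OF 2(5)] by auto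
  next
    fix x assume "x \<in> W2"
    then show "x \<in> \<phi>' ` (V \<inter> V')"
      unfolding W2_def using homeomorphism_apply2[OF 2(5)] by (metis IntE image_eqI vimageE)
  qed
  have h1: "homeomorphism U2 (V \<inter> V') \<phi> \<psi>"
    using homeomorphism_of_subsets[OF 1(5), of U2 "V \<inter> V'"] im1 by (auto simp: U2_def)
  have h2: "homeomorphism (V \<inter> V') W2 \<phi>' \<psi>'"
    using homeomorphism_of_subsets[OF 2(5), of "V \<inter> V'" W2] im2 by (auto simp: W2_def)
  have c1: "\<phi> x \<in> curve_points g \<longleftrightarrow> x \<in> curve_points f" if "x \<in> U2" for x
  proof -
    have x: "x \<in> U" "\<phi> x \<in> V" using that homeomorphism_image1[OF 1(5)] by (auto simp: U2_def)
    show ?thesis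
    proof
      assume "\<phi> x \<in> curve_points g"
      then have "\<phi> x \<in> \<phi> ` (U \<inter> curve_points f)" unfolding 1(7) using x by simp
      then obtain y where y: "y \<in> U" "y \<in> curve_points f" "\<phi> x = \<phi> y" by blast
      have "x = y" using homeomorphism_apply1[OF 1(5) x(1)] homeomorphism_apply1[OF 1(5) y(1)] y(3) by metis
      then show "x \<in> curve_points f" using y by simp
    next
      assume "x \<in> curve_points f"
      then have "\<phi> x \<in> \<phi> ` (U \<inter> curve_points f)" using x by simp
      then show "\<phi> x \<in> curve_points g" unfolding 1(7) by simp
    qed
  qed
  have c2: "\<phi>' x \<in> curve_points h \<longleftrightarrow> x \<in> curve_points g" if x: "x \<in> V'" for x
  proof
    assume "\<phi>' x \<in> curve_points h"
    moreover have "\<phi>' x \<in> W" using x homeomorphism_image1[OF 2(5)] by auto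
    ultimately have "\<phi>' x \<in> \<phi>' ` (V' \<inter> curve_points g)" unfolding 2(7) by simp
    then obtain y where y: "y \<in> V'" "y \<in> curve_points g" "\<phi>' x = \<phi>' y" by blast
    have "x = y" using homeomorphism_apply1[OF 2(5) x] homeomorphism_apply1[OF 2(5) y(1)] y(3) by metis
    then show "x \<in> curve_points g" using y by simp
  next
    assume "x \<in> curve_points g"
    then have "\<phi>' x \<in> \<phi>' ` (V' \<inter> curve_points g)" using x by simp
    then show "\<phi>' x \<in> curve_points h" unfolding 2(7) by simp
  qed
  have image: "(\<phi>' \<circ> \<phi>) ` (U2 \<inter> curve_points f) = W2 \<inter> curve_points h"
  proof (intro equalityI subsetI)
    fix y assume "y \<in> (\<phi>' \<circ> \<phi>) ` (U2 \<inter> curve_points f)"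
    then obtain x where "x \<in> U2" "x \<in> curve_points f" "y = \<phi>' (\<phi> x)" by auto
    moreover then have "\<phi> x \<in> V \<inter> V'" using im1 by blast
    ultimately show "y \<in> W2 \<inter> curve_points h" using c1 c2 im2 by blast
  next
    fix y assume y: "y \<in> W2 \<inter> curve_points h"
    then obtain z where z: "z \<in> V \<inter> V'" "y = \<phi>' z" using im2 by blast
    then obtain x where x: "x \<in> U2" "z = \<phi> x" using im1 by blast
    then have "x \<in> curve_points f" using c1 c2 y z by blast
    then show "y \<in> (\<phi>' \<circ> \<phi>) ` (U2 \<inter> curve_points f)" using x z by auto
  qed
  show ?thesis
    unfolding same_topological_type_def
  proof (intro exI conjI)
    show "homeomorphism U2 W2 (\<phi>' \<circ> \<phi>) (\<psi> \<circ> \<psi>')" using homeomorphism_compose[OF h1 h2] .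
    show "p \<in> U2" using 1 2 by (simp add: U2_def)
    show "r \<in> W2" using im2 1 2 by blast
    show "(\<phi>' \<circ> \<phi>) p = r" using 1 2 by simp
  qed (fact \<open>open U2\<close> \<open>open W2\<close> image)+
qed

section \<open>Affine charts and local coordinates\<close>

locale affine_chart =
  fixes i j k :: 3
  assumes distinct: "i \<noteq> j" "j \<noteq> k" "i \<noteq> k"
begin

definition pt :: "complex \<times> complex \<Rightarrow> complex ^ 3" where
  "pt q = (\<chi> l. if l = i then fst q else if l = j then snd q else 1)"

text \<open>The linear part of the affine map \<open>pt\<close>, and therefore its derivative at
  every point.\<close>

definition dpt :: "complex \<times> complex \<Rightarrow> complex ^ 3" where
  "dpt q = (\<chi> l. if l = i then fst q else if l = j then snd q else 0)"

definition chart :: "complex \<times> complex \<Rightarrow> cp2" where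
  "chart q = abs_cp2 (pt q)"

lemma pt_nth [simp]: "pt q $ i = fst q" "pt q $ j = snd q" "pt q $ k = 1"
  using distinct by (auto simp: pt_def)

lemma UNIV_eq: "UNIV = {i, j, k}"
proof -
  have "card {i, j, k} = CARD(3)" using distinct by auto
  then show ?thesis by (metis card_subset_eq finite subset_UNIV)
qed

lemma pt_eq_iff: "v = pt q \<longleftrightarrow> v $ i = fst q \<and> v $ j = snd q \<and> v $ k = 1"
proof -
  have "(\<forall>l. v $ l = pt q $ l) \<longleftrightarrow> (\<forall>l\<in>{i, j, k}. v $ l = pt q $ l)"
    unfolding UNIV_eq[symmetric] by simp
  then show ?thesis by (simp add: vec_eq_iff)
qed

lemma pt_nonzero: "pt q \<noteq> 0"
  using pt_nth(3)[of q] by force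

lemma bounded_linear_dpt: "bounded_linear dpt"
proof -
  have "linear dpt" by (rule linearI) (auto simp: dpt_def vec_eq_iff)
  then show ?thesis by (simp add: linear_conv_bounded_linear)
qed

lemma pt_eq_dpt: "pt q = dpt q + axis k 1"
proof -
  have "l = k" if "l \<noteq> i" "l \<noteq> j" for l using that UNIV_eq by auto
  then show ?thesis using distinct by (auto simp: pt_def dpt_def vec_eq_iff axis_def)
qed

lemma has_derivative_pt: "(pt has_derivative dpt) (at q)"
  unfolding pt_eq_dpt[abs_def]
  by (auto intro!: derivative_eq_intros bounded_linear.has_derivative[OF bounded_linear_dpt])

lemma continuous_on_pt: "continuous_on A pt"
  by (intro continuous_at_imp_continuous_on ballI has_derivative_continuous[OF has_derivative_pt])

lemma chart_inj: "chart q = chart q' \<Longrightarrow> q = q'"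
proof -
  assume "chart q = chart q'"
  then obtain c where c: "pt q' = c *s pt q"
    unfolding chart_def using abs_cp2_eq_iff pt_nonzero by blast
  then have "pt q' $ k = c * pt q $ k" by simp
  then have "c = 1" by simp
  then have "pt q' $ i = pt q $ i" "pt q' $ j = pt q $ j" using c by auto
  then show "q = q'" by (simp add: prod_eq_iff)
qed

lemma continuous_on_chart: "continuous_on A chart"
proof -
  have "open (chart -` U)" if "open U" for U
  proof -
    have "open {v. v \<noteq> 0 \<and> abs_cp2 v \<in> U}" using that by (simp add: open_cp2_def)
    then have "open (pt -` {v. v \<noteq> 0 \<and> abs_cp2 v \<in> U})"
      using continuous_on_pt open_vimage by blast
    moreover have "pt -` {v. v \<noteq> 0 \<and> abs_cp2 v \<in> U} = chart -` U"
      using pt_nonzero by (auto simp: chart_def)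
    ultimately show ?thesis by simp
  qed
  then have "continuous_on UNIV chart" by (simp add: continuous_on_open_vimage)
  then show ?thesis by (rule continuous_on_subset) simp
qed

text \<open>Openness in the quotient topology is tested on the cone over the image. That cone is the
  preimage of S under the pair of quotients by the k-th coordinate, a continuous map where this
  coordinate is nonzero.\<close>

lemma open_chart: "open S \<Longrightarrow> open (chart ` S)"
proof -
  assume S: "open S"
  have "{v. v \<noteq> 0 \<and> abs_cp2 v \<in> chart ` S}
      = {v. v $ k \<noteq> 0} \<inter> (\<lambda>v. (v $ i / v $ k, v $ j / v $ k)) -` S" (is "?L = ?R")
  proof (intro equalityI subsetI)
    fix v assume "v \<in> ?L"
    then obtain q where q: "v \<noteq> 0" "q \<in> S" "abs_cp2 (pt q) = abs_cp2 v" by (auto simp: chart_def)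
    then obtain c where c: "v = c *s pt q" using abs_cp2_eq_iff pt_nonzero by blast
    then have "c \<noteq> 0" using q(1) by auto
    moreover have "v $ i = c * fst q" "v $ j = c * snd q" "v $ k = c" using c by auto
    ultimately show "v \<in> ?R" using q(2) by simp
  next
    fix v assume v: "v \<in> ?R"
    let ?q = "(v $ i / v $ k, v $ j / v $ k)"
    have "inverse (v $ k) *s v = pt ?q"
      unfolding pt_eq_iff using v by (simp add: field_simps)
    moreover have "v \<noteq> 0" using v by auto
    ultimately have "abs_cp2 v = chart ?q"
      unfolding chart_def using abs_cp2_eq_iff[of v "pt ?q"] pt_nonzero by metis
    then show "v \<in> ?L" using v \<open>v \<noteq> 0\<close> by blast
  qed
  moreover have "open ?R"
  proof (rule continuous_open_preimage[OF _ _ S])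
    show "open {v :: complex^3. v $ k \<noteq> 0}"
      by (intro open_Collect_neq continuous_intros)
    show "continuous_on {v :: complex^3. v $ k \<noteq> 0} (\<lambda>v. (v $ i / v $ k, v $ j / v $ k))"
      by (intro continuous_on_Pair continuous_on_divide linear_continuous_on bounded_linear_vec_nth) auto
  qed
  ultimately show ?thesis by (simp add: open_cp2_def)
qed

lemma homeomorphism_chart:
  assumes "open S"
  obtains h where "homeomorphism S (chart ` S) chart h"
proof (rule homeomorphism_injective_open_map[of S chart "chart ` S"])
  show "continuous_on S chart" by (rule continuous_on_chart)
  show "inj_on chart S" using chart_inj by (auto simp: inj_on_def)
  show "openin (top_of_set (chart ` S)) (chart ` U)" if "openin (top_of_set S) U" for U
  proof -
    have "open U" using that assms openin_open_trans by blast
    then show ?thesis using open_chart openin_imp_subset[OF that] by (auto intro: open_subset)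
  qed
qed (use that in auto)

lemma has_derivative_eval3_pt:
  "((\<lambda>q. eval3 U (pt q)) has_derivative
     (\<lambda>h. eval3 (pdiff i U) (pt q) * fst h + eval3 (pdiff j U) (pt q) * snd h)) (at q)"
proof -
  have "(\<Sum>l\<in>UNIV. eval3 (pdiff l U) (pt q) * dpt h $ l)
      = eval3 (pdiff i U) (pt q) * fst h + eval3 (pdiff j U) (pt q) * snd h" for h
    unfolding UNIV_eq using distinct by (simp add: dpt_def)
  then show ?thesis
    using has_derivative_compose[OF has_derivative_pt[of q] has_derivative_eval3[of U]] by simp
qed

text \<open>The Jacobian determinant makes the derivative at \<open>q0\<close> invertible, and
  continuity of the derivative gives local injectivity. Invariance of domain then turns the
  continuous injection into a homeomorphism onto an open set.\<close>

lemma local_homeomorphism: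
  fixes q0 :: "complex \<times> complex" and U V :: poly3
  defines "G \<equiv> \<lambda>q. (eval3 U (pt q), eval3 V (pt q))"
  assumes det: "eval3 (pdiff i U) (pt q0) * eval3 (pdiff j V) (pt q0)
      - eval3 (pdiff j U) (pt q0) * eval3 (pdiff i V) (pt q0) \<noteq> 0"
    and N: "open N" "q0 \<in> N"
  obtains S H where "open S" "q0 \<in> S" "S \<subseteq> N" "open (G ` S)" "homeomorphism S (G ` S) G H"
proof -
  define c where "c = (\<lambda>F l q. eval3 (pdiff l F) (pt q))"
  define G' where "G' = (\<lambda>q h. (c U i q * fst h + c U j q * snd h, c V i q * fst h + c V j q * snd h))"
  define D where "D = c U i q0 * c V j q0 - c U j q0 * c V i q0"
  have "D \<noteq> 0" using det by (simp add: D_def c_def)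
  \<comment> \<open>Cramer's rule for the inverse of the derivative at \<open>q0\<close>.\<close>
  define g' where "g' = (\<lambda>h. ((c V j q0 * fst h - c U j q0 * snd h) / D, (c U i q0 * snd h - c V i q0 * fst h) / D))"
  have deriv: "(G has_derivative G' q) (at q)" for q
    unfolding G_def G'_def c_def by (intro has_derivative_Pair has_derivative_eval3_pt)
  have "linear g'"
    by (rule linearI) (auto simp: g'_def algebra_simps add_divide_distrib diff_divide_distrib scaleR_conv_of_real)
  then have lin: "bounded_linear g'" by (simp add: linear_conv_bounded_linear)
  have inv: "g' \<circ> G' q0 = id"
  proof
    fix h :: "complex \<times> complex"
    have "c V j q0 * (c U i q0 * fst h + c U j q0 * snd h) - c U j q0 * (c V i q0 * fst h + c V j q0 * snd h) = D * fst h"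
      "c U i q0 * (c V i q0 * fst h + c V j q0 * snd h) - c V i q0 * (c U i q0 * fst h + c U j q0 * snd h) = D * snd h"
      by (simp_all add: D_def algebra_simps)
    then show "(g' \<circ> G' q0) h = id h" using \<open>D \<noteq> 0\<close> by (simp add: g'_def G'_def)
  qed
  have cont: "\<exists>d>0. \<forall>x. dist q0 x < d \<longrightarrow> onorm (\<lambda>v. G' x v - G' q0 v) < e" if "e > 0" for e
  proof -
    \<comment> \<open>Four matrix entries, each within e / 5 of its value at \<open>q0\<close>, keep
      the operator norm of the difference at most 4 e / 5, strictly below e.\<close>
    have "eventually (\<lambda>x. norm (c F l x - c F l q0) < e / 5) (nhds q0)" for F l
    proof -
      have "continuous_on UNIV (c F l)"
        unfolding c_def by (rule continuous_on_compose2[OF continuous_on_eval3 continuous_on_pt]) auto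
      then have "(c F l \<longlongrightarrow> c F l q0) (nhds q0)"
        using continuous_on_eq_continuous_at[OF open_UNIV] continuous_at tendsto_at_iff_tendsto_nhds by blast
      then have "eventually (\<lambda>x. dist (c F l x) (c F l q0) < e / 5) (nhds q0)"
        using \<open>e > 0\<close> by (intro tendstoD) auto
      then show ?thesis by (simp add: dist_norm)
    qed
    from this have "eventually (\<lambda>x. \<forall>F\<in>{U, V}. \<forall>l\<in>{i, j}. norm (c F l x - c F l q0) < e / 5) (nhds q0)"
      by (simp add: eventually_conj_iff)
    then obtain d where d: "d > 0" "\<And>x. dist x q0 < d \<Longrightarrow> \<forall>F\<in>{U, V}. \<forall>l\<in>{i, j}. norm (c F l x - c F l q0) < e / 5"
      unfolding eventually_nhds_metric by blast
    have "onorm (\<lambda>v. G' x v - G' q0 v) < e" if x: "dist q0 x < d" for x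
    proof -
      have b: "norm (c F i x * fst h + c F j x * snd h - (c F i q0 * fst h + c F j q0 * snd h)) \<le> 2 * (e / 5) * norm h"
        if F: "F \<in> {U, V}" for F and h :: "complex \<times> complex"
      proof -
        have "c F i x * fst h + c F j x * snd h - (c F i q0 * fst h + c F j q0 * snd h)
          = (c F i x - c F i q0) * fst h + (c F j x - c F j q0) * snd h" by (simp add: algebra_simps)
        also have "norm \<dots> \<le> norm (c F i x - c F i q0) * norm (fst h) + norm (c F j x - c F j q0) * norm (snd h)"
          by (metis norm_mult norm_triangle_ineq)
        also have "\<dots> \<le> e / 5 * norm h + e / 5 * norm h"
          using d(2)[of x] x F \<open>e > 0\<close> norm_fst_le[of "fst h" "snd h"] norm_snd_le[of "snd h" "fst h"]
          by (intro add_mono mult_mono) (auto simp: dist_commute)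
        finally show ?thesis by simp
      qed
      have "norm (G' x h - G' q0 h) \<le> (4 * (e / 5)) * norm h" for h
        using norm_Pair_le[of "fst (G' x h - G' q0 h)" "snd (G' x h - G' q0 h)"] b[of U h] b[of V h]
        by (simp add: G'_def algebra_simps)
      then have "onorm (\<lambda>v. G' x v - G' q0 v) \<le> 4 * (e / 5)"
        using \<open>e > 0\<close> by (intro onorm_bound) auto
      then show ?thesis using \<open>e > 0\<close> by simp
    qed
    then show ?thesis using d(1) by blast
  qed
  obtain r where r: "r > 0" "ball q0 r \<subseteq> UNIV" "inj_on G (ball q0 r)"
    by (rule has_derivative_locally_injective[of q0 UNIV g' G' G]) (use lin inv deriv cont in auto)
  define S where "S = ball q0 r \<inter> N"
  have S: "open S" "q0 \<in> S" "S \<subseteq> N" using r N by (auto simp: S_def)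
  have inj: "inj_on G S" using r(3) by (rule inj_on_subset) (auto simp: S_def)
  have contG: "continuous_on S G"
    using deriv by (intro continuous_at_imp_continuous_on ballI has_derivative_continuous)
  obtain H where "homeomorphism S (G ` S) G H"
    using invariance_of_domain_homeomorphism[OF S(1) contG _ inj] by auto
  moreover have "open (G ` S)" by (rule invariance_of_domain[OF contG S(1) inj])
  ultimately show thesis using that S by blast
qed

end

interpretation std: affine_chart 1 2 3
  by unfold_locales auto

abbreviation origin :: "complex ^ 3" where "origin \<equiv> vector [0, 0, 1]"

lemma std_pt: "std.pt q = vector [fst q, snd q, 1]"
  by (simp add: vec_eq_iff forall_3 std.pt_def)

section \<open>Normal forms of nodes, triple points and tacnodes\<close>

context affine_chart
begin

text \<open>\<open>E\<close> and \<open>R\<close> are nonzero near v, so by the identity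
  \<open>f\<close> vanishes exactly where \<open>g\<close> vanishes at (U, V, 1). As U and V are
  local coordinates, they map one germ to the other.\<close>

lemma local_model:
  assumes f: "homogeneous (int d) f" and g: "homogeneous (int e) g" and v: "v $ k = 1"
    and UV: "eval3 U v = 0" "eval3 V v = 0"
    and det: "eval3 (pdiff i U) v * eval3 (pdiff j V) v - eval3 (pdiff j U) v * eval3 (pdiff i V) v \<noteq> 0"
    and ident: "\<And>w. eval3 f w * eval3 E w = eval3 R w * eval3 g (vector [eval3 U w, eval3 V w, 1])"
    and ER: "eval3 E v \<noteq> 0" "eval3 R v \<noteq> 0"
  shows "same_topological_type f (abs_cp2 v) g (abs_cp2 origin)"
proof -
  define q0 where "q0 = (v $ i, v $ j)"
  have v': "v = pt q0" using v by (simp add: pt_eq_iff q0_def)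
  define N where "N = {q. eval3 E (pt q) * eval3 R (pt q) \<noteq> 0}"
  have "open N"
    unfolding N_def by (intro open_Collect_neq continuous_intros
        continuous_on_compose2[OF continuous_on_eval3 continuous_on_pt]) auto
  moreover have "q0 \<in> N" using ER by (simp add: N_def v')
  ultimately obtain S H where S: "open S" "q0 \<in> S" "S \<subseteq> N"
      "open ((\<lambda>q. (eval3 U (pt q), eval3 V (pt q))) ` S)"
      "homeomorphism S ((\<lambda>q. (eval3 U (pt q), eval3 V (pt q))) ` S) (\<lambda>q. (eval3 U (pt q), eval3 V (pt q))) H"
    using local_homeomorphism[of U q0 V N] det v' by blast
  define G where "G = (\<lambda>q. (eval3 U (pt q), eval3 V (pt q)))"
  note S = S[folded G_def]
  obtain h where h: "homeomorphism S (chart ` S) chart h" using homeomorphism_chart[OF S(1)] .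
  obtain h' where h': "homeomorphism (G ` S) (std.chart ` G ` S) std.chart h'"
    using std.homeomorphism_chart[OF S(4)] .
  define \<phi> where "\<phi> = std.chart \<circ> (G \<circ> h)"
  have hom: "homeomorphism (chart ` S) (std.chart ` G ` S) \<phi> ((chart \<circ> H) \<circ> h')"
    unfolding \<phi>_def
    using homeomorphism_compose[OF homeomorphism_compose[OF homeomorphism_symD[OF h] S(5)] h'] .
  have \<phi>: "\<phi> (chart q) = std.chart (G q)" if "q \<in> S" for q
    using homeomorphism_apply1[OF h that] by (simp add: \<phi>_def)
  have curve: "chart q \<in> curve_points f \<longleftrightarrow> std.chart (G q) \<in> curve_points g" if "q \<in> S" for q
  proof -
    have "eval3 E (pt q) \<noteq> 0" "eval3 R (pt q) \<noteq> 0" using that S(3) by (auto simp: N_def)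
    moreover have "eval3 f (pt q) * eval3 E (pt q) = eval3 R (pt q) * eval3 g (std.pt (G q))"
      using ident[of "pt q"] by (simp add: std_pt G_def)
    ultimately have "eval3 f (pt q) = 0 \<longleftrightarrow> eval3 g (std.pt (G q)) = 0" by (metis mult_eq_0_iff)
    then show ?thesis
      unfolding chart_def std.chart_def
      using curve_points_iff[OF f pt_nonzero] curve_points_iff[OF g std.pt_nonzero] by simp
  qed
  show ?thesis
    unfolding same_topological_type_def
  proof (intro exI conjI)
    show "open (chart ` S)" using open_chart S(1) .
    show "abs_cp2 v \<in> chart ` S" using S(2) by (auto simp: v' chart_def)
    show "open (std.chart ` G ` S)" using std.open_chart S(4) .
    have G0: "std.chart (G q0) = abs_cp2 origin"
      using UV by (simp add: std.chart_def std_pt G_def v')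
    show "abs_cp2 origin \<in> std.chart ` G ` S" using S(2) G0 by (metis imageI)
    show "homeomorphism (chart ` S) (std.chart ` G ` S) \<phi> ((chart \<circ> H) \<circ> h')" by (fact hom)
    show "\<phi> (abs_cp2 v) = abs_cp2 origin" using \<phi>[OF S(2)] G0 by (simp add: v' chart_def)
    show "\<phi> ` (chart ` S \<inter> curve_points f) = std.chart ` G ` S \<inter> curve_points g"
    proof (intro equalityI subsetI)
      fix y assume "y \<in> \<phi> ` (chart ` S \<inter> curve_points f)"
      then obtain q where "q \<in> S" "chart q \<in> curve_points f" "y = \<phi> (chart q)" by blast
      then show "y \<in> std.chart ` G ` S \<inter> curve_points g" using \<phi> curve by simp
    next
      fix y assume "y \<in> std.chart ` G ` S \<inter> curve_points g"
      then obtain q where "q \<in> S" "std.chart (G q) \<in> curve_points g" "y = std.chart (G q)" by blast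
      then have "chart q \<in> chart ` S \<inter> curve_points f" "y = \<phi> (chart q)" using \<phi> curve by auto
      then show "y \<in> \<phi> ` (chart ` S \<inter> curve_points f)" by blast
    qed
  qed
qed

definition jacobian :: "poly3 \<Rightarrow> poly3 \<Rightarrow> complex ^ 3 \<Rightarrow> complex" where
  "jacobian U V v = eval3 (pdiff i U) v * eval3 (pdiff j V) v - eval3 (pdiff j U) v * eval3 (pdiff i V) v"

lemma node_type:
  assumes "homogeneous (int d) f" "v $ k = 1" "f = A * B * R"
    and "eval3 A v = 0" "eval3 B v = 0" "eval3 R v \<noteq> 0" "jacobian A B v \<noteq> 0"
  shows "same_topological_type f (abs_cp2 v) (X * Y) (abs_cp2 origin)"
proof (rule local_model[where U = A and V = B and E = 1 and R = R and e = 2])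
  show "homogeneous (int 2) (X * Y)" using homogeneous_mult[of 1 X 1 Y] by simp
qed (use assms in \<open>auto simp: jacobian_def\<close>)

text \<open>With U = \<alpha> A and V = \<beta> B the relation gives U V (U + V) = \<alpha> \<beta>
  \<gamma> A B C, which explains the choice of \<open>E\<close>. Since A and B vanish at v, the
  Jacobian of (U, V) there is that of (A, B) times a nonzero scalar.\<close>

lemma triple_type:
  assumes "homogeneous (int d) f" "v $ k = 1" "f = A * B * C * R"
    and rel: "\<gamma> * C = \<alpha> * A + \<beta> * B"
    and "eval3 A v = 0" "eval3 B v = 0" "eval3 R v \<noteq> 0" "jacobian A B v \<noteq> 0"
    and "eval3 \<alpha> v \<noteq> 0" "eval3 \<beta> v \<noteq> 0" "eval3 \<gamma> v \<noteq> 0"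
  shows "same_topological_type f (abs_cp2 v) (X * Y * (X + Y)) (abs_cp2 origin)"
proof (rule local_model[where U = "\<alpha> * A" and V = "\<beta> * B" and E = "\<alpha> * \<beta> * \<gamma>" and R = R and e = 3])
  show "homogeneous (int 3) (X * Y * (X + Y))"
    using homogeneous_mult[OF homogeneous_mult[of 1 X 1 Y], of 1 "X + Y"] homogeneous_add[of 1 X Y] by simp
  have "eval3 \<gamma> w * eval3 C w = eval3 \<alpha> w * eval3 A w + eval3 \<beta> w * eval3 B w" for w
    using arg_cong[OF rel, of "\<lambda>p. eval3 p w"] by simp
  then show "eval3 f w * eval3 (\<alpha> * \<beta> * \<gamma>) w
      = eval3 R w * eval3 (X * Y * (X + Y)) (vector [eval3 (\<alpha> * A) w, eval3 (\<beta> * B) w, 1])" for w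
    by (simp add: assms(3)) (metis (no_types, lifting) mult.assoc mult.commute)
  have "eval3 (pdiff i (\<alpha> * A)) v * eval3 (pdiff j (\<beta> * B)) v - eval3 (pdiff j (\<alpha> * A)) v * eval3 (pdiff i (\<beta> * B)) v
      = eval3 \<alpha> v * eval3 \<beta> v * jacobian A B v"
    using assms(5,6) by (simp add: jacobian_def algebra_simps)
  then show "eval3 (pdiff i (\<alpha> * A)) v * eval3 (pdiff j (\<beta> * B)) v
      - eval3 (pdiff j (\<alpha> * A)) v * eval3 (pdiff i (\<beta> * B)) v \<noteq> 0" using assms by simp
qed (use assms in auto)

text \<open>With U = \<gamma> L and V = - \<gamma> \<alpha> A the relation gives V - U^2 = -
  \<gamma> \<beta> B, hence V (V - U^2) = \<gamma>^2 \<alpha> \<beta> A B.\<close>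

lemma tacnode_type:
  assumes "homogeneous (int d) f" "v $ k = 1" "f = A * B * R"
    and rel: "\<beta> * B = \<alpha> * A + \<gamma> * L^2"
    and "eval3 A v = 0" "eval3 L v = 0" "eval3 R v \<noteq> 0" "jacobian L A v \<noteq> 0"
    and "eval3 \<alpha> v \<noteq> 0" "eval3 \<beta> v \<noteq> 0" "eval3 \<gamma> v \<noteq> 0"
  shows "same_topological_type f (abs_cp2 v) (Y * (Y * Z - X^2)) (abs_cp2 origin)"
proof (rule local_model[where U = "\<gamma> * L" and V = "- (\<gamma> * \<alpha>) * A" and E = "\<gamma>^2 * \<alpha> * \<beta>" and R = R and e = 3])
  show "homogeneous (int 3) (Y * (Y * Z - X^2))"
    using homogeneous_mult[of 1 Y 2, OF _ homogeneous_diff[of 2 "Y * Z" "X^2"]]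
      homogeneous_mult[of 1 Y 1 Z] homogeneous_power[of 1 X 2] by simp
  have "eval3 \<beta> w * eval3 B w = eval3 \<alpha> w * eval3 A w + eval3 \<gamma> w * (eval3 L w)^2" for w
    using arg_cong[OF rel, of "\<lambda>p. eval3 p w"] by simp
  then have "eval3 R w * eval3 (Y * (Y * Z - X^2)) (vector [eval3 (\<gamma> * L) w, eval3 (- (\<gamma> * \<alpha>) * A) w, 1])
      = eval3 R w * ((eval3 \<gamma> w)^2 * eval3 \<alpha> w * eval3 A w * (eval3 \<beta> w * eval3 B w))" for w
    by (simp add: algebra_simps power2_eq_square)
  then show "eval3 f w * eval3 (\<gamma>^2 * \<alpha> * \<beta>) w
      = eval3 R w * eval3 (Y * (Y * Z - X^2)) (vector [eval3 (\<gamma> * L) w, eval3 (- (\<gamma> * \<alpha>) * A) w, 1])" for w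
    by (simp add: assms(3) mult_ac)
  have "eval3 (pdiff i (\<gamma> * L)) v * eval3 (pdiff j (- (\<gamma> * \<alpha>) * A)) v
      - eval3 (pdiff j (\<gamma> * L)) v * eval3 (pdiff i (- (\<gamma> * \<alpha>) * A)) v
      = - ((eval3 \<gamma> v)^2 * eval3 \<alpha> v * jacobian L A v)"
    using assms(5,6) by (simp add: jacobian_def algebra_simps power2_eq_square)
  then show "eval3 (pdiff i (\<gamma> * L)) v * eval3 (pdiff j (- (\<gamma> * \<alpha>) * A)) v
      - eval3 (pdiff j (\<gamma> * L)) v * eval3 (pdiff i (- (\<gamma> * \<alpha>) * A)) v \<noteq> 0" using assms by simp
qed (use assms in auto)

end

lemma same_topological_typeI:
  "same_topological_type f p h r \<Longrightarrow> same_topological_type g q h r \<Longrightarrow> same_topological_type f p g q"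
  using same_topological_type_sym same_topological_type_trans by blast


section \<open>The Jacobian ideal\<close>

lemma module_poly3: "module ((*) :: poly3 \<Rightarrow> poly3 \<Rightarrow> poly3)"
  by unfold_locales (auto simp: algebra_simps)

lemma jacobian_ideal_iff:
  "h \<in> jacobian_ideal f \<longleftrightarrow> (\<exists>a b c. h = a * pdiff 1 f + b * pdiff 2 f + c * pdiff 3 f)"
proof -
  interpret module "(*) :: poly3 \<Rightarrow> poly3 \<Rightarrow> poly3" by (rule module_poly3)
  have "range (\<lambda>i. pdiff i f) = {pdiff 1 f, pdiff 2 f, pdiff 3 f}"
    unfolding UNIV_3 by simp
  then have J: "jacobian_ideal f = span {pdiff 1 f, pdiff 2 f, pdiff 3 f}"
    by (simp add: jacobian_ideal_def)
  show ?thesis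
  proof
    assume "h \<in> jacobian_ideal f"
    then show "\<exists>a b c. h = a * pdiff 1 f + b * pdiff 2 f + c * pdiff 3 f"
      unfolding J by (auto simp: span_insert algebra_simps diff_eq_eq)
  next
    assume "\<exists>a b c. h = a * pdiff 1 f + b * pdiff 2 f + c * pdiff 3 f"
    then show "h \<in> jacobian_ideal f"
      unfolding J by (auto intro!: span_add span_scale intro: span_base)
  qed
qed

lemma pdiff_in_jacobian_ideal: "pdiff i f \<in> jacobian_ideal f"
  unfolding jacobian_ideal_def by (rule module.span_base[OF module_poly3]) simp

lemma jacobian_ideal_add: "g \<in> jacobian_ideal f \<Longrightarrow> h \<in> jacobian_ideal f \<Longrightarrow> g + h \<in> jacobian_ideal f"
  unfolding jacobian_ideal_def by (rule module.span_add[OF module_poly3])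

lemma jacobian_ideal_mult: "g \<in> jacobian_ideal f \<Longrightarrow> h * g \<in> jacobian_ideal f"
  unfolding jacobian_ideal_def by (rule module.span_scale[OF module_poly3])

lemma jacobian_ideal_0: "0 \<in> jacobian_ideal f"
  unfolding jacobian_ideal_def by (rule module.span_zero[OF module_poly3])

lemma jacobian_ideal_sum: "(\<And>a. a \<in> A \<Longrightarrow> F a \<in> jacobian_ideal f) \<Longrightarrow> sum F A \<in> jacobian_ideal f"
  unfolding jacobian_ideal_def by (rule module.span_sum[OF module_poly3])

text \<open>The generators have degree d - 1, so taking components leaves cofactors of degree e - d
  + 1. For d = 6 and e = 7, 8 these are the quadrics and cubics of the certificates.\<close>

lemma jacobian_ideal_homogeneous:
  assumes "homogeneous d f" "h \<in> jacobian_ideal f"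
  shows "\<exists>a b c. homogeneous (e - d + 1) a \<and> homogeneous (e - d + 1) b \<and> homogeneous (e - d + 1) c
    \<and> hcomp e h = a * pdiff 1 f + b * pdiff 2 f + c * pdiff 3 f"
proof -
  obtain a b c where h: "h = a * pdiff 1 f + b * pdiff 2 f + c * pdiff 3 f"
    using assms(2) jacobian_ideal_iff by blast
  have "hcomp e (u * pdiff i f) = hcomp (e - d + 1) u * pdiff i f" for u i
    using hcomp_mult_left[OF homogeneous_pdiff[OF assms(1)], of e i u] by (simp add: mult.commute algebra_simps)
  then have "hcomp e h = hcomp (e - d + 1) a * pdiff 1 f + hcomp (e - d + 1) b * pdiff 2 f
      + hcomp (e - d + 1) c * pdiff 3 f" by (simp add: h hcomp_add)
  then show ?thesis using homogeneous_hcomp by blast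
qed

lemma graded_ideal_jacobian:
  assumes "homogeneous d f"
  shows "graded_ideal (jacobian_ideal f)"
proof
  show "hcomp e h \<in> jacobian_ideal f" if "h \<in> jacobian_ideal f" for e h
    using jacobian_ideal_homogeneous[OF assms that, of e] jacobian_ideal_iff by blast
qed (auto intro: jacobian_ideal_add jacobian_ideal_mult jacobian_ideal_0)


subsection \<open>Linear changes of coordinates\<close>

abbreviation subst :: "(3 \<Rightarrow> poly3) \<Rightarrow> poly3 \<Rightarrow> poly3" where "subst \<equiv> insertion Const"

lemmas subst_simps = Const.insertion_add Const.insertion_diff Const.insertion_uminus
  Const.insertion_mult Const.insertion_power Const.insertion_Const Const.insertion_Var
  Const.insertion_numeral Const.insertion_sum

lemma homogeneous_subst:
  assumes "\<And>i. homogeneous 1 (\<sigma> i)" "homogeneous d f"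
  shows "homogeneous d (subst \<sigma> f)"
  unfolding insertion_def
proof (rule homogeneous_sum)
  fix m assume "m \<in> Poly_Mapping.keys f"
  then have "int (mon_deg m) = d" using assms(2) by (simp add: homogeneous_def)
  moreover have P: "homogeneous (int n) (\<sigma> i ^ n)" for i n
    using homogeneous_power[OF assms(1), of n i] by simp
  ultimately show "homogeneous d (Const (Poly_Mapping.lookup f m) * (\<Prod>i\<in>UNIV. \<sigma> i ^ Poly_Mapping.lookup m i))"
    using homogeneous_mult[OF homogeneous_Const[of "Poly_Mapping.lookup f m"]
        homogeneous_mult[OF homogeneous_mult[OF P[of "Poly_Mapping.lookup m 1" 1]
            P[of "Poly_Mapping.lookup m 2" 2]] P[of "Poly_Mapping.lookup m 3" 3]]]
    by (simp add: prod_3 mon_deg_def sum_3)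
qed

lemma pdiff_subst: "pdiff j (subst \<sigma> f) = (\<Sum>i\<in>UNIV. pdiff j (\<sigma> i) * subst \<sigma> (pdiff i f))"
proof (induction f rule: poly3_induct)
  case (Const c)
  show ?case by (simp add: subst_simps Const.insertion_0)
next
  case (Var i)
  have "(\<Sum>l\<in>UNIV. pdiff j (\<sigma> l) * subst \<sigma> (pdiff l (Var i))) = (\<Sum>l\<in>UNIV. if l = i then pdiff j (\<sigma> i) else 0)"
    using Const.insertion_Const[of \<sigma> 1]
    by (intro sum.cong) (auto simp: pdiff_Var Const.insertion_0)
  then show ?case by (simp add: subst_simps)
next
  case (add f g)
  then show ?case by (simp add: subst_simps distrib_left sum.distrib)
next
  case (mult f g)
  then show ?case by (simp add: subst_simps distrib_left distrib_right sum.distrib sum_distrib_left mult_ac)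
qed

lemma subst_inverse:
  assumes "\<And>i. subst \<tau> (\<sigma> i) = Var i"
  shows "subst \<tau> (subst \<sigma> f) = f"
  by (induction f rule: poly3_induct) (simp_all add: subst_simps assms)

text \<open>The chain rule for the inverse substitution \<tau>, applied to
  \<open>subst \<sigma> f\<close>, expresses the derivatives of \<open>f\<close>; pushing this
  forward by \<sigma> writes their images as combinations of the derivatives of
  \<open>subst \<sigma> f\<close>.\<close>

lemma subst_jacobian_ideal:
  assumes "\<And>i. subst \<tau> (\<sigma> i) = Var i" "\<And>i. subst \<sigma> (\<tau> i) = Var i" "h \<in> jacobian_ideal f"
  shows "subst \<sigma> h \<in> jacobian_ideal (subst \<sigma> f)"
proof -
  have "subst \<sigma> (pdiff i f) \<in> jacobian_ideal (subst \<sigma> f)" for i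
  proof -
    have "pdiff i f = (\<Sum>j\<in>UNIV. pdiff i (\<tau> j) * subst \<tau> (pdiff j (subst \<sigma> f)))"
      using pdiff_subst[of i \<tau> "subst \<sigma> f"] by (simp add: subst_inverse assms(1))
    then have "subst \<sigma> (pdiff i f) = (\<Sum>j\<in>UNIV. subst \<sigma> (pdiff i (\<tau> j)) * pdiff j (subst \<sigma> f))"
      by (simp add: subst_simps subst_inverse assms(2))
    then show ?thesis
      by (simp add: jacobian_ideal_sum jacobian_ideal_mult pdiff_in_jacobian_ideal)
  qed
  moreover obtain a b c where "h = a * pdiff 1 f + b * pdiff 2 f + c * pdiff 3 f"
    using assms(3) jacobian_ideal_iff by blast
  ultimately show ?thesis by (simp add: subst_simps jacobian_ideal_add jacobian_ideal_mult)
qed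

lemma subst_socle_elem:
  assumes "\<And>i. subst \<tau> (\<sigma> i) = Var i" "\<And>i. subst \<sigma> (\<tau> i) = Var i"
    "\<And>i. homogeneous 1 (\<sigma> i)" "\<And>i. homogeneous 1 (\<tau> i)" "socle_elem d (jacobian_ideal f) g"
  shows "socle_elem d (jacobian_ideal (subst \<sigma> f)) (subst \<sigma> g)"
  unfolding socle_elem_def
proof (intro conjI allI)
  have g: "homogeneous d g" "g \<notin> jacobian_ideal f" "\<And>i. Var i * g \<in> jacobian_ideal f"
    using assms(5) by (auto simp: socle_elem_def)
  show "homogeneous d (subst \<sigma> g)" using homogeneous_subst[OF assms(3)] g(1) .
  show "subst \<sigma> g \<notin> jacobian_ideal (subst \<sigma> f)"
  proof
    assume "subst \<sigma> g \<in> jacobian_ideal (subst \<sigma> f)"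
    then have "subst \<tau> (subst \<sigma> g) \<in> jacobian_ideal (subst \<tau> (subst \<sigma> f))"
      by (rule subst_jacobian_ideal[OF assms(2,1)])
    then show False using g(2) by (simp add: subst_inverse assms(1))
  qed
  fix i
  \<comment> \<open>The form \<open>\<tau> i\<close> is linear, so its product with g is a constant
    combination of the products with the variables; \<sigma> then turns \<open>\<tau> i\<close> into
    \<open>Var i\<close>.\<close>
  have "\<tau> i * g = (\<Sum>j\<in>UNIV. Const (Poly_Mapping.lookup (\<tau> i) (Poly_Mapping.single j 1)) * (Var j * g))"
    by (subst linear_form[OF assms(4)]) (simp add: sum_distrib_right mult.assoc)
  then have "\<tau> i * g \<in> jacobian_ideal f"
    by (simp add: jacobian_ideal_sum jacobian_ideal_mult g(3))
  then have "subst \<sigma> (\<tau> i * g) \<in> jacobian_ideal (subst \<sigma> f)"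
    by (rule subst_jacobian_ideal[OF assms(1,2)])
  then show "Var i * subst \<sigma> g \<in> jacobian_ideal (subst \<sigma> f)"
    by (simp add: subst_simps assms(2))
qed


section \<open>Certificates for socle elements\<close>

text \<open>A homogeneous polynomial of degree \<open>d\<close> is stored as the list of lists whose entry at \<open>(i, j)\<close>
  is the coefficient of \<open>X^i Y^j Z^(d - i - j)\<close>; a list of lists also stands for the linear
  functional taking these values on monomials.\<close>

fun row_poly :: "int list \<Rightarrow> nat \<Rightarrow> poly3" where
  "row_poly [] d = 0"
| "row_poly (c # r) d = of_int c * Z ^ d + Y * row_poly r (d - 1)"

fun tri_poly :: "int list list \<Rightarrow> nat \<Rightarrow> poly3" where
  "tri_poly [] d = 0"
| "tri_poly (r # p) d = row_poly r d + X * tri_poly p (d - 1)"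

text \<open>Confines the entries to the triangle i + j \<le> d. Outside it the truncated exponents
  in \<open>tri_poly\<close> no longer add up to d, and products of tables do not represent products
  of polynomials.\<close>

fun tri_shape :: "int list list \<Rightarrow> nat \<Rightarrow> bool" where
  "tri_shape [] d = True"
| "tri_shape (r # p) d = (length r \<le> d + 1 \<and> (p = [] \<or> 1 \<le> d \<and> tri_shape p (d - 1)))"

fun row_add :: "int list \<Rightarrow> int list \<Rightarrow> int list" where
  "row_add [] s = s"
| "row_add (c # r) [] = c # r"
| "row_add (c # r) (e # s) = (c + e) # row_add r s"

definition row_scale :: "int \<Rightarrow> int list \<Rightarrow> int list" where
  "row_scale c r = (if c = 0 then [] else map ((*) c) r)"

fun row_mult :: "int list \<Rightarrow> int list \<Rightarrow> int list" where
  "row_mult [] s = []"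
| "row_mult (c # r) s = row_add (row_scale c s) (0 # row_mult r s)"

fun tri_add :: "int list list \<Rightarrow> int list list \<Rightarrow> int list list" where
  "tri_add [] q = q"
| "tri_add (r # p) [] = r # p"
| "tri_add (r # p) (s # q) = row_add r s # tri_add p q"

definition tri_scale :: "int \<Rightarrow> int list list \<Rightarrow> int list list" where
  "tri_scale c p = (if c = 0 then [] else map (map ((*) c)) p)"

text \<open>Tables multiply like polynomials in X and Y, that is, after setting Z = 1; the degree
  argument of \<open>tri_poly\<close> restores the power of Z. The prefixed \<open>[]\<close> is
  multiplication by X, as the prefixed 0 in \<open>row_mult\<close> is multiplication by Y.\<close>

fun tri_mult :: "int list list \<Rightarrow> int list list \<Rightarrow> int list list" where
  "tri_mult [] q = []"
| "tri_mult (r # p) q = tri_add (map (row_mult r) q) ([] # tri_mult p q)"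

definition tri_zero :: "int list list \<Rightarrow> bool" where
  "tri_zero p = list_all (list_all (\<lambda>c. c = 0)) p"

lemma row_add_Nil [simp]: "row_add r [] = r" by (cases r) auto
lemma tri_add_Nil [simp]: "tri_add p [] = p" by (cases p) auto

lemma row_poly_add: "row_poly (row_add r s) d = row_poly r d + row_poly s d"
  by (induction r s arbitrary: d rule: row_add.induct) (simp_all add: algebra_simps)

lemma row_poly_scale: "row_poly (row_scale c r) d = of_int c * row_poly r d"
proof (cases "c = 0")
  case False
  then show ?thesis
    by (induction r arbitrary: d) (simp_all add: row_scale_def algebra_simps)
qed (simp add: row_scale_def)

lemma row_poly_Z: "length r \<le> d + 1 \<Longrightarrow> row_poly r (d + k) = Z ^ k * row_poly r d"
proof (induction r arbitrary: d)
  case (Cons c r)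
  then show ?case
    by (cases "r = []"; cases d) (auto simp: algebra_simps power_add)
qed simp

lemma row_poly_mult:
  "length r \<le> d + 1 \<Longrightarrow> length s \<le> e + 1 \<Longrightarrow> row_poly (row_mult r s) (d + e) = row_poly r d * row_poly s e"
proof (induction r arbitrary: d)
  case (Cons c r)
  have "row_poly s (d + e) = Z ^ d * row_poly s e"
    using row_poly_Z[OF Cons.prems(2), of d] by (simp add: add.commute)
  moreover have "row_poly (row_mult r s) (d + e - 1) = row_poly r (d - 1) * row_poly s e"
  proof (cases "r = []")
    case False
    then have "d - 1 + e = d + e - 1" using Cons.prems by (cases d) auto
    then show ?thesis using Cons.IH[of "d - 1"] Cons.prems False by (cases d) auto
  qed simp
  ultimately show ?case
    by (simp add: row_poly_add row_poly_scale algebra_simps)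
qed simp

lemma tri_poly_add: "tri_poly (tri_add p q) d = tri_poly p d + tri_poly q d"
  by (induction p q arbitrary: d rule: tri_add.induct) (simp_all add: row_poly_add algebra_simps)

lemma tri_poly_scale: "tri_poly (tri_scale c p) d = of_int c * tri_poly p d"
proof (cases "c = 0")
  case False
  then have "row_poly (map ((*) c) r) d = of_int c * row_poly r d" for r d
    using row_poly_scale[of c r d] by (simp add: row_scale_def)
  then show ?thesis using False
    by (induction p arbitrary: d) (simp_all add: tri_scale_def algebra_simps)
qed (simp add: tri_scale_def)

lemma tri_poly_row_mult:
  "length r \<le> d + 1 \<Longrightarrow> tri_shape q e \<Longrightarrow> tri_poly (map (row_mult r) q) (d + e) = row_poly r d * tri_poly q e"
proof (induction q arbitrary: e)
  case (Cons s q)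
  have "tri_poly (map (row_mult r) q) (d + e - 1) = row_poly r d * tri_poly q (e - 1)"
  proof (cases "q = []")
    case False
    then have "d + (e - 1) = d + e - 1" "tri_shape q (e - 1)" using Cons.prems by auto
    then show ?thesis using Cons.IH[of "e - 1"] Cons.prems by simp
  qed simp
  then show ?case using Cons.prems by (simp add: row_poly_mult algebra_simps)
qed simp

lemma tri_poly_mult:
  "tri_shape p d \<Longrightarrow> tri_shape q e \<Longrightarrow> tri_poly (tri_mult p q) (d + e) = tri_poly p d * tri_poly q e"
proof (induction p arbitrary: d)
  case (Cons r p)
  have "tri_poly (tri_mult p q) (d + e - 1) = tri_poly p (d - 1) * tri_poly q e"
  proof (cases "p = []")
    case False
    then have "d - 1 + e = d + e - 1" "tri_shape p (d - 1)" using Cons.prems by auto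
    then show ?thesis using Cons.IH[of "d - 1"] Cons.prems by simp
  qed simp
  then show ?case using Cons.prems
    by (simp add: tri_poly_add tri_poly_row_mult algebra_simps)
qed simp

lemma row_poly_eq_0: "list_all (\<lambda>c. c = 0) r \<Longrightarrow> row_poly r d = 0"
  by (induction r arbitrary: d) auto

lemma tri_poly_eq_0: "tri_zero p \<Longrightarrow> tri_poly p d = 0"
  by (induction p arbitrary: d) (auto simp: tri_zero_def row_poly_eq_0)

lemma homogeneous_of_int [simp]: "homogeneous 0 (of_int c)"
  using homogeneous_Const[of "of_int c"] by (simp add: Const_of_int)

lemma homogeneous_row_poly: "length r \<le> d + 1 \<Longrightarrow> homogeneous (int d) (row_poly r d)"
proof (induction r arbitrary: d)
  case (Cons c r)
  have "homogeneous (int d) (of_int c * Z ^ d)"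
    using homogeneous_mult[OF homogeneous_of_int homogeneous_power[OF homogeneous_Var]] by simp
  moreover have "homogeneous (int d) (Y * row_poly r (d - 1))"
  proof (cases "r = []")
    case False
    then obtain d' where "d = Suc d'" using Cons.prems by (cases d) auto
    then show ?thesis
      using Cons homogeneous_Var_mult[of "int d'" "row_poly r d'" 2] by (simp add: add.commute)
  qed simp
  ultimately show ?case by (simp add: homogeneous_add)
qed simp

lemma homogeneous_tri_poly: "tri_shape p d \<Longrightarrow> homogeneous (int d) (tri_poly p d)"
proof (induction p arbitrary: d)
  case (Cons r p)
  have "homogeneous (int d) (X * tri_poly p (d - 1))"
  proof (cases "p = []")
    case False
    then obtain d' where "d = Suc d'" using Cons.prems by (cases d) auto
    then show ?thesis
      using Cons False homogeneous_Var_mult[of "int d'" "tri_poly p d'" 1] by (simp add: add.commute)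
  qed simp
  then show ?case using Cons.prems by (simp add: homogeneous_add homogeneous_row_poly)
qed simp

section \<open>Coefficient tables as linear functionals\<close>

fun row_entry :: "int list \<Rightarrow> nat \<Rightarrow> int" where
  "row_entry [] j = 0"
| "row_entry (c # r) 0 = c"
| "row_entry (c # r) (Suc j) = row_entry r j"

fun tri_entry :: "int list list \<Rightarrow> nat \<Rightarrow> nat \<Rightarrow> int" where
  "tri_entry [] i j = 0"
| "tri_entry (r # L) 0 j = row_entry r j"
| "tri_entry (r # L) (Suc i) j = tri_entry L i j"

lemma row_entry_tl: "row_entry (tl r) j = row_entry r (Suc j)"
  by (cases r) auto

lemma tri_entry_tl: "tri_entry (tl L) i j = tri_entry L (Suc i) j"
  by (cases L) auto

lemma tri_entry_map_tl: "tri_entry (map tl L) i j = tri_entry L i (Suc j)"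
  by (induction L i j rule: tri_entry.induct) (auto simp: row_entry_tl)

lemma row_entry_add: "row_entry (row_add r s) j = row_entry r j + row_entry s j"
proof (induction r s arbitrary: j rule: row_add.induct)
  case (3 c r e s)
  then show ?case by (cases j) auto
qed auto

lemma tri_entry_add: "tri_entry (tri_add p q) i j = tri_entry p i j + tri_entry q i j"
proof (induction p q arbitrary: i rule: tri_add.induct)
  case (3 r p s q)
  then show ?case by (cases i) (auto simp: row_entry_add)
qed auto

lemma tri_entry_scale: "tri_entry (tri_scale c p) i j = c * tri_entry p i j"
proof (cases "c = 0")
  case False
  have "row_entry (map ((*) c) r) j = c * row_entry r j" for r
    by (induction r j rule: row_entry.induct) auto
  then show ?thesis using False
    by (induction p i j rule: tri_entry.induct) (auto simp: tri_scale_def)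
qed (simp add: tri_scale_def)

definition functional :: "int list list \<Rightarrow> poly3 \<Rightarrow> complex" where
  "functional L g = (\<Sum>m\<in>Poly_Mapping.keys g.
     of_int (tri_entry L (Poly_Mapping.lookup m 1) (Poly_Mapping.lookup m 2)) * Poly_Mapping.lookup g m)"

lemma functional_single:
  "functional L (Poly_Mapping.single m c) = of_int (tri_entry L (Poly_Mapping.lookup m 1) (Poly_Mapping.lookup m 2)) * c"
  by (simp add: functional_def)

lemma functional_add: "functional L (f + g) = functional L f + functional L g"
proof -
  have *: "functional L F = (\<Sum>m\<in>A. of_int (tri_entry L (Poly_Mapping.lookup m 1) (Poly_Mapping.lookup m 2))
      * Poly_Mapping.lookup F m)" if "finite A" "Poly_Mapping.keys F \<subseteq> A" for F A
    unfolding functional_def using that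
    by (intro sum.mono_neutral_left) (auto simp: in_keys_iff)
  show ?thesis
    using keys_add[of f g]
    by (subst (1 2 3) *[of "Poly_Mapping.keys f \<union> Poly_Mapping.keys g"])
      (auto simp: lookup_add distrib_left sum.distrib)
qed

lemma functional_0 [simp]: "functional L 0 = 0" by (simp add: functional_def)

lemma functional_sum: "functional L (sum F A) = (\<Sum>a\<in>A. functional L (F a))"
  by (induction A rule: infinite_finite_induct) (auto simp: functional_add)

lemma functional_Const_mult: "functional L (Const c * g) = c * functional L g"
proof (induction g rule: poly_mapping_add_induct)
  case (single m a)
  show ?case by (simp add: Const_def mult_single functional_single)
qed (simp add: functional_add distrib_left)

lemma functional_of_int_mult: "functional L (of_int c * g) = of_int c * functional L g"
  using functional_Const_mult[of L "of_int c" g] by (simp add: Const_of_int)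

text \<open>The transpose of multiplication by X shifts the rows of the table by one. For Y the
  shift happens inside every row, whence \<open>map tl\<close>.\<close>

lemma functional_X: "functional L (X * g) = functional (tl L) g"
proof (induction g rule: poly_mapping_add_induct)
  case (single m a)
  show ?case by (simp add: Var_def mult_single functional_single lookup_add lookup_single when_def tri_entry_tl)
qed (simp add: functional_add distrib_left)

lemma functional_Y: "functional L (Y * g) = functional (map tl L) g"
proof (induction g rule: poly_mapping_add_induct)
  case (single m a)
  show ?case by (simp add: Var_def mult_single functional_single lookup_add lookup_single when_def tri_entry_map_tl)
qed (simp add: functional_add distrib_left)

text \<open>A table reads only the exponents of X and Y, so it serves in every degree. This is why
  \<open>kills_3\<close> contains \<open>kills_2\<close>: those six conditions concern the cubic
  monomials divisible by Z.\<close>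

lemma functional_Z: "functional L (Z * g) = functional L g"
proof (induction g rule: poly_mapping_add_induct)
  case (single m a)
  show ?case by (simp add: Var_def mult_single functional_single lookup_add lookup_single when_def)
qed (simp add: functional_add distrib_left)

lemma functional_X_power: "functional L (X ^ n * g) = functional ((tl ^^ n) L) g"
  by (induction n arbitrary: L) (simp_all add: functional_X mult.assoc funpow_swap1)

lemma functional_Y_power: "functional L (Y ^ n * g) = functional ((map tl ^^ n) L) g"
  by (induction n arbitrary: L) (simp_all add: functional_Y mult.assoc funpow_swap1)

lemma functional_Z_power: "functional L (Z ^ n * g) = functional L g"
  by (induction n) (simp_all add: functional_Z mult.assoc)

lemma functional_tri_add: "functional (tri_add A B) g = functional A g + functional B g"
  by (simp add: functional_def tri_entry_add distrib_right sum.distrib)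

lemma functional_tri_scale: "functional (tri_scale c A) g = of_int c * functional A g"
  by (simp add: functional_def tri_entry_scale sum_distrib_left mult.assoc)

fun row_pair :: "int list \<Rightarrow> int list \<Rightarrow> int" where
  "row_pair [] s = 0"
| "row_pair (c # r) [] = 0"
| "row_pair (c # r) (e # s) = c * e + row_pair r s"

fun tri_pair :: "int list list \<Rightarrow> int list list \<Rightarrow> int" where
  "tri_pair [] q = 0"
| "tri_pair (r # p) [] = 0"
| "tri_pair (r # p) (s # q) = row_pair r s + tri_pair p q"

lemma row_pair_Nil [simp]: "row_pair r [] = 0" by (cases r) auto
lemma tri_pair_Nil [simp]: "tri_pair p [] = 0" by (cases p) auto

lemma functional_Z_pow: "functional L (Z ^ d) = of_int (tri_entry L 0 0)"
  using functional_Z_power[of L d 1] functional_single[of L 0 1] by simp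

lemma functional_Nil [simp]: "functional [] g = 0"
  by (simp add: functional_def)

lemma functional_row_poly: "functional (l # L) (row_poly r d) = of_int (row_pair l r)"
proof (induction r arbitrary: l L d)
  case (Cons c r)
  have "functional (l # L) (row_poly (c # r) d)
      = of_int (c * tri_entry (l # L) 0 0) + of_int (row_pair (tl l) r)"
    using Cons[of "tl l" "map tl L" "d - 1"]
    by (simp add: functional_add functional_of_int_mult functional_Z_pow functional_Y)
  then show ?case by (cases l) auto
qed simp

lemma functional_tri_poly: "functional L (tri_poly p d) = of_int (tri_pair L p)"
proof (induction p arbitrary: L d)
  case (Cons r p)
  then show ?case
    by (cases L) (simp_all add: functional_add functional_X functional_row_poly)
qed simp

text \<open>The conditions below express that the functional \<open>L\<close> kills the products of the polynomial
  stored in \<open>F\<close> with all monomials of degree two, respectively three.\<close>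

definition kills_2 :: "int list list \<Rightarrow> int list list \<Rightarrow> bool" where
  "kills_2 L F \<longleftrightarrow> list_all (\<lambda>M. tri_pair M F = 0)
     [L, map tl L, map tl (map tl L), tl L, map tl (tl L), tl (tl L)]"

definition kills_3 :: "int list list \<Rightarrow> int list list \<Rightarrow> bool" where
  "kills_3 L F \<longleftrightarrow> kills_2 L F \<and> list_all (\<lambda>M. tri_pair M F = 0)
     [map tl (map tl (map tl L)), map tl (map tl (tl L)), map tl (tl (tl L)), tl (tl (tl L))]"

text \<open>Linearity reduces to a monomial cofactor. Its powers of X and Y are moved onto L as
  contractions, and its power of Z is invisible.\<close>

lemma functional_mult_eq_0:
  assumes h: "homogeneous (int k) h"
    and *: "\<And>a b. a + b \<le> k \<Longrightarrow> tri_pair ((map tl ^^ b) ((tl ^^ a) L)) F = 0"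
  shows "functional L (h * tri_poly F d) = 0"
proof -
  have s: "functional L (Poly_Mapping.single m c * tri_poly F d) = 0" if "mon_deg m = k" for m c
  proof -
    have eq: "Poly_Mapping.single m c * tri_poly F d = Const c * (X ^ Poly_Mapping.lookup m 1
        * (Y ^ Poly_Mapping.lookup m 2 * (Z ^ Poly_Mapping.lookup m 3 * tri_poly F d)))"
      by (simp add: single_eq_Const_Var prod_3 mult.assoc)
    show ?thesis
      unfolding eq using *[of "Poly_Mapping.lookup m 1" "Poly_Mapping.lookup m 2"] that
      by (simp add: functional_Const_mult functional_X_power functional_Y_power functional_Z_power
          functional_tri_poly mon_deg_def sum_3)
  qed
  have sum: "h = (\<Sum>m\<in>Poly_Mapping.keys h. Poly_Mapping.single m (Poly_Mapping.lookup h m))"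
    by (rule poly_mapping_eqI) (auto simp: lookup_sum lookup_single when_def in_keys_iff)
  have "functional L ((\<Sum>m\<in>Poly_Mapping.keys h. Poly_Mapping.single m (Poly_Mapping.lookup h m)) * tri_poly F d) = 0"
    using h s by (simp add: sum_distrib_right functional_sum homogeneous_def)
  then show ?thesis by (simp flip: sum)
qed

lemma kills_2_imp:
  assumes "kills_2 L F" "a + b \<le> 2"
  shows "tri_pair ((map tl ^^ b) ((tl ^^ a) L)) F = 0"
proof -
  have "(a, b) \<in> {(0,0), (0,1), (0,2), (1,0), (1,1), (2,0)}" using assms(2) by auto
  then show ?thesis using assms(1) by (auto simp: kills_2_def numeral_2_eq_2)
qed

lemma kills_3_imp:
  assumes "kills_3 L F" "a + b \<le> 3"
  shows "tri_pair ((map tl ^^ b) ((tl ^^ a) L)) F = 0"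
proof (cases "a + b \<le> 2")
  case True
  then show ?thesis using kills_2_imp assms(1) by (simp add: kills_3_def)
next
  case False
  then have "(a, b) \<in> {(0,3), (1,2), (2,1), (3,0)}" using assms(2) by auto
  then show ?thesis using assms(1) by (auto simp: kills_3_def numeral_2_eq_2 numeral_3_eq_3)
qed

definition monomial_tri :: "nat \<Rightarrow> nat \<Rightarrow> int list list" where
  "monomial_tri i j = replicate i [] @ [replicate j 0 @ [1]]"

lemma row_poly_monomial: "row_poly (replicate j 0 @ [1]) d = Y ^ j * Z ^ (d - j)"
  by (induction j arbitrary: d) (simp_all add: mult.assoc)

lemma tri_poly_monomial: "tri_poly (monomial_tri i j) d = X ^ i * (Y ^ j * Z ^ (d - i - j))"
proof (induction i arbitrary: d)
  case 0
  show ?case by (simp add: monomial_tri_def row_poly_monomial)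
next
  case (Suc i)
  then have "tri_poly (replicate i [] @ [replicate j 0 @ [1]]) (d - 1) = X ^ i * (Y ^ j * Z ^ (d - 1 - i - j))"
    by (simp add: monomial_tri_def)
  then show ?case by (simp add: monomial_tri_def mult.assoc)
qed

text \<open>Contraction by X, Y and Z is \<open>tl\<close>, \<open>map tl\<close> and the identity.
  The result is therefore the table of the functional sending g to the sum of the values L((a X + b
  Y + c Z) g).\<close>

fun combine :: "int list list list \<Rightarrow> (int \<times> int \<times> int) list \<Rightarrow> int list list" where
  "combine (L # Ls) ((a, b, c) # cs) = tri_add (tri_add (tri_scale a (tl L)) (tri_scale b (map tl L)))
     (tri_add (tri_scale c L) (combine Ls cs))"
| "combine _ _ = []"

lemma functional_combine:
  assumes "\<And>L i. L \<in> set Ls \<Longrightarrow> functional L (Var i * g) = 0"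
  shows "functional (combine Ls cs) g = 0"
  using assms
proof (induction Ls cs rule: combine.induct)
  case (1 L Ls a b c cs)
  have "functional (tl L) g = 0" "functional (map tl L) g = 0" "functional L g = 0"
    using 1(2)[of L 1] 1(2)[of L 2] 1(2)[of L 3] by (simp_all add: functional_X functional_Y functional_Z)
  then show ?case using 1 by (simp add: functional_tri_add functional_tri_scale)
qed simp_all

text \<open>The table form of the map sending a polynomial p to the sum of V(p) h, evaluated at the
  polynomial stored in \<open>e\<close>.\<close>

fun linear_combination :: "int list list \<Rightarrow> (int list list \<times> int list list) list \<Rightarrow> int list list" where
  "linear_combination e [] = []"
| "linear_combination e ((h, V) # hV) = tri_add (tri_scale (tri_pair V e) h) (linear_combination e hV)"

definition combine3 :: "int list list \<times> int list list \<times> int list list \<Rightarrow> int list list \<times> int list list \<times> int list list \<Rightarrow> int list list" where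
  "combine3 u F = (case u of (u1, u2, u3) \<Rightarrow> case F of (F1, F2, F3) \<Rightarrow>
     tri_add (tri_mult u1 F1) (tri_add (tri_mult u2 F2) (tri_mult u3 F3)))"

definition shape3 :: "nat \<Rightarrow> int list list \<times> int list list \<times> int list list \<Rightarrow> bool" where
  "shape3 d u = (case u of (u1, u2, u3) \<Rightarrow> tri_shape u1 d \<and> tri_shape u2 d \<and> tri_shape u3 d)"

definition partials :: "poly3 \<Rightarrow> int list list \<times> int list list \<times> int list list \<Rightarrow> bool" where
  "partials f F = (case F of (F1, F2, F3) \<Rightarrow>
     pdiff 1 f = tri_poly F1 5 \<and> pdiff 2 f = tri_poly F2 5 \<and> pdiff 3 f = tri_poly F3 5)"

lemma combine3_in_jacobian_ideal:
  assumes "partials f F" "shape3 5 F" "shape3 d u"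
  shows "tri_poly (combine3 u F) (d + 5) \<in> jacobian_ideal f"
  using assms jacobian_ideal_iff
  by (auto simp: partials_def shape3_def combine3_def tri_poly_add tri_poly_mult add.assoc
      split: prod.splits)

text \<open>A certificate for a socle element \<open>G\<close> of degree seven: cofactors expressing its multiples
  by the variables, and a functional \<open>L\<close> separating it from the ideal.\<close>

theorem socle_elem_certificate:
  assumes f: "homogeneous 6 f" "partials f (F1, F2, F3)" "shape3 5 (F1, F2, F3)"
    and G: "tri_shape G 7" "shape3 3 a" "shape3 3 b" "shape3 3 c"
    and X: "tri_zero (tri_add (combine3 a (F1, F2, F3)) (tri_scale (-1) (tri_mult [[], [1]] G)))"
    and Y: "tri_zero (tri_add (combine3 b (F1, F2, F3)) (tri_scale (-1) (tri_mult [[0, 1]] G)))"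
    and Z: "tri_zero (tri_add (combine3 c (F1, F2, F3)) (tri_scale (-1) (tri_mult [[1]] G)))"
    and L: "kills_2 L F1" "kills_2 L F2" "kills_2 L F3" "tri_pair L G \<noteq> 0"
  shows "socle_elem 7 (jacobian_ideal f) (tri_poly G 7)"
  unfolding socle_elem_def
proof (intro conjI allI)
  let ?g = "tri_poly G 7"
  show hom: "homogeneous 7 ?g" using homogeneous_tri_poly[OF G(1)] by simp
  show "?g \<notin> jacobian_ideal f"
  proof
    assume "?g \<in> jacobian_ideal f"
    then obtain u v w where u: "homogeneous 2 u" "homogeneous 2 v" "homogeneous 2 w"
      "?g = u * pdiff 1 f + v * pdiff 2 f + w * pdiff 3 f"
      using jacobian_ideal_homogeneous[OF f(1), of ?g 7] by (auto simp: hcomp_homogeneous[OF hom])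
    have "functional L (u * tri_poly F 5) = 0" if "homogeneous 2 u" "kills_2 L F" for u F
      using functional_mult_eq_0[of 2 u L F 5] kills_2_imp[OF that(2)] that(1) by simp
    then have "functional L ?g = 0"
      using u L f(2) by (simp add: partials_def functional_add)
    then show False using L(4) by (simp add: functional_tri_poly)
  qed
  have "tri_poly q 1 * ?g \<in> jacobian_ideal f"
    if "tri_zero (tri_add (combine3 a (F1, F2, F3)) (tri_scale (-1) (tri_mult q G)))" "shape3 3 a" "tri_shape q 1" for a q
  proof -
    have "tri_poly (combine3 a (F1, F2, F3)) 8 - tri_poly (tri_mult q G) 8 = 0"
      using tri_poly_eq_0[OF that(1), of 8] by (simp add: tri_poly_add tri_poly_scale)
    moreover have "tri_poly (tri_mult q G) 8 = tri_poly q 1 * ?g"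
      using tri_poly_mult[OF that(3) G(1)] by simp
    ultimately show ?thesis
      using combine3_in_jacobian_ideal[OF f(2,3) that(2)] by simp
  qed
  \<comment> \<open>The tables \<open>[[], [1]]\<close>, \<open>[[0, 1]]\<close> and
    \<open>[[1]]\<close> represent X, Y and Z in degree one.\<close>
  from this[OF X G(2)] this[OF Y G(3)] this[OF Z G(4)]
  have "X * ?g \<in> jacobian_ideal f" "Y * ?g \<in> jacobian_ideal f" "Z * ?g \<in> jacobian_ideal f"
    by simp_all
  then show "Var i * ?g \<in> jacobian_ideal f" for i using exhaust_3[of i] by metis
qed

definition monomials_7 :: "int list list list" where
  "monomials_7 = concat (map (\<lambda>i. map (monomial_tri i) [0..<8 - i]) [0..<8])"

definition reduces :: "int \<Rightarrow> int list list \<times> int list list \<times> int list list \<Rightarrow>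
    (int list list \<times> int list list) list \<Rightarrow> (int list list \<times> int list list \<times> int list list) list \<Rightarrow> bool" where
  "reduces N F hV us \<longleftrightarrow> list_all2 (\<lambda>e u. shape3 2 u \<and>
     tri_zero (tri_add (tri_scale (- N) e) (tri_add (combine3 u F) (linear_combination e hV)))) monomials_7 us"

text \<open>A certificate that there is no socle element of degree seven: modulo the ideal, \<open>N\<close> times
  each monomial of degree seven is a combination of the polynomials \<open>h\<close> whose coefficients are the
  values of combinations of functionals \<open>g \<mapsto> L (Var i * g)\<close> with \<open>L\<close> killing the ideal in degree
  eight.\<close>

theorem no_socle_elem_certificate:
  assumes f: "homogeneous 6 f" "partials f (F1, F2, F3)" "shape3 5 (F1, F2, F3)"
    and L: "list_all (\<lambda>L. kills_3 L F1 \<and> kills_3 L F2 \<and> kills_3 L F3) Ls"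
    and u: "reduces N (F1, F2, F3) (map (\<lambda>(h, cs). (h, combine Ls cs)) hcs) us"
    and N: "N \<noteq> 0"
  shows "\<nexists>g. socle_elem 7 (jacobian_ideal f) g"
proof
  assume "\<exists>g. socle_elem 7 (jacobian_ideal f) g"
  then obtain g where g: "homogeneous 7 g" "g \<notin> jacobian_ideal f" "\<And>i. Var i * g \<in> jacobian_ideal f"
    by (auto simp: socle_elem_def)
  have Ls: "functional L (Var i * g) = 0" if "L \<in> set Ls" for L i
  proof -
    have hom: "homogeneous 8 (Var i * g)" using homogeneous_Var_mult[OF g(1)] by simp
    obtain a b c where a: "homogeneous 3 a" "homogeneous 3 b" "homogeneous 3 c"
      "Var i * g = a * pdiff 1 f + b * pdiff 2 f + c * pdiff 3 f"
      using jacobian_ideal_homogeneous[OF f(1) g(3), of 8 i] by (auto simp: hcomp_homogeneous[OF hom])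
    have "functional L (a * tri_poly F 5) = 0" if "homogeneous 3 a" "kills_3 L F" for a F
      using functional_mult_eq_0[of 3 a L F 5] kills_3_imp[OF that(2)] that(1) by simp
    then show ?thesis using a f(2) L that by (auto simp: partials_def functional_add list_all_iff)
  qed
  define hV where "hV = map (\<lambda>(h, cs). (h, combine Ls cs)) hcs"
  have V0: "functional V g = 0" if hV: "(h, V) \<in> set hV" for h V
  proof -
    obtain cs where "V = combine Ls cs" using hV by (auto simp: hV_def)
    then show ?thesis using functional_combine[of Ls g cs] Ls by simp
  qed
  \<comment> \<open>The certificate makes \<open>S\<close> agree with multiplication by N modulo the
    ideal on every monomial of degree seven, hence on g by linearity. But \<open>S g\<close> is
    zero, because every V kills g.\<close>
  define S where "S = (\<lambda>p. \<Sum>(h, V)\<leftarrow>hV. Const (functional V p) * tri_poly h 7)"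
  have S_add: "S (p + q) = S p + S q" for p q
    unfolding S_def by (induction hV) (auto simp: functional_add Const_add algebra_simps)
  have S_Const: "S (Const c * p) = Const c * S p" for c p
    unfolding S_def by (induction hV) (auto simp: functional_Const_mult Const_mult distrib_left mult.assoc)
  have monomial: "of_int N * tri_poly e 7 - S (tri_poly e 7) \<in> jacobian_ideal f" if em: "e \<in> set monomials_7" for e
  proof -
    obtain i where i: "i < length monomials_7" "monomials_7 ! i = e" using em by (auto simp: in_set_conv_nth)
    define u' where "u' = us ! i"
    have u': "shape3 2 u'"
      "tri_zero (tri_add (tri_scale (- N) e) (tri_add (combine3 u' (F1, F2, F3)) (linear_combination e hV)))"
      using list_all2_nthD[OF u[unfolded reduces_def] i(1)] by (simp_all add: u'_def hV_def i(2))
    have "tri_poly (linear_combination e hV) 7 = S (tri_poly e 7)"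
      unfolding S_def
      by (induction hV) (auto simp: tri_poly_add tri_poly_scale functional_tri_poly Const_of_int)
    moreover have "tri_poly (tri_add (tri_scale (- N) e)
        (tri_add (combine3 u' (F1, F2, F3)) (linear_combination e hV))) 7 = 0"
      using u' by (intro tri_poly_eq_0) auto
    ultimately have "of_int N * tri_poly e 7 - S (tri_poly e 7) = tri_poly (combine3 u' (F1, F2, F3)) 7"
      by (simp add: tri_poly_add tri_poly_scale algebra_simps eq_neg_iff_add_eq_0)
    then show ?thesis using combine3_in_jacobian_ideal[OF f(2,3) u'(1)] by simp
  qed
  have single: "of_int N * Poly_Mapping.single m c - S (Poly_Mapping.single m c) \<in> jacobian_ideal f"
    if "mon_deg m = 7" for m c
  proof -
    let ?e = "monomial_tri (Poly_Mapping.lookup m 1) (Poly_Mapping.lookup m 2)"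
    have d: "Poly_Mapping.lookup m 1 + Poly_Mapping.lookup m 2 + Poly_Mapping.lookup m 3 = 7"
      using that by (simp add: mon_deg_def sum_3)
    then have "7 - Poly_Mapping.lookup m 1 - Poly_Mapping.lookup m 2 = Poly_Mapping.lookup m 3" by simp
    then have s: "Poly_Mapping.single m c = Const c * tri_poly ?e 7"
      by (simp add: single_eq_Const_Var prod_3 tri_poly_monomial mult.assoc)
    have "?e \<in> set monomials_7"
      using d by (auto simp: monomials_7_def intro!: bexI[of _ "Poly_Mapping.lookup m 1"] imageI)
    then have "Const c * (of_int N * tri_poly ?e 7 - S (tri_poly ?e 7)) \<in> jacobian_ideal f"
      by (intro jacobian_ideal_mult monomial)
    then show ?thesis by (simp add: s S_Const algebra_simps)
  qed
  have K: "of_int N * p - S p \<in> jacobian_ideal f" if "finite A" "\<forall>m\<in>A. mon_deg m = 7"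
    "p = (\<Sum>m\<in>A. Poly_Mapping.single m (Poly_Mapping.lookup g m))" for A p
    using that
  proof (induction A arbitrary: p rule: finite_induct)
    case empty
    have "S (Const 0 * 0) = 0" by (simp only: S_Const) simp
    then show ?case using empty jacobian_ideal_0 by simp
  next
    case (insert m A)
    let ?p = "\<Sum>m\<in>A. Poly_Mapping.single m (Poly_Mapping.lookup g m)"
    have "(of_int N * Poly_Mapping.single m (Poly_Mapping.lookup g m) - S (Poly_Mapping.single m (Poly_Mapping.lookup g m)))
        + (of_int N * ?p - S ?p) \<in> jacobian_ideal f"
      using insert by (intro jacobian_ideal_add single) auto
    then show ?case using insert by (simp add: S_add algebra_simps)
  qed
  have sum: "g = (\<Sum>m\<in>Poly_Mapping.keys g. Poly_Mapping.single m (Poly_Mapping.lookup g m))"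
    by (rule poly_mapping_eqI) (auto simp: lookup_sum lookup_single when_def in_keys_iff)
  have "\<forall>m\<in>Poly_Mapping.keys g. mon_deg m = 7"
    using g(1) by (simp add: homogeneous_def)
  then have "of_int N * g - S g \<in> jacobian_ideal f"
    by (rule K[OF finite_keys _ sum])
  moreover have "S g = 0"
  proof -
    have eq: "map (\<lambda>(h, V). Const (functional V g) * tri_poly h 7) hV = map (\<lambda>_. 0) hV"
      using V0 by auto
    show ?thesis unfolding S_def eq by simp
  qed
  ultimately have "of_int N * g \<in> jacobian_ideal f" by simp
  then have "Const (1 / of_int N) * (of_int N * g) \<in> jacobian_ideal f"
    by (rule jacobian_ideal_mult)
  moreover have "Const (1 / of_int N) * of_int N = 1"
    using N Const_mult[of "1 / of_int N" "of_int N"] by (simp add: Const_of_int)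
  ultimately have "g \<in> jacobian_ideal f" by (simp flip: mult.assoc)
  then show False using g(2) by simp
qed


section \<open>The six certificates\<close>

text \<open>Obtained by linear algebra over the rationals. The suffixes are those of the curves, but 41 and 82
  refer to the polynomials \<open>U41\<close> and \<open>U82\<close> below, which define the same curves in other coordinates.\<close>

definition P1_51 :: "int list list" where
  "P1_51 = [[], [32, -10, -26, 6, 4], [], [-28, 4, 12], [], [6]]"

definition P2_51 :: "int list list" where
  "P2_51 = [[6, 28, -21, -16, 10], [], [-5, -26, 9, 8], [], [1, 6]]"

definition P3_51 :: "int list list" where
  "P3_51 = [[-72, 30, 56, -21, -8, 2], [], [64, -15, -26, 3], [], [-14, 1]]"

definition L_51 :: "int list list list" where
  "L_51 = [[[], [0, 0, 0, 0, 72, 148, 294, 445], [], [0, 0, -64, -136, -132, -126], [], [80, 144, 24, -124],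
   [], [176, 424]], [[0, 0, 0, 0, 16, -456, 556, 2098, 12175], [], [0, 0, 0, 640, -56, -1164,
   -5098], [], [0, -880, 64, 2312, 4764], [], [-144, -5168, -5384], [], [6864]], [[], [0, 0, 0,
   16, 24, 36, 46, 57], [], [0, 0, -16, 8, 12, 26], [], [0, 16, -40, 4], [], [-16, 72]], [[0, 0,
   0, 0, 0, -1600, 1852, 7134, 41293], [], [0, 0, 16, 2184, -320, -4148, -17518], [], [0, -2936,
   376, 8072, 16116], [], [-696, -17520, -17864], [], [22080]], [[], [0, 0, 0, 0, 56, 84, 182,
   245], [], [0, 40, -32, -48, -36, -38], [], [0, 192, -8, -12], [], [-112, 512]], [[0, 0, 0, 8,
   0, -440, 532, 2022, 11549], [], [0, 0, 0, 616, -112, -1188, -4918], [], [0, -800, 120, 2304,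
   4484], [], [-248, -4848, -4936], [], [5840]], [[], [0, 0, 16, 0, 8, -4, 2, -9], [], [0, 0, 32,
   8, 20, 6], [], [0, -16, 56, 12], [], [16, -72]], [[0, 0, 0, 0, 0, -304, 388, 1434, 8071], [],
   [0, 8, 0, 416, -96, -852, -3434], [], [0, -520, 104, 1608, 3100], [], [-200, -3288, -3368], [],
   [3904]], [[0, 0, 16, 0, 0, 3424, -3980, -15326, -88677], [], [0, 0, 0, -4680, 688, 8884,
   37598], [], [0, 6296, -728, -17288, -34580], [], [1480, 37552, 38520], [], [-47488]], [[], [0,
   80, 0, 0, -232, -268, -594, -695], [], [0, 0, 144, 136, 12, 26], [], [0, -384, 216, 84], [],
   [304, -1304]], [[0, 2, 0, 0, 0, 188, -230, -862, -4905], [], [0, 0, 0, -256, 52, 512, 2088],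
   [], [0, 332, -56, -976, -1896], [], [112, 2036, 2076], [], [-2436]]]"

text \<open>Each entry pairs a monomial with the coefficients that assemble, from contractions of
  \<open>L_51\<close>, 599040 times its coordinate function on S_7/J_7. The 18 monomials are a basis
  of this quotient: the ideal is spanned by 3 times 6 products inside a space of dimension 36, so
  they cannot be fewer, and the reductions show that they span.\<close>

definition C_51 :: "(int list list \<times> (int \<times> int \<times> int) list) list" where
  "C_51 = [([[], [], [], [0, 0, 1]], [(0, 71500, -138060), (-5200, 0, 0), (0, 0, -113750), (0, 0, 0), (0, 0,
   0), (0, 0, 0), (0, 0, 0), (0, 0, 0), (0, 0, 0), (0, 0, 0), (0, 0, 0)]), ([[], [], [], [], [0,
   1]], [(660, 0, 0), (0, 60, -1170), (-60, 0, 0), (0, 0, 180), (0, 0, 0), (0, 0, 0), (0, 0, 0),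
   (0, 0, 0), (0, 0, 0), (0, 0, 0), (0, 0, 0)]), ([[], [], [], [], [], [1]], [(0, 57200, -102960),
   (-4160, 0, 0), (0, 0, -91000), (0, 0, 0), (0, 0, 0), (0, 0, 0), (0, 0, 0), (0, 0, 0), (0, 0,
   0), (0, 0, 0), (0, 0, 0)]), ([[0, 0, 0, 0, 1]], [(36300, 0, 0), (0, 3300, -26910), (-3300, 0,
   0), (0, 0, 9900), (0, 0, 0), (0, 0, 0), (0, 0, 0), (0, 0, 0), (0, 0, 0), (0, 0, 0), (0, 0,
   0)]), ([[], [0, 0, 0, 1]], [(0, 71500, -138060), (-5200, 0, 0), (0, 0, -76310), (0, 0, 0), (0,
   0, 0), (0, 0, 0), (0, 0, 0), (0, 0, 0), (0, 0, 0), (0, 0, 0), (0, 0, 0)]), ([[], [], [0, 0,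
   1]], [(121110, 0, 0), (0, 11010, -214695), (-11010, 0, 0), (0, 0, 70470), (0, 0, 0), (0, 0, 0),
   (0, 0, 0), (0, 0, 0), (0, 0, 0), (0, 0, 0), (0, 0, 0)]), ([[], [], [], [0, 1]], [(0, 47840,
   -93600), (-4160, 0, 0), (0, 0, -48880), (0, 0, 0), (0, 0, 0), (0, 0, 0), (0, 0, 0), (0, 0, 0),
   (0, 0, 0), (0, 0, 0), (0, 0, 0)]), ([[], [], [], [], [1]], [(70518, 0, 0), (0, 5730, -145431),
   (-5730, 0, 0), (0, 0, 47142), (0, 0, 0), (0, 0, 0), (0, 0, 0), (0, 0, 0), (0, 0, 0), (0, 0, 0),
   (0, 0, 0)]), ([[0, 0, 0, 1]], [(66000, 0, 0), (0, 6000, -173160), (31440, 0, 0), (0, 0, 55440),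
   (0, 0, 0), (0, 0, 0), (0, 0, 0), (0, 0, 0), (0, 0, 0), (0, 0, 0), (0, 0, 0)]), ([[], [0, 0,
   1]], [(0, -152360, 285480), (10400, 0, 0), (0, 37440, 213460), (0, 0, 0), (0, 0, 0), (0, 0, 0),
   (0, 0, 0), (0, 0, 0), (0, 0, 0), (0, 0, 0), (0, 0, 0)]), ([[], [], [0, 1]], [(23028, 0, 0), (0,
   -122820, -44226), (122820, 0, 0), (0, 37440, 17172), (0, 0, 0), (0, 0, 0), (0, 0, 0), (0, 0,
   0), (0, 0, 0), (0, 0, 0), (0, 0, 0)]), ([[], [], [], [1]], [(0, -250588, 446940), (17680, 0,
   0), (0, 0, 368030), (0, 0, 0), (0, 14976, 0), (0, 0, 0), (0, 0, 0), (0, 0, 0), (0, 0, 0), (0,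
   0, 0), (0, 0, 0)]), ([[0, 0, 1]], [(-287070, 0, 0), (0, -94170, 525915), (94170, 0, 0), (0, 0,
   -170190), (0, 0, 0), (0, 74880, 0), (0, 0, 0), (0, 0, 0), (0, 0, 0), (0, 0, 0), (0, 0, 0)]),
   ([[], [0, 1]], [(0, -109980, 222300), (9360, 0, 0), (0, 0, 101790), (0, 0, 0), (0, 0, 0), (0,
   0, 0), (0, 37440, 0), (0, 0, 0), (0, 0, 0), (0, 0, 0), (0, 0, 0)]), ([[], [], [1]], [(-343230,
   0, 0), (0, -75450, 703755), (75450, 0, 0), (0, 0, -226350), (0, 0, 0), (0, 0, 0), (0, 0, 0),
   (0, 74880, 0), (0, 0, 0), (0, 0, 0), (0, 0, 0)]), ([[0, 1]], [(-62328, 0, 0), (0, 262200,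
   134316), (-262200, 0, 0), (0, 0, -48312), (0, 0, 0), (0, 0, 0), (0, 0, 0), (0, 0, 0), (0,
   37440, 0), (0, 0, 0), (0, 0, 0)]), ([[], [1]], [(0, 274248, -491400), (-18720, 0, 0), (0, 0,
   -376740), (0, 0, 0), (0, 0, 0), (0, 0, 0), (0, 0, 0), (0, 0, 0), (0, 0, 0), (0, 7488, 0), (0,
   0, 0)]), ([[1]], [(402372, 0, 0), (0, 149580, -842634), (-149580, 0, 0), (0, 0, 269028), (0, 0,
   0), (0, 0, 0), (0, 0, 0), (0, 0, 0), (0, 0, 0), (0, 0, 0), (0, 299520, 0)])]"

text \<open>Quadratic cofactors in the order of \<open>monomials_7\<close>; the entries at the basis
  monomials are zero because nothing has to be reduced there.\<close>

definition U_51 :: "(int list list \<times> int list list \<times> int list list) list" where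
  "U_51 = [([], [], []), ([], [], []), ([], [], []), ([], [], []), ([], [], []), ([], [[-112320]],
   [[299520]]), ([[], [873600, -62400]], [[1048320, -174720, -62400]], [[2820480, 611520], [],
   [374400]]), ([[], [499200, 343200]], [[5091840, 424320, -330720], [], [-374400]], [[9784320,
   2851680, 299520], [], [187200]]), ([], [], []), ([], [], []), ([], [], []), ([], [], []),
   ([[149760]], [], []), ([[3594240, -748800]], [[], [449280]], [[], [1797120]]), ([[9135360,
   1123200, -748800]], [[], [2171520, 449280]], [[], [4942080, 1797120]]), ([], [], []), ([], [],
   []), ([], [], []), ([], [[74880]], []), ([[], [-1048320, 74880]], [[-673920, 149760, 74880]],
   [[-1647360, -374400], [], [-449280]]), ([[], [-948480, -386880]], [[-3631680, 99840, 361920],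
   [], [449280]], [[-4842240, -1809600], [], [-374400]]), ([], [], []), ([], [], []), ([], [],
   []), ([[-3444480, 898560]], [[], [-599040]], [[], [-1797120]]), ([[-8386560, -1048320,
   898560]], [[], [-2246400, -599040]], [[], [-4792320, -1797120]]), ([], [], []), ([], [], []),
   ([[], [1397760, -99840]], [[973440, -99840, -99840]], [[1697280, 499200], [], [599040]]), ([[],
   [1148160, 524160]], [[3968640, -49920, -374400], [], [-599040]], [[4742400, 1872000], [],
   [449280]]), ([], [], []), ([[4343040, -1198080]], [[], [898560]], [[], [2396160]]),
   ([[10033920, 1497600, -1198080]], [[], [2995200, 898560]], [[], [5690880, 2396160]]), ([[],
   [-1996800, 149760]], [[-1572480, 99840, 149760]], [[-2296320, -748800], [], [-898560]]), ([[],
   [-1547520, -698880]], [[-5166720, -49920, 499200], [], [898560]], [[-5740800, -2496000], [],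
   [-599040]]), ([[-13927680, -2396160, 1797120], [], [99840]], [[], [-4492800, -1397760]], [[],
   [-7987200, -3594240]])]"

lemma partials_shape_51: "shape3 5 (P1_51, P2_51, P3_51)"
  by (simp add: shape3_def P1_51_def P2_51_def P3_51_def)

lemma kills_51: "list_all (\<lambda>L. kills_3 L P1_51 \<and> kills_3 L P2_51 \<and> kills_3 L P3_51) L_51"
  by code_simp

lemma reduces_51: "reduces 599040 (P1_51, P2_51, P3_51) (map (\<lambda>(h, cs). (h, combine L_51 cs)) C_51) U_51"
  by code_simp

lemmas no_socle_51 = no_socle_elem_certificate[OF _ _ partials_shape_51 kills_51 reduces_51 numeral_neq_zero]

section \<open>Degree seven for \<open>W30_81\<close>: no socle element\<close>

definition P1_81 :: "int list list" where
  "P1_81 = [[6, 0, 3, 0, -3], [40, 0, -16, 0, -2], [-21, 0, 6], [-36, 0, 12], [5], [6]]"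

definition P2_81 :: "int list list" where
  "P2_81 = [[0, 0, 0, 36, 0, -18], [0, 6, 0, -12], [0, -16, 0, -4], [0, 4], [0, 6]]"

definition P3_81 :: "int list list" where
  "P3_81 = [[-72, 0, 0, 0, 18], [30, 0, 9, 0, -3], [80, 0, -16], [-21, 0, 2], [-18], [1]]"

definition L_81 :: "int list list list" where
  "L_81 = [[[0, 0, 0, 0, 0, 32, 0, 111], [0, 0, 0, 0, 0, -57, 0, -216], [0, 0, 0, -36], [0, 0, 0, 99, 0,
   117], [0, 72, 0, -135], [0, -225, 0, 162], [0, 666], [0, -1521]], [[0, 0, 0, 0, 0, -56, 0,
   -147], [0, 0, 0, 96, 0, 261, 0, 576], [0, 0, 0, -36, 0, -216], [0, 0, 0, 81, 0, 297], [0, 0, 0,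
   27], [0, 189, 0, 162], [0, -378], [0, 1323]], [[0, 0, 0, 0, 0, 0, -831, 0, -6794], [0, 0, 0, 0,
   -1632, 0, -4371], [0, 0, 256, 0, 3105, 0, 12668], [0, 0, 988, 0, -2686], [0, 0, -3663, 0,
   -3990], [-2776, 0, 5919], [9553, 0, -3360], [-29628], [60158]], [[0, 0, 0, 0, 0, 0, -675, 0,
   -9010], [0, 0, 0, 0, -3616, 0, -10087], [0, 0, 0, 0, 4733, 0, 21932], [0, 0, 2732, 0, -3206],
   [512, 0, -7923, 0, -10158], [-7096, 0, 11331], [21869, 0, -7200], [-65164], [132854]], [[0, 0,
   0, 64, 0, 104, 0, 153], [0, 0, 0, 0, 0, 21, 0, 126], [0, 0, 0, 108, 0, 144], [0, 0, 0, -135, 0,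
   -243], [0, 0, 0, 351], [0, 189, 0, -324], [0, -378], [0, 1323]], [[0, 0, 0, 0, 0, -296, 0,
   -1029], [0, 0, 0, 0, 0, 363, 0, 1422], [0, 192, 0, 564, 0, 444], [0, 0, 0, -729, 0, -945], [0,
   0, 0, 1701], [0, 1539, 0, -1296], [0, -3402], [0, 10449]], [[0, 0, 512, 0, 0, 0, 1713, 0,
   10198], [0, 0, 0, 0, -96, 0, 477], [0, 0, 0, 0, -3375, 0, -12564], [0, 0, -612, 0, 2178], [0,
   0, 3105, 0, 2538], [936, 0, -6993], [-7551, 0, 2160], [20196], [-45666]], [[0, 0, 0, 0, 0, 0,
   945, 0, 8382], [256, 0, 0, 0, 2240, 0, 6461], [0, 0, 0, 0, -3567, 0, -16428], [0, 0, -2436, 0,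
   1554], [0, 0, 6561, 0, 8658], [3912, 0, -11025], [-14271, 0, 8280], [43092], [-91002]]]"

definition C_81 :: "(int list list \<times> (int \<times> int \<times> int) list) list" where
  "C_81 = [([[], [], [0, 0, 0, 1]], [(-129920, 0, -56080), (0, 0, 40880), (0, 0, 0), (0, 0, 0), (0, 0, 0),
   (0, 0, 0), (0, 0, 0), (0, -3840, 0)]), ([[], [], [], [], [0, 1]], [(-64960, 0, -8840), (0, 0,
   20440), (0, 0, 0), (0, 0, 0), (0, 0, 0), (0, 0, 0), (0, 0, 0), (0, -1920, 0)]), ([[], [], [],
   [], [], [1]], [(0, 151552, 0), (0, 0, 0), (0, 0, 0), (0, 0, 16128), (0, -65536, 0), (0, 0, 0),
   (-20480, 0, 8192), (0, 0, 0)]), ([[0, 0, 0, 0, 1]], [(0, -1790784, 0), (0, 0, 0), (0, 0, 0),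
   (0, 0, -195696), (0, 790272, 0), (0, 0, 0), (244800, 0, -98784), (0, 0, 0)]), ([[], [0, 0, 0,
   1]], [(-48720, 0, -21030), (0, 0, 29730), (0, 0, 0), (0, 0, 0), (0, 0, 0), (0, 0, 0), (0, 0,
   0), (0, -1440, 0)]), ([[], [], [0, 0, 1]], [(0, 1623424, 0), (0, 0, 0), (0, 0, 0), (0, 0,
   177696), (0, -704512, 0), (0, 0, 0), (-222080, 0, 88064), (0, 0, 0)]), ([[], [], [], [0, 1]],
   [(-29520, 0, 38970), (0, 0, 22530), (0, 0, 0), (0, 0, 0), (0, 0, 0), (0, 0, 0), (0, 0, 0), (0,
   -1440, 0)]), ([[], [], [], [], [1]], [(0, 2100416, 0), (0, 0, 0), (0, 0, 0), (0, 0, 226224),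
   (0, -908288, 0), (0, 0, 0), (-283840, 0, 113536), (0, 0, 0)]), ([[0, 0, 0, 1]], [(219240, 0,
   56835), (14400, 0, -63585), (0, 0, 0), (0, 0, 0), (0, 0, 0), (0, 0, 0), (0, 0, 0), (0, 6480,
   0)]), ([[], [0, 0, 1]], [(0, -734208, 0), (0, 14400, 0), (0, 0, 0), (0, 0, -79272), (0, 325824,
   0), (0, 0, 0), (99840, 0, -40728), (0, 0, 0)]), ([[], [], [0, 1]], [(449640, 0, 269235), (0, 0,
   -100785), (0, 5400, 0), (0, 0, 0), (0, 0, 0), (0, 0, 0), (0, 0, 0), (0, 15480, 0)]), ([[], [],
   [], [1]], [(0, 1327328, 0), (0, 0, 0), (0, 0, 0), (2700, 0, 116172), (0, -448544, 0), (0, 0,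
   0), (-145180, 0, 56068), (0, 0, 0)]), ([[0, 0, 1]], [(0, -277056, 0), (0, 0, 0), (0, 0, 0), (0,
   0, -29484), (0, 119808, 0), (0, 0, 0), (37440, 0, -12276), (0, 0, 0)]), ([[], [0, 1]],
   [(170520, 0, -80295), (0, 0, -95955), (0, 0, 0), (0, 0, 0), (0, 0, 0), (7200, 0, 0), (0, 0, 0),
   (0, 5040, 0)]), ([[], [], [1]], [(0, -8744384, 0), (0, 0, 0), (0, 0, 0), (0, 0, -952956), (0,
   3813152, 0), (0, 7200, 0), (1193920, 0, -476644), (0, 0, 0)]), ([[0, 1]], [(-506880, 0,
   -273420), (0, 0, 178020), (0, 0, 0), (0, 0, 0), (0, 0, 0), (0, 0, 0), (0, 2700, 0), (0, -15660,
   0)]), ([[], [1]], [(0, -2315904, 0), (0, 0, 0), (0, 0, 0), (0, 0, -246456), (0, 1001472, 0),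
   (0, 0, 0), (312960, 0, -125184), (0, 0, 5400)]), ([[1]], [(0, 7468704, 0), (0, 0, 0), (0, 0,
   0), (0, 0, 845316), (0, -3392352, 0), (0, 0, 0), (-1059480, 0, 424044), (5400, 0, 0)])]"

definition U_81 :: "(int list list \<times> int list list \<times> int list list) list" where
  "U_81 = [([], [], []), ([], [], []), ([], [], []), ([], [], []), ([], [], []), ([], [[-76800]], []),
   ([[-54000], [182400], [-9600]], [[0, -19200], [0, -9600]], [[-69600, 0, 57600], [-9600],
   [57600]]), ([[0, 626400], [0, -19200]], [[-910800, 0, -76800], [381600], [-28800]], [[0,
   -652800], [0, 288000]]), ([], [], []), ([], [], []), ([], [], []), ([], [], []), ([[86400]],
   [], [[-518400]]), ([[0, 86400]], [[-532800]], [[0, -518400]]), ([[2322000, 0, 86400],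
   [-3556800], [136800]], [[0, -1353600], [0, 136800]], [[39880800, 0, -1339200], [5882400],
   [-820800]]), ([], [], []), ([], [], []), ([], [], []), ([], [], []), ([[-226800], [86400]], [],
   [[-3045600], [-518400]]), ([[0, -1231200], [0, 86400]], [[1846800], [-669600]], [[0, 1641600],
   [0, -518400]]), ([], [], []), ([], [], []), ([[129600]], [], [[-86400]]), ([], [[518400],
   [-86400]], [[0, 518400]]), ([[-1620000], [3456000], [-136800]], [[0, 1339200], [0, -223200]],
   [[-38059200, 0, 1339200], [-5277600], [820800]]), ([], [], []), ([], [], []), ([[-226800],
   [604800], [-28800]], [[0, 172800], [0, -28800]], [[-3218400, 0, 172800], [-374400], [172800]]),
   ([[0, 1231200]], [[-2451600], [756000], [-86400]], [[0, -2246400], [0, 518400]]), ([], [], []),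
   ([[0, 259200]], [[-1252800], [172800]], [[0, -1209600]]), ([[5410800, 0, 259200], [-8596800],
   [338400]], [[0, -3283200], [0, 511200]], [[93204000, 0, -3240000], [13341600], [-2030400]]),
   ([[291600], [-950400], [57600]], [[0, -345600], [0, 57600]], [[5248800, 0, -345600], [576000],
   [-345600]]), ([[0, -3045600], [0, 259200]], [[5778000], [-1792800], [172800]], [[0, 5270400],
   [0, -1209600]]), ([[-11145600, 0, -518400], [18576000], [-511200]], [[0, 7128000], [0,
   -1116000]], [[-202003200, 0, 7041600], [-28807200], [4449600]])]"

lemma partials_shape_81: "shape3 5 (P1_81, P2_81, P3_81)"
  by (simp add: shape3_def P1_81_def P2_81_def P3_81_def)

lemma kills_81: "list_all (\<lambda>L. kills_3 L P1_81 \<and> kills_3 L P2_81 \<and> kills_3 L P3_81) L_81"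
  by code_simp

lemma reduces_81: "reduces 1382400 (P1_81, P2_81, P3_81) (map (\<lambda>(h, cs). (h, combine L_81 cs)) C_81) U_81"
  by code_simp

lemmas no_socle_81 = no_socle_elem_certificate[OF _ _ partials_shape_81 kills_81 reduces_81 numeral_neq_zero]

section \<open>Degree seven for \<open>U41\<close>: no socle element\<close>

definition P1_41 :: "int list list" where
  "P1_41 = [[16, 0, -8, 0, 1], [32, 0, -16, 0, 2], [-24, 0, 3], [-32, 0, 4], [5], [6]]"

definition P2_41 :: "int list list" where
  "P2_41 = [[], [0, -16, 0, 4], [0, -16, 0, 4], [0, 2], [0, 2]]"

definition P3_41 :: "int list list" where
  "P3_41 = [[], [80, 0, -24, 0, 1], [64, 0, -16], [-24, 0, 1], [-16], [1]]"

definition L_41 :: "int list list list" where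
  "L_41 = [[[0, 0, 0, 0, 0, 0, 0, 0, 1]], [[0, 0, 0, 0, 2, 0, 25], [0, 0, 0, 0, 0, 0, 3], [0, 0, 0, 0, 0, 0,
   -3], [0, 0, 1, 0, 4], [0, 0, -1, 0, -4], [-1, 0, 1], [1, 0, -1], [-5], [5]], [[0, 0, 0, 0, 0,
   1, 0, 8], [0, 0, 0, 1, 0, 7, 0, 40], [0, 0, 0, -1, 0, -7], [0, 0, 0, 1, 0, 7], [0, 0, 0, -1],
   [0, 0, 0, 1]], [[0, 0, 0, 0, 0, 9, 0, 111], [0, 0, 0, 0, 0, 3, 0, 33], [0, 0, 0, 0, 0, -3], [0,
   1, 0, 4, 0, 19], [0, -1, 0, -4], [0, 1, 0, 4], [0, -1], [0, 1]], [[0, 0, 0, 0, 0, 0, 459], [0,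
   0, 0, 0, 36, 0, 231], [0, 0, 0, 0, -30, 0, -199], [0, 0, 29, 0, 140], [2, 0, -41, 0, -156],
   [-33, 0, 53], [55, 0, -117], [-193], [321]], [[0, 0, 0, 0, 0, 0, 228], [0, 0, 0, 0, 21, 0,
   135], [0, 0, 0, 0, -18, 0, -119], [1, 0, 14, 0, 71], [0, 0, -20, 0, -79], [-11, 0, 26], [22, 0,
   -58], [-73], [137]], [[0, 0, 1, 0, 0, 0, -52], [0, 0, 0, 0, 0, 0, -12], [0, 0, 0, 0, 0, 0, 12],
   [0, 0, -4, 0, -16], [0, 0, 4, 0, 16], [4, 0, -4], [-4, 0, 4], [20], [-20]], [[0, 0, 0, 0, 0,
   -4, 0, -32], [0, 1, 0, 0, 0, -12, 0, -96], [0, 0, 0, 4, 0, 28], [0, 0, 0, -4, 0, -28], [0, 0,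
   0, 4], [0, 0, 0, -4]], [[1, 0, 0, 0, 0, 0, 72], [0, 0, 0, 0, 0, 0, 24], [0, 0, 0, 0, 0, 0,
   -24], [0, 0, 8, 0, 32], [0, 0, -8, 0, -32], [-8, 0, 8], [8, 0, -8], [-40], [40]]]"

definition C_41 :: "(int list list \<times> (int \<times> int \<times> int) list) list" where
  "C_41 = [([[0, 0, 0, 0, 0, 0, 0, 1]], [(0, 7488, 0), (0, 0, 0), (0, 0, 0), (0, 0, 0), (0, 0, 0), (0, 0,
   0), (0, 0, 0), (0, 0, 0), (0, 0, 0)]), ([[0, 0, 0, 0, 0, 0, 1]], [(0, 0, 0), (0, 0, -864), (0,
   0, 0), (0, 0, 0), (48, 0, 96), (0, 0, -96), (348, 0, 0), (0, 0, 0), (0, 0, 0)]), ([[], [], [],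
   [], [0, 1]], [(0, -2424240, 0), (0, 0, 0), (0, 0, 0), (0, 0, 21840), (0, -4368, 0), (0, 7488,
   0), (0, 0, 0), (0, 0, 0), (0, 0, 0)]), ([[0, 0, 0, 0, 1]], [(0, 0, 0), (0, 0, 14544), (0, 0,
   0), (0, 0, 0), (-600, 0, -1200), (0, 0, 1200), (-4350, 0, 0), (0, 0, 0), (0, 0, 0)]), ([[], [0,
   0, 0, 1]], [(0, -138528, 0), (0, 0, 0), (0, 0, 0), (0, 0, 1248), (0, -1248, 0), (0, 2496, 0),
   (0, 0, 0), (0, 0, 0), (0, 0, 0)]), ([[], [], [0, 0, 1]], [(0, 0, 0), (0, 0, 200880), (0, 0, 0),
   (0, 0, 0), (-11160, 0, -18576), (0, 0, 22320), (-82782, 0, 0), (0, 0, 0), (0, 0, 0)]), ([[],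
   [], [], [0, 1]], [(0, -3255408, 0), (0, 0, 0), (0, 0, 0), (0, 0, 29328), (0, -4368, 0), (0,
   7488, 0), (0, 0, 0), (0, 0, 0), (0, 0, 0)]), ([[], [], [], [], [1]], [(0, 0, 0), (0, 0,
   198288), (0, 0, 0), (0, 0, 0), (-11016, 0, -18288), (0, 0, 22032), (-79866, 0, 0), (0, 0, 0),
   (0, 0, 0)]), ([[0, 0, 0, 1]], [(0, 415584, 0), (0, 3744, 0), (0, 0, 0), (0, 0, -3744), (0, 0,
   0), (0, 0, 0), (0, 0, 0), (0, 0, 0), (0, 0, 0)]), ([[], [0, 0, 1]], [(0, 0, 0), (0, 0, 193248),
   (0, 7488, 0), (0, 0, 0), (-10944, 0, -18144), (0, 0, 21888), (-81216, 0, 0), (0, 0, 0), (0, 0,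
   0)]), ([[], [], [0, 1]], [(0, -1078272, 0), (0, 0, 0), (0, 0, 0), (7488, 0, 7488), (0, 0, 0),
   (0, 0, 0), (0, 0, 0), (0, 0, 0), (0, 0, 0)]), ([[], [], [], [1]], [(0, 0, 0), (0, 0, 196992),
   (0, 0, 0), (0, 0, 0), (-10944, 0, -21888), (0, 0, 29376), (-79344, 0, 0), (0, 0, 0), (0, 0,
   0)]), ([[0, 0, 1]], [(0, 0, 0), (0, 0, -44928), (0, 0, 0), (0, 0, 0), (2496, 0, 4992), (0, 0,
   -4992), (18096, 0, 7488), (0, 0, 0), (0, 0, 0)]), ([[], [0, 1]], [(0, 239616, 0), (0, 0, 0),
   (0, 0, 0), (0, 0, 0), (0, 0, 0), (0, 0, 0), (0, 0, 0), (0, 0, 7488), (0, 0, 0)]), ([[], [],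
   [1]], [(0, 0, 0), (0, 0, -819936), (0, 0, 0), (0, 0, 0), (41184, 0, 71136), (7488, 0, -82368),
   (324792, 0, 0), (0, 0, 0), (0, 0, 0)]), ([[0, 1]], [(0, -3324672, 0), (0, 0, 0), (0, 0, 0), (0,
   0, 29952), (0, 0, 0), (0, 0, 0), (0, 7488, 0), (0, 0, 0), (0, 0, 0)]), ([[], [1]], [(0, 0, 0),
   (0, 0, -772992), (0, 0, 0), (0, 0, 0), (43776, 0, 72576), (0, 0, -87552), (324864, 0, 0), (0,
   7488, 0), (0, 0, 0)]), ([[1]], [(0, 0, 0), (0, 0, 62208), (0, 0, 0), (0, 0, 0), (-3456, 0,
   -6912), (0, 0, 6912), (-25056, 0, 0), (0, 0, 0), (0, 0, 7488)])]"

definition U_41 :: "(int list list \<times> int list list \<times> int list list) list" where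
  "U_41 = [([], [], []), ([], [], []), ([], [], []), ([], [], []), ([], [], []), ([[0, 7488], [0, -468]],
   [[-50544, 0, -468], [7488]], [[0, -12636], [0, 2808]]), ([], [], []), ([], [], []), ([], [],
   []), ([], [], []), ([], [], []), ([], [], []), ([[], [-78]], [[0, -78]], [[7878], [468]]),
   ([[], [0, -78]], [[33696, 0, -78]], [[0, 7878], [0, 468]]), ([[-5616, 0, -1248], [-30134],
   [1755]], [[0, 54106], [0, 507]], [[44590, 0, 9984], [3549], [-10530]]), ([], [], []), ([], [],
   []), ([], [], []), ([], [[1872]], []), ([[], [1404], [-78]], [[0, 1404], [0, -78]], [[-7020],
   [-546], [468]]), ([[], [0, 494]], [[-23712, 0, 1742], [], [-1248]], [[0, -7462], [0, -468]]),
   ([], [], []), ([], [], []), ([[-3744], [156]], [[0, 156]], [[6708], [-936]]), ([[], [0, -78]],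
   [[0, 0, -78], [3744]], [[0, 390], [0, 468]]), ([[-9360, 0, -1248], [-8294], [507]], [[0,
   12298], [0, 3003]], [[17758, 0, 2496], [-1443], [-3042]]), ([], [], []), ([], [], []),
   ([[3744], [-2808], [156]], [[0, 936], [0, 156]], [[-8424], [1092], [-936]]), ([[], [0, -754]],
   [[-4992, 0, 494], [-3744], [2496]], [[0, -1222], [0, -468]]), ([[3744], [-78]], [[0, -78]],
   [[-7098], [468]]), ([[], [0, 156]], [[-3744, 0, 156], [-3744]], [[0, -780], [0, -936]]),
   ([[-14976, 0, 2496], [17836], [-1014]], [[0, -27092], [0, -2262]], [[40612, 0, -4992], [-4602],
   [6084]]), ([[-3744], [2652], [-78]], [[0, -1092], [0, -78]], [[9204], [-546], [468]]), ([[],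
   [0, 1508]], [[13728, 0, -988], [3744], [-1248]], [[0, 2444], [0, 936]]), ([[24336, 0, -1248],
   [-10166], [1755]], [[0, 14170], [0, 507]], [[-55250, 0, 2496], [3549], [-3042]])]"

lemma partials_shape_41: "shape3 5 (P1_41, P2_41, P3_41)"
  by (simp add: shape3_def P1_41_def P2_41_def P3_41_def)

lemma kills_41: "list_all (\<lambda>L. kills_3 L P1_41 \<and> kills_3 L P2_41 \<and> kills_3 L P3_41) L_41"
  by code_simp

lemma reduces_41: "reduces 7488 (P1_41, P2_41, P3_41) (map (\<lambda>(h, cs). (h, combine L_41 cs)) C_41) U_41"
  by code_simp

lemmas no_socle_41 = no_socle_elem_certificate[OF _ _ partials_shape_41 kills_41 reduces_41 numeral_neq_zero]

section \<open>Degree seven for \<open>W30_52\<close>: a socle element\<close>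

definition P1_52 :: "int list list" where
  "P1_52 = [[12, 0, -14, 0, 4], [22, -20, -20, 12, 4], [-30, 0, 18], [-24, 8, 12], [10], [6]]"

definition P2_52 :: "int list list" where
  "P2_52 = [[12, 14, -42, -8, 20], [0, -28, 0, 16], [-10, -20, 18, 8], [0, 12], [2, 6]]"

definition P3_52 :: "int list list" where
  "P3_52 = [[-36, 60, 28, -42, -4, 4], [60, 0, -42, 0, 4], [44, -30, -20, 6], [-30, 0, 6], [-12, 2], [2]]"

definition G_52 :: "int list list" where
  "G_52 = [[1980, -1644, -2412, 1356, 696, -216], [-1224, -456, 720, 240], [-2004, 708, 1260, -204], [504,
   216], [480]]"

definition L_52 :: "int list list" where
  "L_52 = [[0, 0, 0, 0, 0, 2, 44, 119], [0, 0, 0, 0, 0, 36, -38], [0, 0, 0, 0, -56, -148], [0, 0, -4, -44,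
   52], [0, 0, 76, 188], [8, 68, -96], [-116, -272], [176]]"

definition CX_52 :: "int list list \<times> int list list \<times> int list list" where
  "CX_52 = ([[18, -36], [6]], [[0, 6], [42]], [[6], [-18]])"

definition CY_52 :: "int list list \<times> int list list \<times> int list list" where
  "CY_52 = ([[0, 36], [-6, 18, -6], [0, -6]], [[-18, 72, 0, -6], [36, 0, -6], [18]], [[-6, -36, 30], [0, 30],
   [0, 18]])"

definition CZ_52 :: "int list list \<times> int list list \<times> int list list" where
  "CZ_52 = ([[0, 21, -6, 6], [4], [0, 1]], [[78, -14, -6], [39, -6, -8], [6], [-3]], [[-29, 30, -6], [0, 28,
   -6], [3, 6]])"

lemma partials_shape_52: "shape3 5 (P1_52, P2_52, P3_52)"
  by (simp add: shape3_def P1_52_def P2_52_def P3_52_def)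

lemma shape_52: "tri_shape G_52 7" "shape3 3 CX_52" "shape3 3 CY_52" "shape3 3 CZ_52"
  by (simp_all add: G_52_def CX_52_def CY_52_def CZ_52_def shape3_def)

lemma multiples_52:
  "tri_zero (tri_add (combine3 CX_52 (P1_52, P2_52, P3_52)) (tri_scale (-1) (tri_mult [[], [1]] G_52)))"
  "tri_zero (tri_add (combine3 CY_52 (P1_52, P2_52, P3_52)) (tri_scale (-1) (tri_mult [[0, 1]] G_52)))"
  "tri_zero (tri_add (combine3 CZ_52 (P1_52, P2_52, P3_52)) (tri_scale (-1) (tri_mult [[1]] G_52)))"
  by code_simp+

lemma separate_52: "kills_2 L_52 P1_52" "kills_2 L_52 P2_52" "kills_2 L_52 P3_52"
    "tri_pair L_52 G_52 \<noteq> 0"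
  by code_simp+

lemmas socle_52 = socle_elem_certificate[OF _ _ partials_shape_52 shape_52 multiples_52 separate_52]

section \<open>Degree seven for \<open>U82\<close>: a socle element\<close>

definition P1_82 :: "int list list" where
  "P1_82 = [[-324, 0, 54, 0, 18], [1998, -540, -468, 72, -12], [270, 0, -36], [-540, 72, 72], [-30], [36]]"

definition P2_82 :: "int list list" where
  "P2_82 = [[972, 1458, -486, 324, -270, -108], [0, 108, 0, 72], [-270, -468, 108, -24], [0, -24], [18, 36]]"

definition P3_82 :: "int list list" where
  "P3_82 = [[-14580, 4860, 2916, -486, 162, -54], [-1620, 0, 162, 0, 18], [3996, -810, -468, 36], [270, 0,
   -12], [-270, 18], [-6]]"

definition G_82 :: "int list list" where
  "G_82 = [[-13632300, 2886840, -2779920, 1924560, 997920], [-855360, -1069200, -926640, 142560, 190080],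
   [4704480, -641520, 142560], [213840, 142560], [-380160]]"

definition L_82 :: "int list list" where
  "L_82 = [[0, 0, 0, 800, 0, 0, -75690, 164385], [0, 0, 0, 0, 0, 25470, -103869], [0, 0, 0, 10800, 57510,
   -23787], [0, 0, 0, -13770, 82269], [0, 0, -210330, -109863], [0, 45630, -302481], [418230,
   669357], [678105]]"

definition CX_82 :: "int list list \<times> int list list \<times> int list list" where
  "CX_82 = ([[517590, -273132, -18954, -3240], [-8874, 12582, -270], [-61560, 5364], [-1350]], [[9720,
   -10854, 1080, -270], [-21708, 1134, 3204], [-162, -1350], [-1080]], [[-10854, 2700, -270, 540],
   [71820, -35460, -5508], [-1350, 1404], [-8100]])"

definition CY_82 :: "int list list \<times> int list list \<times> int list list" where
  "CY_82 = ([[145800, -89064, -6318, -1080], [-3618, 4194, -90], [-20520, 1788], [-450]], [[-5670, -3618,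
   360, -90], [-7236, 378, 1068], [-54, -450], [-360]], [[-3618, 900, -90, 180], [19980, -11820,
   -1836], [-450, 468], [-2700]])"

definition CZ_82 :: "int list list \<times> int list list \<times> int list list" where
  "CZ_82 = ([[-56340, 69741, -43983, 9045], [11862, -23121, 300], [7020, -4057], [180]], [[-10800, -18, -540,
   300], [-16371, -6507, 1973], [-909, 180], [3015]], [[1467, -2340, 795, -600], [-9180, 7280,
   -6156], [1665, -3012], [1080]])"

lemma partials_shape_82: "shape3 5 (P1_82, P2_82, P3_82)"
  by (simp add: shape3_def P1_82_def P2_82_def P3_82_def)

lemma shape_82: "tri_shape G_82 7" "shape3 3 CX_82" "shape3 3 CY_82" "shape3 3 CZ_82"
  by (simp_all add: G_82_def CX_82_def CY_82_def CZ_82_def shape3_def)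

lemma multiples_82:
  "tri_zero (tri_add (combine3 CX_82 (P1_82, P2_82, P3_82)) (tri_scale (-1) (tri_mult [[], [1]] G_82)))"
  "tri_zero (tri_add (combine3 CY_82 (P1_82, P2_82, P3_82)) (tri_scale (-1) (tri_mult [[0, 1]] G_82)))"
  "tri_zero (tri_add (combine3 CZ_82 (P1_82, P2_82, P3_82)) (tri_scale (-1) (tri_mult [[1]] G_82)))"
  by code_simp+

lemma separate_82: "kills_2 L_82 P1_82" "kills_2 L_82 P2_82" "kills_2 L_82 P3_82"
    "tri_pair L_82 G_82 \<noteq> 0"
  by code_simp+

lemmas socle_82 = socle_elem_certificate[OF _ _ partials_shape_82 shape_82 multiples_82 separate_82]

section \<open>Degree seven for \<open>W22_42\<close>: a socle element\<close>

definition P1_42 :: "int list list" where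
  "P1_42 = [[16, 0, -16, 0, 3], [32, 0, -32, 0, 6], [-48, 0, 30], [-64, 0, 40], [15], [18]]"

definition P2_42 :: "int list list" where
  "P2_42 = [[], [0, -32, 0, 12], [0, -32, 0, 12], [0, 20], [0, 20]]"

definition P3_42 :: "int list list" where
  "P3_42 = [[], [80, 0, -48, 0, 3], [64, 0, -32], [-48, 0, 10], [-32], [3]]"

definition G_42 :: "int list list" where
  "G_42 = [[], [0, 0, 0, 0, 0, 0, -24], [0, 0, 0, 0, -224], [0, 0, 0, 0, -176], [0, 0, 224], [0, 0, 200]]"

definition L_42 :: "int list list" where
  "L_42 = [[19], [-45, 0, -26, 0, 0, 0, 96], [32, 0, 16], [-32, 0, -16], [16], [-16]]"

definition CX_42 :: "int list list \<times> int list list \<times> int list list" where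
  "CX_42 = ([[], [0, 0, -15]], [[0, 0, 0, 3], [0, 16], [0, 22]], [[0, 0, 3], [0, 0, 10]])"

definition CY_42 :: "int list list \<times> int list list \<times> int list list" where
  "CY_42 = ([[], [0, 192], [0, -15]], [[96, 0, -80], [96, 0, -53], [192], [-18]], [[0, 0, 0, -8], [0, 3], [0,
   210]])"

definition CZ_42 :: "int list list \<times> int list list \<times> int list list" where
  "CZ_42 = ([[], [0, 0, -3]], [[0, 16, 0, -3], [0, 40]], [[0, 0, 7], [0, 0, 18]])"

lemma partials_shape_42: "shape3 5 (P1_42, P2_42, P3_42)"
  by (simp add: shape3_def P1_42_def P2_42_def P3_42_def)

lemma shape_42: "tri_shape G_42 7" "shape3 3 CX_42" "shape3 3 CY_42" "shape3 3 CZ_42"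
  by (simp_all add: G_42_def CX_42_def CY_42_def CZ_42_def shape3_def)

lemma multiples_42:
  "tri_zero (tri_add (combine3 CX_42 (P1_42, P2_42, P3_42)) (tri_scale (-1) (tri_mult [[], [1]] G_42)))"
  "tri_zero (tri_add (combine3 CY_42 (P1_42, P2_42, P3_42)) (tri_scale (-1) (tri_mult [[0, 1]] G_42)))"
  "tri_zero (tri_add (combine3 CZ_42 (P1_42, P2_42, P3_42)) (tri_scale (-1) (tri_mult [[1]] G_42)))"
  by code_simp+

lemma separate_42: "kills_2 L_42 P1_42" "kills_2 L_42 P2_42" "kills_2 L_42 P3_42"
    "tri_pair L_42 G_42 \<noteq> 0"
  by code_simp+

lemmas socle_42 = socle_elem_certificate[OF _ _ partials_shape_42 shape_42 multiples_42 separate_42]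


section \<open>Points with coordinates in quadratic fields\<close>

text \<open>The complex root admits negative arguments, since some intersection points lie over
  imaginary quadratic fields.\<close>

definition surd :: "int \<Rightarrow> complex" where "surd d = csqrt (of_int d)"

lemma surd_mult: "surd d * surd d = of_int d" "surd d * (surd d * x) = of_int d * x"
  by (simp_all add: surd_def flip: power2_eq_square mult.assoc)

lemma surd_eq_0_iff [simp]: "surd d = 0 \<longleftrightarrow> d = 0"
  by (simp add: surd_def)

text \<open>The norm test, which turns the nonvanishing conditions at the singular points into
  comparisons free of roots.\<close>

lemma surd_nonzero:
  assumes "x = a + b * surd d" "a\<^sup>2 \<noteq> of_int d * b\<^sup>2"
  shows "x \<noteq> 0"
proof
  assume "x = 0"
  then have "a = - (b * surd d)" using assms(1) by (simp add: eq_neg_iff_add_eq_0)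
  then have "a\<^sup>2 = b\<^sup>2 * (surd d * surd d)" by (simp add: power2_eq_square)
  then show False using assms(2) by (simp add: surd_mult mult.commute)
qed

lemma surd_neq:
  assumes "a\<^sup>2 \<noteq> of_int d * b\<^sup>2"
  shows "a + b * surd d \<noteq> 0" "a + surd d * b \<noteq> 0" "b * surd d \<noteq> a"
  using assms surd_nonzero[of "a + b * surd d" a b d] surd_nonzero[of "a - b * surd d" a "- b" d]
  by (auto simp: mult.commute)

lemma surd_neq_rational: "a\<^sup>2 \<noteq> of_int d \<Longrightarrow> surd d \<noteq> a"
  using surd_neq(3)[of a d 1] by simp

lemmas surd_simps = algebra_simps power2_eq_square surd_mult surd_neq surd_neq_rational

lemma surd_3: "complex_of_real (sqrt 3) = surd 3"
  by (simp add: surd_def csqrt_of_real_nonneg[of 3, simplified])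

section \<open>Checkable forms of incidence, distinctness and smoothness\<close>

definition listed :: "(complex ^ 3) list \<Rightarrow> complex \<Rightarrow> complex \<Rightarrow> complex \<Rightarrow> bool" where
  "listed vs x y z \<longleftrightarrow> (\<exists>w\<in>set vs. \<exists>c. vector [x, y, z] = c *s w)"

text \<open>Clearing the third coordinate \<open>n\<close> leaves two polynomial equations, which
  follow from those of the curves by ideal membership. The scalar relating the two vectors is z /
  n.\<close>

lemma listedI:
  assumes "w = vector [a, b, n]" "w \<in> set vs" "n \<noteq> 0" "n * x = a * z" "n * y = b * z"
  shows "listed vs x y z"
proof -
  have "vector [x, y, z] = (z / n) *s w"
    using assms by (simp add: vec_eq_iff forall_3 field_simps)
  then show ?thesis using assms(2) unfolding listed_def by blast
qed

definition meets_in :: "(complex ^ 3) list \<Rightarrow> poly3 \<Rightarrow> poly3 \<Rightarrow> bool" where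
  "meets_in vs P Q \<longleftrightarrow> (\<forall>x y z. eval3 P (vector [x, y, z]) = 0 \<longrightarrow> eval3 Q (vector [x, y, z]) = 0
     \<longrightarrow> listed vs x y z)"

lemma meets_inI:
  "(\<And>x y z. eval3 P (vector [x, y, z]) = 0 \<Longrightarrow> eval3 Q (vector [x, y, z]) = 0 \<Longrightarrow> listed vs x y z)
    \<Longrightarrow> meets_in vs P Q"
  by (simp add: meets_in_def)

text \<open>A nonzero 2 x 2 minor: a form of non-proportionality without quantifiers.\<close>

definition distinct_points :: "complex ^ 3 \<Rightarrow> complex ^ 3 \<Rightarrow> bool" where
  "distinct_points v w \<longleftrightarrow> v $ 1 * w $ 2 - v $ 2 * w $ 1 \<noteq> 0 \<or> v $ 1 * w $ 3 - v $ 3 * w $ 1 \<noteq> 0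
     \<or> v $ 2 * w $ 3 - v $ 3 * w $ 2 \<noteq> 0"

lemma vector_3_exhaust: "vector [v $ 1, v $ 2, v $ 3] = (v :: complex ^ 3)"
  by (simp add: vec_eq_iff forall_3)

lemma homogeneous_numeral_mult: "homogeneous d p \<Longrightarrow> homogeneous d (numeral n * p)"
  using homogeneous_mult[OF homogeneous_numeral, of d p n] by simp

lemma homogeneous_Var_square: "homogeneous 2 (Var i ^ 2)"
  using homogeneous_power[of 1 "Var i" 2] by simp

lemma homogeneous_mult_Var: "homogeneous 1 p \<Longrightarrow> homogeneous 2 (p * Var i)"
  using homogeneous_mult[of 1 p 1 "Var i"] by simp

lemma homogeneous_scalar_mult_Var: "homogeneous 0 p \<Longrightarrow> homogeneous 1 (p * Var i)"
  using homogeneous_mult[of 0 p 1 "Var i"] by simp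

lemmas homogeneous_intros = homogeneous_add homogeneous_diff homogeneous_uminus homogeneous_Var
  homogeneous_Var_square homogeneous_mult_Var homogeneous_scalar_mult_Var homogeneous_numeral_mult
  homogeneous_Const homogeneous_numeral homogeneous_1

lemma smoothI:
  assumes "\<And>x y z. eval3 (pdiff 1 f) (vector [x, y, z]) = 0 \<Longrightarrow> eval3 (pdiff 2 f) (vector [x, y, z]) = 0
    \<Longrightarrow> eval3 (pdiff 3 f) (vector [x, y, z]) = 0 \<Longrightarrow> x = 0 \<and> y = 0 \<and> z = 0"
  shows "smooth f"
  unfolding smooth_def
proof (intro allI impI)
  fix v :: "complex ^ 3" assume "v \<noteq> 0"
  then have "\<not> (v $ 1 = 0 \<and> v $ 2 = 0 \<and> v $ 3 = 0)" by (simp add: vec_eq_iff forall_3)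
  then show "\<exists>i. eval3 (pdiff i f) v \<noteq> 0"
    using assms[of "v $ 1" "v $ 2" "v $ 3"] unfolding vector_3_exhaust by blast
qed


section \<open>Recognizing arrangements and singularities\<close>

context affine_chart
begin

lemma eval3_rescale:
  assumes "homogeneous a U"
  shows "\<exists>e. eval3 U (c *s v) = c ^ e * eval3 U v"
proof (cases "U = 0")
  case False
  then have "a = int (nat a)" using homogeneous_nonneg[OF assms] by simp
  then show ?thesis using eval3_scale[of "nat a" U c v] assms by metis
qed simp

lemma jacobian_rescale:
  assumes "homogeneous a U" "homogeneous b V"
  shows "\<exists>e. jacobian U V (c *s v) = c ^ e * jacobian U V v"
proof (cases "a \<ge> 1 \<and> b \<ge> 1")
  case True
  then have "homogeneous (int (nat (a - 1))) (pdiff l U)" "homogeneous (int (nat (b - 1))) (pdiff l V)" for l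
    using homogeneous_pdiff[OF assms(1)] homogeneous_pdiff[OF assms(2)] by auto
  then have "eval3 (pdiff l U) (c *s v) = c ^ nat (a - 1) * eval3 (pdiff l U) v"
    "eval3 (pdiff l V) (c *s v) = c ^ nat (b - 1) * eval3 (pdiff l V) v" for l
    by (auto intro: eval3_scale)
  then have "jacobian U V (c *s v) = c ^ (nat (a - 1) + nat (b - 1)) * jacobian U V v"
    by (simp add: jacobian_def power_add algebra_simps)
  then show ?thesis by blast
next
  \<comment> \<open>A form of degree at most zero has vanishing partial derivatives, so the Jacobian
    is zero everywhere.\<close>
  case False
  have "pdiff l W = 0" if "homogeneous d W" "\<not> d \<ge> 1" for d l W
    using homogeneous_nonneg[OF homogeneous_pdiff[OF that(1)]] that(2) by force
  then have "(\<forall>l. pdiff l U = 0) \<or> (\<forall>l. pdiff l V = 0)"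
    using False assms by blast
  then have "jacobian U V w = 0" for w by (auto simp: jacobian_def)
  then show ?thesis by simp
qed

text \<open>The normal forms want the k-th coordinate to be 1, while the points are listed without
  denominators. All conditions at a point are homogeneous and survive the rescaling.\<close>

lemma rescaled_point:
  assumes "v $ k \<noteq> 0"
  obtains c where "c \<noteq> 0" "(c *s v) $ k = 1" "abs_cp2 (c *s v) = abs_cp2 v"
    "\<And>U a. homogeneous a U \<Longrightarrow> eval3 U (c *s v) = 0 \<longleftrightarrow> eval3 U v = 0"
    "\<And>U V a b. homogeneous a U \<Longrightarrow> homogeneous b V \<Longrightarrow> jacobian U V (c *s v) = 0 \<longleftrightarrow> jacobian U V v = 0"
proof
  let ?c = "inverse (v $ k)"
  show c: "?c \<noteq> 0" "(?c *s v) $ k = 1" using assms by auto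
  have "v \<noteq> 0" using assms by auto
  moreover from c(2) have "?c *s v \<noteq> 0" by (metis zero_index zero_neq_one)
  ultimately show "abs_cp2 (?c *s v) = abs_cp2 v" using abs_cp2_eq_iff[of v "?c *s v"] by auto
  show "eval3 U (?c *s v) = 0 \<longleftrightarrow> eval3 U v = 0" if "homogeneous a U" for U a
    using eval3_rescale[OF that, of ?c v] c(1) by (metis mult_eq_0_iff power_not_zero)
  show "jacobian U V (?c *s v) = 0 \<longleftrightarrow> jacobian U V v = 0" if "homogeneous a U" "homogeneous b V" for U V a b
    using jacobian_rescale[OF that, of ?c v] c(1) by (metis mult_eq_0_iff power_not_zero)
qed

lemma node_type':
  assumes "homogeneous (int d) f" "v $ k \<noteq> 0" "f = A * B * R"
    and "homogeneous a A" "homogeneous b B" "homogeneous r R"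
    and "eval3 A v = 0" "eval3 B v = 0" "eval3 R v \<noteq> 0" "jacobian A B v \<noteq> 0"
  shows "same_topological_type f (abs_cp2 v) (X * Y) (abs_cp2 origin)"
proof -
  obtain c where "(c *s v) $ k = 1" and c: "abs_cp2 (c *s v) = abs_cp2 v"
    "\<And>U a. homogeneous a U \<Longrightarrow> eval3 U (c *s v) = 0 \<longleftrightarrow> eval3 U v = 0"
    "\<And>U V a b. homogeneous a U \<Longrightarrow> homogeneous b V \<Longrightarrow> jacobian U V (c *s v) = 0 \<longleftrightarrow> jacobian U V v = 0"
    using rescaled_point[OF assms(2)] by metis
  then have "same_topological_type f (abs_cp2 (c *s v)) (X * Y) (abs_cp2 origin)"
    using assms by (intro node_type[where A = A and B = B and R = R]) auto
  then show ?thesis using c(1) by simp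
qed

lemma triple_type':
  assumes "homogeneous (int d) f" "v $ k \<noteq> 0" "f = A * B * C * R" "\<gamma> * C = \<alpha> * A + \<beta> * B"
    and "homogeneous a A" "homogeneous b B" "homogeneous r R"
    and "homogeneous d1 \<alpha>" "homogeneous d2 \<beta>" "homogeneous d3 \<gamma>"
    and "eval3 A v = 0" "eval3 B v = 0" "eval3 R v \<noteq> 0" "jacobian A B v \<noteq> 0"
    and "eval3 \<alpha> v \<noteq> 0" "eval3 \<beta> v \<noteq> 0" "eval3 \<gamma> v \<noteq> 0"
  shows "same_topological_type f (abs_cp2 v) (X * Y * (X + Y)) (abs_cp2 origin)"
proof -
  obtain c where "(c *s v) $ k = 1" and c: "abs_cp2 (c *s v) = abs_cp2 v"
    "\<And>U a. homogeneous a U \<Longrightarrow> eval3 U (c *s v) = 0 \<longleftrightarrow> eval3 U v = 0"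
    "\<And>U V a b. homogeneous a U \<Longrightarrow> homogeneous b V \<Longrightarrow> jacobian U V (c *s v) = 0 \<longleftrightarrow> jacobian U V v = 0"
    using rescaled_point[OF assms(2)] by metis
  then have "same_topological_type f (abs_cp2 (c *s v)) (X * Y * (X + Y)) (abs_cp2 origin)"
    using assms by (intro triple_type[OF _ _ assms(3,4)]) auto
  then show ?thesis using c(1) by simp
qed

lemma tacnode_type':
  assumes "homogeneous (int d) f" "v $ k \<noteq> 0" "f = A * B * R" "\<beta> * B = \<alpha> * A + \<gamma> * L^2"
    and "homogeneous a A" "homogeneous l L" "homogeneous r R"
    and "homogeneous d1 \<alpha>" "homogeneous d2 \<beta>" "homogeneous d3 \<gamma>"
    and "eval3 A v = 0" "eval3 L v = 0" "eval3 R v \<noteq> 0" "jacobian L A v \<noteq> 0"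
    and "eval3 \<alpha> v \<noteq> 0" "eval3 \<beta> v \<noteq> 0" "eval3 \<gamma> v \<noteq> 0"
  shows "same_topological_type f (abs_cp2 v) (Y * (Y * Z - X^2)) (abs_cp2 origin)"
proof -
  obtain c where "(c *s v) $ k = 1" and c: "abs_cp2 (c *s v) = abs_cp2 v"
    "\<And>U a. homogeneous a U \<Longrightarrow> eval3 U (c *s v) = 0 \<longleftrightarrow> eval3 U v = 0"
    "\<And>U V a b. homogeneous a U \<Longrightarrow> homogeneous b V \<Longrightarrow> jacobian U V (c *s v) = 0 \<longleftrightarrow> jacobian U V v = 0"
    using rescaled_point[OF assms(2)] by metis
  then have "same_topological_type f (abs_cp2 (c *s v)) (Y * (Y * Z - X^2)) (abs_cp2 origin)"
    using assms by (intro tacnode_type[OF _ _ assms(3,4)]) auto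
  then show ?thesis using c(1) by simp
qed

end

definition component_tests :: "poly3 list \<Rightarrow> complex ^ 3 \<Rightarrow> nat list \<Rightarrow> bool" where
  "component_tests Ps v A \<longleftrightarrow> v \<noteq> 0 \<and> (\<forall>i\<in>set A. i < length Ps) \<and>
     (\<forall>i<length Ps. i \<in> set A \<longleftrightarrow> eval3 (Ps ! i) v = 0)"

definition smooth_of_degrees :: "poly3 list \<Rightarrow> nat list \<Rightarrow> bool" where
  "smooth_of_degrees Ps ds \<longleftrightarrow>
     list_all2 (\<lambda>P d. homogeneous (int d) P \<and> smooth P \<and> (d = 1 \<or> d = 2)) Ps ds"

text \<open>Vanishing is invariant under scaling, so points with different incidence lists are
  automatically different. Coordinates are compared only for points with equal lists.\<close>

lemma arrangementI:
  assumes "Ps \<noteq> []" and degrees: "smooth_of_degrees Ps ds"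
    and tests: "list_all2 (component_tests Ps) vs inc"
    and two: "\<forall>A\<in>set inc. 2 \<le> length A \<and> sorted A \<and> distinct A"
    and meet: "sorted_wrt (meets_in vs) Ps"
    and distinct: "sorted_wrt (\<lambda>(v, A) (w, B). A = B \<longrightarrow> distinct_points v w) (zip vs inc)"
    and separated: "\<forall>i<length Ps. \<forall>j<length Ps. i \<noteq> j \<longrightarrow> (\<exists>A\<in>set inc. i \<in> set A \<and> j \<notin> set A)"
  shows "arrangement Ps ds vs (map set inc)"
proof
  have len: "length inc = length vs" using tests by (simp add: list_all2_lengthD)
  have inc: "set (inc ! k) = {i. i < length Ps \<and> eval3 (Ps ! i) (vs ! k) = 0}" "vs ! k \<noteq> 0" if "k < length vs" for k
    using list_all2_nthD[OF tests that] unfolding component_tests_def by blast+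
  then show nonzero: "\<forall>v\<in>set vs. v \<noteq> 0" by (metis in_set_conv_nth)
  show "list_all2 (\<lambda>v A. A = {i. i < length Ps \<and> eval3 (Ps ! i) v = 0}) vs (map set inc)"
    using inc len by (simp add: list_all2_conv_all_nth)
  show "\<forall>A\<in>set (map set inc). \<exists>i\<in>A. \<exists>j\<in>A. i \<noteq> j"
  proof
    fix B assume "B \<in> set (map set inc)"
    then obtain A where A: "A \<in> set inc" "B = set A" by auto
    then have "2 \<le> length A" and d: "distinct A" using two by blast+
    then have l: "0 < length A" "1 < length A" by linarith+
    have "A ! 0 \<in> B" "A ! 1 \<in> B" unfolding A(2) by (rule nth_mem[OF l(1)], rule nth_mem[OF l(2)])
    moreover have "A ! 0 \<noteq> A ! 1" using nth_eq_iff_index_eq[OF d l] by simp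
    ultimately have "A ! 0 \<in> B" "A ! 1 \<in> B" "A ! 0 \<noteq> A ! 1" by blast+
    then show "\<exists>i\<in>B. \<exists>j\<in>B. i \<noteq> j" by blast
  qed
  show "\<exists>w\<in>set vs. \<exists>c. v = c *s w"
    if "i < j" "j < length Ps" "v \<noteq> 0" "eval3 (Ps ! i) v = 0" "eval3 (Ps ! j) v = 0" for i j v
  proof -
    have "meets_in vs (Ps ! i) (Ps ! j)" using meet that unfolding sorted_wrt_iff_nth_less by blast
    then have "listed vs (v $ 1) (v $ 2) (v $ 3)"
      using that(4,5) unfolding meets_in_def by (simp add: vector_3_exhaust)
    then show ?thesis by (simp add: listed_def vector_3_exhaust)
  qed
  show "sorted_wrt (\<lambda>v w. \<not> (\<exists>c. w = c *s v)) vs"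
    unfolding sorted_wrt_iff_nth_less
  proof (intro allI impI notI)
    fix k l assume kl: "k < l" "l < length vs" and "\<exists>c. vs ! l = c *s vs ! k"
    then obtain c where c: "vs ! l = c *s vs ! k" by blast
    then have "c \<noteq> 0" using nonzero kl by (metis nth_mem vector_smult_lzero)
    have "eval3 (Ps ! i) (vs ! l) = 0 \<longleftrightarrow> eval3 (Ps ! i) (vs ! k) = 0" if "i < length Ps" for i
    proof -
      have "homogeneous (int (ds ! i)) (Ps ! i)"
        using list_all2_nthD[OF degrees[unfolded smooth_of_degrees_def] that] by simp
      then show ?thesis using c \<open>c \<noteq> 0\<close> eval3_scale[of "ds ! i" "Ps ! i" c "vs ! k"] by simp
    qed
    then have "set (inc ! l) = set (inc ! k)" using inc kl by auto
    \<comment> \<open>Sorted lists without repetition are determined by their sets.\<close>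
    then have "inc ! l = inc ! k"
      using two kl len by (metis nth_mem order.strict_trans sorted_distinct_set_unique)
    then have "distinct_points (vs ! k) (vs ! l)"
      using distinct kl len unfolding sorted_wrt_iff_nth_less by auto
    then show False using c by (auto simp: distinct_points_def)
  qed
  show "list_all2 (\<lambda>P d. homogeneous (int d) P \<and> smooth P \<and> (d = 1 \<or> d = 2)) Ps ds"
    using degrees by (simp add: smooth_of_degrees_def)
  show "\<exists>A\<in>set (map set inc). i \<in> A \<and> j \<notin> A" if "i < length Ps" "j < length Ps" "i \<noteq> j" for i j
    using separated that by auto
qed (use assms in auto)

lemma homogeneous_prod:
  assumes "\<And>a. a \<in> A \<Longrightarrow> homogeneous (int (d a)) (F a)"
  shows "homogeneous (int (sum d A)) (prod F A)"
  using assms by (induction A rule: infinite_finite_induct) (auto intro: homogeneous_mult)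

lemma eval3_prod: "eval3 (prod F A) v = (\<Prod>a\<in>A. eval3 (F a) v)"
  by (induction A rule: infinite_finite_induct) auto

lemma remaining_components:
  assumes degrees: "smooth_of_degrees Ps ds" and tests: "component_tests Ps v A"
  obtains R r where "homogeneous r R" "eval3 R v \<noteq> 0" "prod_list Ps = (\<Prod>i\<in>set A. Ps ! i) * R"
proof
  let ?B = "{..<length Ps} - set A"
  have hom: "homogeneous (int (ds ! i)) (Ps ! i)" if "i \<in> ?B" for i
    using list_all2_nthD[OF degrees[unfolded smooth_of_degrees_def]] that by simp
  then show "homogeneous (int (\<Sum>i\<in>?B. ds ! i)) (\<Prod>i\<in>?B. Ps ! i)" by (rule homogeneous_prod)
  show "eval3 (\<Prod>i\<in>?B. Ps ! i) v \<noteq> 0"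
    using tests by (auto simp: component_tests_def eval3_prod)
  have "set A \<subseteq> {..<length Ps}" using tests by (auto simp: component_tests_def)
  then show "prod_list Ps = (\<Prod>i\<in>set A. Ps ! i) * (\<Prod>i\<in>?B. Ps ! i)"
    by (metis finite_lessThan lessThan_atLeast0 mult.commute prod.list_conv_set_nth prod.subset_diff)
qed

lemma homogeneous_arrangement:
  assumes "smooth_of_degrees Ps ds"
  shows "homogeneous (int (sum_list ds)) (prod_list Ps)"
  using assms unfolding smooth_of_degrees_def
  by (induction rule: list_all2_induct) (auto intro: homogeneous_mult)

context affine_chart
begin

definition node_test :: "poly3 list \<Rightarrow> complex ^ 3 \<Rightarrow> nat list \<Rightarrow> bool" where
  "node_test Ps v A \<longleftrightarrow> length A = 2 \<and> distinct A \<and> v $ k \<noteq> 0 \<and> jacobian (Ps ! (A ! 0)) (Ps ! (A ! 1)) v \<noteq> 0"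

lemma component_facts:
  assumes "smooth_of_degrees Ps ds" "component_tests Ps v A" "n \<in> set A"
  shows "eval3 (Ps ! n) v = 0" "homogeneous (int (ds ! n)) (Ps ! n)"
  using assms list_all2_nthD[OF assms(1)[unfolded smooth_of_degrees_def], of n]
  by (auto simp: component_tests_def)

lemma node_of_arrangement:
  assumes A: "smooth_of_degrees Ps ds" "component_tests Ps v A" and "node_test Ps v A"
  shows "same_topological_type (prod_list Ps) (abs_cp2 v) (X * Y) (abs_cp2 origin)"
proof -
  obtain n m where ij: "A = [n, m]" "n \<noteq> m" "v $ k \<noteq> 0" "jacobian (Ps ! n) (Ps ! m) v \<noteq> 0"
    using assms(3) by (auto simp: node_test_def length_Suc_conv numeral_2_eq_2)
  obtain R r where R: "homogeneous r R" "eval3 R v \<noteq> 0" "prod_list Ps = (\<Prod>i\<in>set A. Ps ! i) * R"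
    by (rule remaining_components[OF A])
  moreover from R(3) have "prod_list Ps = Ps ! n * Ps ! m * R" using ij(1,2) by simp
  ultimately show ?thesis
    using ij component_facts[OF A, of n] component_facts[OF A, of m]
    by (intro node_type'[OF homogeneous_arrangement[OF A(1)]]) auto
qed

lemma triple_of_arrangement:
  assumes A: "smooth_of_degrees Ps ds" "component_tests Ps v [n, m, l]"
    and "v $ k \<noteq> 0" "distinct [n, m, l]"
    and rel: "\<gamma> * Ps ! l = \<alpha> * Ps ! n + \<beta> * Ps ! m"
    and "homogeneous d1 \<alpha>" "homogeneous d2 \<beta>" "homogeneous d3 \<gamma>" "jacobian (Ps ! n) (Ps ! m) v \<noteq> 0"
    and "eval3 \<alpha> v \<noteq> 0" "eval3 \<beta> v \<noteq> 0" "eval3 \<gamma> v \<noteq> 0"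
  shows "same_topological_type (prod_list Ps) (abs_cp2 v) (X * Y * (X + Y)) (abs_cp2 origin)"
proof -
  obtain R r where R: "homogeneous r R" "eval3 R v \<noteq> 0" "prod_list Ps = (\<Prod>i\<in>set [n, m, l]. Ps ! i) * R"
    by (rule remaining_components[OF A])
  moreover from R(3) have "prod_list Ps = Ps ! n * Ps ! m * Ps ! l * R"
    using assms(4) by (simp add: mult.assoc)
  ultimately show ?thesis
    using assms component_facts[OF A, of n] component_facts[OF A, of m]
    by (intro triple_type'[OF homogeneous_arrangement[OF A(1)] _ _ rel]) auto
qed

lemma tacnode_of_arrangement:
  assumes A: "smooth_of_degrees Ps ds" "component_tests Ps v [n, m]"
    and "v $ k \<noteq> 0" "n \<noteq> m" and rel: "\<beta> * Ps ! m = \<alpha> * Ps ! n + \<gamma> * L^2"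
    and "homogeneous d1 \<alpha>" "homogeneous d2 \<beta>" "homogeneous d3 \<gamma>" "homogeneous d4 L"
    and "eval3 L v = 0" "jacobian L (Ps ! n) v \<noteq> 0"
    and "eval3 \<alpha> v \<noteq> 0" "eval3 \<beta> v \<noteq> 0" "eval3 \<gamma> v \<noteq> 0"
  shows "same_topological_type (prod_list Ps) (abs_cp2 v) (Y * (Y * Z - X^2)) (abs_cp2 origin)"
proof -
  obtain R r where R: "homogeneous r R" "eval3 R v \<noteq> 0" "prod_list Ps = (\<Prod>i\<in>set [n, m]. Ps ! i) * R"
    by (rule remaining_components[OF A])
  moreover from R(3) have "prod_list Ps = Ps ! n * Ps ! m * R" using assms(4) by simp
  ultimately show ?thesis
    using assms component_facts[OF A, of n] component_facts[OF A, of m]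
    by (intro tacnode_type'[OF homogeneous_arrangement[OF A(1)] _ _ rel]) auto
qed

end

text \<open>The chart in which the second coordinate does not vanish.\<close>

interpretation ychart: affine_chart 1 3 2
  by unfold_locales auto

text \<open>Nodes are recognized by a Jacobian in one of two charts; for triple points and tacnodes
  the type enters through the first alternative, as each of them rests on its own algebraic
  relation.\<close>

lemma types_of_arrangement:
  assumes "smooth_of_degrees Ps ds" and tests: "list_all2 (component_tests Ps) vs inc"
    and "list_all2 (\<lambda>(v, A) M. same_topological_type (prod_list Ps) (abs_cp2 v) M (abs_cp2 origin)
       \<or> M = X * Y \<and> (std.node_test Ps v A \<or> ychart.node_test Ps v A)) (zip vs inc) Ms"
  shows "list_all2 (\<lambda>v M. same_topological_type (prod_list Ps) (abs_cp2 v) M (abs_cp2 origin)) vs Ms"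
  unfolding list_all2_conv_all_nth
proof (intro conjI allI impI)
  show "length vs = length Ms"
    using list_all2_lengthD[OF tests] list_all2_lengthD[OF assms(3)] by simp
  fix k assume k: "k < length vs"
  then have "k < length (zip vs inc)" using list_all2_lengthD[OF tests] by simp
  from list_all2_nthD[OF assms(3) this] list_all2_nthD[OF tests k] k
  show "same_topological_type (prod_list Ps) (abs_cp2 (vs ! k)) (Ms ! k) (abs_cp2 origin)"
    using list_all2_lengthD[OF tests] std.node_of_arrangement[OF assms(1)] ychart.node_of_arrangement[OF assms(1)]
    by auto
qed


section \<open>The six arrangements\<close>

definition f1_51 :: poly3 where "f1_51 = X^2 + 2 * Y^2 - 3 * Z^2"
definition f2_51 :: poly3 where "f2_51 = X^2 + Y^2 - 2 * Z^2"
definition f3_51 :: poly3 where "f3_51 = X^2 + Y * Z - 2 * Z^2"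
definition v0_51 :: "complex ^ 3" where "v0_51 = vector [1, 1, 1]"
definition v1_51 :: "complex ^ 3" where "v1_51 = vector [- 1, 1, 1]"
definition v2_51 :: "complex ^ 3" where "v2_51 = vector [1, - 1, 1]"
definition v3_51 :: "complex ^ 3" where "v3_51 = vector [- 1, - 1, 1]"
definition v4_51 :: "complex ^ 3" where "v4_51 = vector [surd 10, - 1, 2]"
definition v5_51 :: "complex ^ 3" where "v5_51 = vector [- surd 10, - 1, 2]"
definition v6_51 :: "complex ^ 3" where "v6_51 = vector [surd 2, 0, 1]"
definition v7_51 :: "complex ^ 3" where "v7_51 = vector [- surd 2, 0, 1]"

abbreviation vs_51 :: "(complex ^ 3) list" where
  "vs_51 \<equiv> [v0_51, v1_51, v2_51, v3_51, v4_51, v5_51, v6_51, v7_51]"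
abbreviation fs_51 :: "poly3 list" where "fs_51 \<equiv> [f1_51, f2_51, f3_51]"
abbreviation inc_51 :: "nat list list" where
  "inc_51 \<equiv> [[0, 1, 2], [0, 1, 2], [0, 1], [0, 1], [0, 2], [0, 2], [1, 2], [1, 2]]"

lemmas f_51 = f1_51_def f2_51_def f3_51_def
lemmas v_51 = v0_51_def v1_51_def v2_51_def v3_51_def v4_51_def v5_51_def v6_51_def v7_51_def

lemma degrees_51: "smooth_of_degrees fs_51 [2, 2, 2]"
proof -
  have "smooth f1_51" "smooth f2_51" "smooth f3_51"
    by (rule smoothI, simp add: f_51)+
  moreover have "homogeneous 2 f1_51" "homogeneous 2 f2_51" "homogeneous 2 f3_51"
    unfolding f_51 by (intro homogeneous_intros)+
  ultimately show ?thesis by (simp add: smooth_of_degrees_def)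
qed

lemma tests_51: "list_all2 (component_tests fs_51) vs_51 inc_51"
  by (simp add: component_tests_def All_less_Suc f_51 v_51 vec_eq_iff forall_3 surd_simps)

lemma meets_51_12: "meets_in vs_51 f1_51 f2_51"
proof (rule meets_inI)
  fix x y z assume "eval3 f1_51 (vector [x, y, z]) = 0" "eval3 f2_51 (vector [x, y, z]) = 0"
  note e = this[unfolded f_51, simplified]
  show "listed vs_51 x y z"
  proof -
    \<comment> \<open>The difference of the two equations is y^2 - z^2.\<close>
    have "y - z = 0 \<or> y + z = 0" using e by algebra
    then show ?thesis
    proof
      assume 1: "y - z = 0"
      have "x - z = 0 \<or> x + z = 0" using e 1 by algebra
      then show ?thesis
      proof
        assume 2: "x - z = 0"
        show ?thesis by (rule listedI[OF v0_51_def]) (simp, simp, (use e 1 2 in algebra)+)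
      next
        assume 2: "x + z = 0"
        show ?thesis by (rule listedI[OF v1_51_def]) (simp, simp, (use e 1 2 in algebra)+)
      qed
    next
      assume 1: "y + z = 0"
      have "x - z = 0 \<or> x + z = 0" using e 1 by algebra
      then show ?thesis
      proof
        assume 2: "x - z = 0"
        show ?thesis by (rule listedI[OF v2_51_def]) (simp, simp, (use e 1 2 in algebra)+)
      next
        assume 2: "x + z = 0"
        show ?thesis by (rule listedI[OF v3_51_def]) (simp, simp, (use e 1 2 in algebra)+)
      qed
    qed
  qed
qed

lemma meets_51_13: "meets_in vs_51 f1_51 f3_51"
proof (rule meets_inI)
  fix x y z assume "eval3 f1_51 (vector [x, y, z]) = 0" "eval3 f3_51 (vector [x, y, z]) = 0"
  note e = this[unfolded f_51, simplified]
  have s: "surd 10 * surd 10 = 10" by (simp add: surd_mult)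
  show "listed vs_51 x y z"
  proof -
    \<comment> \<open>From f1 - f3 = (2y + z)(y - z).\<close>
    have "2 * y + z = 0 \<or> y - z = 0" using e s by algebra
    then show ?thesis
    proof
      assume 1: "2 * y + z = 0"
      have "2 * x - surd 10 * z = 0 \<or> 2 * x + surd 10 * z = 0" using e 1 s by algebra
      then show ?thesis
      proof
        assume 2: "2 * x - surd 10 * z = 0"
        show ?thesis by (rule listedI[OF v4_51_def]) (simp, simp, (use e 1 2 s in algebra)+)
      next
        assume 2: "2 * x + surd 10 * z = 0"
        show ?thesis by (rule listedI[OF v5_51_def]) (simp, simp, (use e 1 2 s in algebra)+)
      qed
    next
      assume 1: "y - z = 0"
      have "x - z = 0 \<or> x + z = 0" using e 1 s by algebra
      then show ?thesis
      proof
        assume 2: "x - z = 0"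
        show ?thesis by (rule listedI[OF v0_51_def]) (simp, simp, (use e 1 2 s in algebra)+)
      next
        assume 2: "x + z = 0"
        show ?thesis by (rule listedI[OF v1_51_def]) (simp, simp, (use e 1 2 s in algebra)+)
      qed
    qed
  qed
qed

lemma meets_51_23: "meets_in vs_51 f2_51 f3_51"
proof (rule meets_inI)
  fix x y z assume "eval3 f2_51 (vector [x, y, z]) = 0" "eval3 f3_51 (vector [x, y, z]) = 0"
  note e = this[unfolded f_51, simplified]
  have s: "surd 2 * surd 2 = 2" by (simp add: surd_mult)
  show "listed vs_51 x y z"
  proof -
    \<comment> \<open>From f2 - f3 = y (y - z).\<close>
    have "y = 0 \<or> y - z = 0" using e s by algebra
    then show ?thesis
    proof
      assume 1: "y = 0"
      have "x - surd 2 * z = 0 \<or> x + surd 2 * z = 0" using e 1 s by algebra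
      then show ?thesis
      proof
        assume 2: "x - surd 2 * z = 0"
        show ?thesis by (rule listedI[OF v6_51_def]) (simp, simp, (use e 1 2 s in algebra)+)
      next
        assume 2: "x + surd 2 * z = 0"
        show ?thesis by (rule listedI[OF v7_51_def]) (simp, simp, (use e 1 2 s in algebra)+)
      qed
    next
      assume 1: "y - z = 0"
      have "x - z = 0 \<or> x + z = 0" using e 1 s by algebra
      then show ?thesis
      proof
        assume 2: "x - z = 0"
        show ?thesis by (rule listedI[OF v0_51_def]) (simp, simp, (use e 1 2 s in algebra)+)
      next
        assume 2: "x + z = 0"
        show ?thesis by (rule listedI[OF v1_51_def]) (simp, simp, (use e 1 2 s in algebra)+)
      qed
    qed
  qed
qed

lemma arrangement_51: "arrangement fs_51 [2, 2, 2] vs_51 (map set inc_51)"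
  by (rule arrangementI[OF _ degrees_51 tests_51])
    (simp_all add: meets_51_12 meets_51_13 meets_51_23 All_less_Suc,
     simp add: distinct_points_def v_51 surd_simps)

lemma triple_51: 
  "same_topological_type (prod_list fs_51) (abs_cp2 v0_51) (X * Y * (X + Y)) (abs_cp2 origin)" 
  "same_topological_type (prod_list fs_51) (abs_cp2 v1_51) (X * Y * (X + Y)) (abs_cp2 origin)"
proof -
  \<comment> \<open>On the line y = z through both triple points the three conics agree: f1 - f3 =
    (y - z)(2y + z) and f2 - f3 = (y - z) y. Eliminating y - z gives the relation.\<close>
  have rel: "(Y + Z) * fs_51 ! 2 = (- Y) * fs_51 ! 0 + (2 * Y + Z) * fs_51 ! 1"
    by (simp add: f_51) algebra
  have hom: "homogeneous 1 (- Y)" "homogeneous 1 (2 * Y + Z)" "homogeneous 1 (Y + Z)"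
    by (intro homogeneous_intros)+
  note triple = std.triple_of_arrangement[OF degrees_51 _ _ _ rel hom]
  show "same_topological_type (prod_list fs_51) (abs_cp2 v0_51) (X * Y * (X + Y)) (abs_cp2 origin)"
    using tests_51 by (intro triple) (simp_all add: std.jacobian_def f_51 v0_51_def surd_simps)
  show "same_topological_type (prod_list fs_51) (abs_cp2 v1_51) (X * Y * (X + Y)) (abs_cp2 origin)"
    using tests_51 by (intro triple) (simp_all add: std.jacobian_def f_51 v1_51_def surd_simps)
qed

lemma types_51:
  "list_all2 (\<lambda>v M. same_topological_type (prod_list fs_51) (abs_cp2 v) M (abs_cp2 origin)) vs_51
    [X * Y * (X + Y), X * Y * (X + Y), X * Y, X * Y, X * Y, X * Y, X * Y, X * Y]"
  using triple_51
  by (intro types_of_arrangement[OF degrees_51 tests_51])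
    (simp add: std.node_test_def std.jacobian_def f_51 v_51 surd_simps)

lemma product_51: "prod_list fs_51 = W30_51"
  by (simp add: W30_51_def f_51 mult_ac)

lemma homogeneous_51: "homogeneous 6 W30_51"
  using homogeneous_arrangement[OF degrees_51, unfolded product_51] by simp


section \<open>The arrangement \<open>W30_52\<close>\<close>

definition f1_52 :: poly3 where "f1_52 = X^2 + 2 * Y^2 - 3 * Z^2"
definition f2_52 :: poly3 where "f2_52 = X^2 + Y^2 - 2 * Z^2"
definition f3_52 :: poly3 where "f3_52 = X^2 + 2 * X * Z + 2 * Y * Z - Z^2"
text \<open>The points are numbered as those of \<open>W30_51\<close>, triple points first, so that
  \<open>inc_51\<close> describes both curves.\<close>

definition v0_52 :: "complex ^ 3" where "v0_52 = vector [1, - 1, 1]"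
definition v1_52 :: "complex ^ 3" where "v1_52 = vector [- 1, 1, 1]"
definition v2_52 :: "complex ^ 3" where "v2_52 = vector [1, 1, 1]"
definition v3_52 :: "complex ^ 3" where "v3_52 = vector [- 1, - 1, 1]"
definition v4_52 :: "complex ^ 3" where "v4_52 = vector [- 2 + surd (- 1), 1 + surd (- 1), 1]"
definition v5_52 :: "complex ^ 3" where "v5_52 = vector [- 2 - surd (- 1), 1 - surd (- 1), 1]"
definition v6_52 :: "complex ^ 3" where "v6_52 = vector [- 2 + surd (- 3), 2 + surd (- 3), 1]"
definition v7_52 :: "complex ^ 3" where "v7_52 = vector [- 2 - surd (- 3), 2 - surd (- 3), 1]"

abbreviation vs_52 :: "(complex ^ 3) list" where
  "vs_52 \<equiv> [v0_52, v1_52, v2_52, v3_52, v4_52, v5_52, v6_52, v7_52]"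
abbreviation fs_52 :: "poly3 list" where "fs_52 \<equiv> [f1_52, f2_52, f3_52]"

lemmas f_52 = f1_52_def f2_52_def f3_52_def
lemmas v_52 = v0_52_def v1_52_def v2_52_def v3_52_def v4_52_def v5_52_def v6_52_def v7_52_def

lemma degrees_52: "smooth_of_degrees fs_52 [2, 2, 2]"
proof -
  have "smooth f1_52" "smooth f2_52" "smooth f3_52"
    by (rule smoothI, simp add: f_52)+
  moreover have "homogeneous 2 f1_52" "homogeneous 2 f2_52" "homogeneous 2 f3_52"
    unfolding f_52 by (intro homogeneous_intros)+
  ultimately show ?thesis by (simp add: smooth_of_degrees_def)
qed

lemma tests_52: "list_all2 (component_tests fs_52) vs_52 inc_51"
  by (simp add: component_tests_def All_less_Suc f_52 v_52 vec_eq_iff forall_3 surd_simps)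

lemma meets_52_12: "meets_in vs_52 f1_52 f2_52"
proof (rule meets_inI)
  fix x y z assume "eval3 f1_52 (vector [x, y, z]) = 0" "eval3 f2_52 (vector [x, y, z]) = 0"
  note e = this[unfolded f_52, simplified]
  show "listed vs_52 x y z"
  proof -
    have "y - z = 0 \<or> y + z = 0" using e by algebra
    then show ?thesis
    proof
      assume 1: "y - z = 0"
      have "x - z = 0 \<or> x + z = 0" using e 1 by algebra
      then show ?thesis
      proof
        assume 2: "x - z = 0"
        show ?thesis by (rule listedI[OF v2_52_def]) (simp, simp, (use e 1 2 in algebra)+)
      next
        assume 2: "x + z = 0"
        show ?thesis by (rule listedI[OF v1_52_def]) (simp, simp, (use e 1 2 in algebra)+)
      qed
    next
      assume 1: "y + z = 0"
      have "x - z = 0 \<or> x + z = 0" using e 1 by algebra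
      then show ?thesis
      proof
        assume 2: "x - z = 0"
        show ?thesis by (rule listedI[OF v0_52_def]) (simp, simp, (use e 1 2 in algebra)+)
      next
        assume 2: "x + z = 0"
        show ?thesis by (rule listedI[OF v3_52_def]) (simp, simp, (use e 1 2 in algebra)+)
      qed
    qed
  qed
qed

lemma meets_52_13: "meets_in vs_52 f1_52 f3_52"
proof (rule meets_inI)
  fix x y z assume "eval3 f1_52 (vector [x, y, z]) = 0" "eval3 f3_52 (vector [x, y, z]) = 0"
  note e = this[unfolded f_52, simplified]
  have s: "surd (- 1) * surd (- 1) = - 1" by (simp add: surd_mult)
  show "listed vs_52 x y z"
  proof -
    \<comment> \<open>From f1 - 3 f3 = 2 (x + y)(y - x - 3z).\<close>
    have "x + y = 0 \<or> y - x - 3 * z = 0" using e s by algebra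
    then show ?thesis
    proof
      assume 1: "x + y = 0"
      have "x - z = 0 \<or> x + z = 0" using e 1 s by algebra
      then show ?thesis
      proof
        assume 2: "x - z = 0"
        show ?thesis by (rule listedI[OF v0_52_def]) (simp, simp, (use e 1 2 s in algebra)+)
      next
        assume 2: "x + z = 0"
        show ?thesis by (rule listedI[OF v1_52_def]) (simp, simp, (use e 1 2 s in algebra)+)
      qed
    next
      assume 1: "y - x - 3 * z = 0"
      have "x + 2 * z - surd (- 1) * z = 0 \<or> x + 2 * z + surd (- 1) * z = 0" using e 1 s by algebra
      then show ?thesis
      proof
        assume 2: "x + 2 * z - surd (- 1) * z = 0"
        show ?thesis by (rule listedI[OF v4_52_def]) (simp, simp, (use e 1 2 s in algebra)+)
      next
        assume 2: "x + 2 * z + surd (- 1) * z = 0"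
        show ?thesis by (rule listedI[OF v5_52_def]) (simp, simp, (use e 1 2 s in algebra)+)
      qed
    qed
  qed
qed

lemma meets_52_23: "meets_in vs_52 f2_52 f3_52"
proof (rule meets_inI)
  fix x y z assume "eval3 f2_52 (vector [x, y, z]) = 0" "eval3 f3_52 (vector [x, y, z]) = 0"
  note e = this[unfolded f_52, simplified]
  have s: "surd (- 3) * surd (- 3) = - 3" by (simp add: surd_mult)
  show "listed vs_52 x y z"
  proof -
    \<comment> \<open>From f2 - 2 f3 = (x + y)(y - x - 4z).\<close>
    have "x + y = 0 \<or> y - x - 4 * z = 0" using e s by algebra
    then show ?thesis
    proof
      assume 1: "x + y = 0"
      have "x - z = 0 \<or> x + z = 0" using e 1 s by algebra
      then show ?thesis
      proof
        assume 2: "x - z = 0"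
        show ?thesis by (rule listedI[OF v0_52_def]) (simp, simp, (use e 1 2 s in algebra)+)
      next
        assume 2: "x + z = 0"
        show ?thesis by (rule listedI[OF v1_52_def]) (simp, simp, (use e 1 2 s in algebra)+)
      qed
    next
      assume 1: "y - x - 4 * z = 0"
      have "x + 2 * z - surd (- 3) * z = 0 \<or> x + 2 * z + surd (- 3) * z = 0" using e 1 s by algebra
      then show ?thesis
      proof
        assume 2: "x + 2 * z - surd (- 3) * z = 0"
        show ?thesis by (rule listedI[OF v6_52_def]) (simp, simp, (use e 1 2 s in algebra)+)
      next
        assume 2: "x + 2 * z + surd (- 3) * z = 0"
        show ?thesis by (rule listedI[OF v7_52_def]) (simp, simp, (use e 1 2 s in algebra)+)
      qed
    qed
  qed
qed

lemma arrangement_52: "arrangement fs_52 [2, 2, 2] vs_52 (map set inc_51)"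
  by (rule arrangementI[OF _ degrees_52 tests_52])
    (simp_all add: meets_52_12 meets_52_13 meets_52_23 All_less_Suc,
     simp add: distinct_points_def v_52 surd_simps)

lemma triple_52: 
  "same_topological_type (prod_list fs_52) (abs_cp2 v0_52) (X * Y * (X + Y)) (abs_cp2 origin)" 
  "same_topological_type (prod_list fs_52) (abs_cp2 v1_52) (X * Y * (X + Y)) (abs_cp2 origin)"
proof -
  \<comment> \<open>Elimination of x + y, the line through both triple points, from the
    factorizations of f1 - 3 f3 and f2 - 2 f3.\<close>
  have rel: "(X - Y) * fs_52 ! 2 = (Y - X - 4 * Z) * fs_52 ! 0 + (2 * X - 2 * Y + 6 * Z) * fs_52 ! 1"
    by (simp add: f_52) algebra
  have hom: "homogeneous 1 (Y - X - 4 * Z)" "homogeneous 1 (2 * X - 2 * Y + 6 * Z)" "homogeneous 1 (X - Y)"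
    by (intro homogeneous_intros)+
  note triple = std.triple_of_arrangement[OF degrees_52 _ _ _ rel hom]
  show "same_topological_type (prod_list fs_52) (abs_cp2 v0_52) (X * Y * (X + Y)) (abs_cp2 origin)"
    using tests_52 by (intro triple) (simp_all add: std.jacobian_def f_52 v0_52_def surd_simps)
  show "same_topological_type (prod_list fs_52) (abs_cp2 v1_52) (X * Y * (X + Y)) (abs_cp2 origin)"
    using tests_52 by (intro triple) (simp_all add: std.jacobian_def f_52 v1_52_def surd_simps)
qed

lemma types_52:
  "list_all2 (\<lambda>v M. same_topological_type (prod_list fs_52) (abs_cp2 v) M (abs_cp2 origin)) vs_52
    [X * Y * (X + Y), X * Y * (X + Y), X * Y, X * Y, X * Y, X * Y, X * Y, X * Y]"
  using triple_52
  by (intro types_of_arrangement[OF degrees_52 tests_52])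
    (simp add: std.node_test_def std.jacobian_def f_52 v_52 surd_simps)

lemma product_52: "prod_list fs_52 = W30_52"
  by (simp add: W30_52_def f_52 mult_ac)

lemma homogeneous_52: "homogeneous 6 W30_52"
  using homogeneous_arrangement[OF degrees_52, unfolded product_52] by simp


section \<open>The arrangement \<open>W30_81\<close>\<close>

definition f1_81 :: poly3 where "f1_81 = X^2 - Y^2 - Z^2"
definition f2_81 :: poly3 where "f2_81 = X^2 + Y^2 + X * Z - 2 * Z^2"
definition f3_81 :: poly3 where "f3_81 = X^2 + 3 * Y^2 - 6 * Z^2"
definition v0_81 :: "complex ^ 3" where "v0_81 = vector [- 3, surd 5, 2]"
definition v1_81 :: "complex ^ 3" where "v1_81 = vector [- 3, - surd 5, 2]"
definition v2_81 :: "complex ^ 3" where "v2_81 = vector [1, 0, 1]"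
definition v3_81 :: "complex ^ 3" where "v3_81 = vector [3, surd 5, 2]"
definition v4_81 :: "complex ^ 3" where "v4_81 = vector [3, - surd 5, 2]"
definition v5_81 :: "complex ^ 3" where "v5_81 = vector [0, surd 2, 1]"
definition v6_81 :: "complex ^ 3" where "v6_81 = vector [0, - surd 2, 1]"

abbreviation vs_81 :: "(complex ^ 3) list" where
  "vs_81 \<equiv> [v0_81, v1_81, v2_81, v3_81, v4_81, v5_81, v6_81]"
abbreviation fs_81 :: "poly3 list" where "fs_81 \<equiv> [f1_81, f2_81, f3_81]"
abbreviation inc_81 :: "nat list list" where
  "inc_81 \<equiv> [[0, 1, 2], [0, 1, 2], [0, 1], [0, 2], [0, 2], [1, 2], [1, 2]]"

lemmas f_81 = f1_81_def f2_81_def f3_81_def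
lemmas v_81 = v0_81_def v1_81_def v2_81_def v3_81_def v4_81_def v5_81_def v6_81_def

lemma smooth_f2_81: "smooth f2_81"
proof (rule smoothI)
  fix x y z
  assume "eval3 (pdiff 1 f2_81) (vector [x, y, z]) = 0" "eval3 (pdiff 2 f2_81) (vector [x, y, z]) = 0"
    "eval3 (pdiff 3 f2_81) (vector [x, y, z]) = 0"
  note e = this[unfolded f_81, simplified]
  have "18 * x = 0" "18 * y = 0" "18 * z = 0" using e by algebra+
  then show "x = 0 \<and> y = 0 \<and> z = 0" by simp
qed

lemma degrees_81: "smooth_of_degrees fs_81 [2, 2, 2]"
proof -
  have "smooth f1_81" "smooth f3_81"
    by (rule smoothI, simp add: f_81)+
  moreover have "homogeneous 2 f1_81" "homogeneous 2 f2_81" "homogeneous 2 f3_81"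
    unfolding f_81 by (intro homogeneous_intros)+
  ultimately show ?thesis by (simp add: smooth_of_degrees_def smooth_f2_81)
qed

lemma tests_81: "list_all2 (component_tests fs_81) vs_81 inc_81"
  by (simp add: component_tests_def All_less_Suc f_81 v_81 vec_eq_iff forall_3 surd_simps)

lemma meets_81_12: "meets_in vs_81 f1_81 f2_81"
proof (rule meets_inI)
  fix x y z assume "eval3 f1_81 (vector [x, y, z]) = 0" "eval3 f2_81 (vector [x, y, z]) = 0"
  note e = this[unfolded f_81, simplified]
  have s: "surd 5 * surd 5 = 5" by (simp add: surd_mult)
  show "listed vs_81 x y z"
  proof -
    \<comment> \<open>From f1 + f2 = (2x + 3z)(x - z); the second factor is the common tangent at
      [1:0:1].\<close>
    have "2 * x + 3 * z = 0 \<or> x - z = 0" using e s by algebra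
    then show ?thesis
    proof
      assume 1: "2 * x + 3 * z = 0"
      have "2 * y - surd 5 * z = 0 \<or> 2 * y + surd 5 * z = 0" using e 1 s by algebra
      then show ?thesis
      proof
        assume 2: "2 * y - surd 5 * z = 0"
        show ?thesis by (rule listedI[OF v0_81_def]) (simp, simp, (use e 1 2 s in algebra)+)
      next
        assume 2: "2 * y + surd 5 * z = 0"
        show ?thesis by (rule listedI[OF v1_81_def]) (simp, simp, (use e 1 2 s in algebra)+)
      qed
    next
      assume 1: "x - z = 0"
      \<comment> \<open>A double root: the two conics are tangent at this point.\<close>
      have "(y) * (y) = 0" using e 1 s by algebra
      then have 2: "y = 0" by simp
      show ?thesis by (rule listedI[OF v2_81_def]) (simp, simp, (use e 1 2 s in algebra)+)
    qed
  qed
qed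

lemma meets_81_13: "meets_in vs_81 f1_81 f3_81"
proof (rule meets_inI)
  fix x y z assume "eval3 f1_81 (vector [x, y, z]) = 0" "eval3 f3_81 (vector [x, y, z]) = 0"
  note e = this[unfolded f_81, simplified]
  have s: "surd 5 * surd 5 = 5" by (simp add: surd_mult)
  show "listed vs_81 x y z"
  proof -
    \<comment> \<open>From 3 f1 + f3 = 4 x^2 - 9 z^2.\<close>
    have "2 * x + 3 * z = 0 \<or> 2 * x - 3 * z = 0" using e s by algebra
    then show ?thesis
    proof
      assume 1: "2 * x + 3 * z = 0"
      have "2 * y - surd 5 * z = 0 \<or> 2 * y + surd 5 * z = 0" using e 1 s by algebra
      then show ?thesis
      proof
        assume 2: "2 * y - surd 5 * z = 0"
        show ?thesis by (rule listedI[OF v0_81_def]) (simp, simp, (use e 1 2 s in algebra)+)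
      next
        assume 2: "2 * y + surd 5 * z = 0"
        show ?thesis by (rule listedI[OF v1_81_def]) (simp, simp, (use e 1 2 s in algebra)+)
      qed
    next
      assume 1: "2 * x - 3 * z = 0"
      have "2 * y - surd 5 * z = 0 \<or> 2 * y + surd 5 * z = 0" using e 1 s by algebra
      then show ?thesis
      proof
        assume 2: "2 * y - surd 5 * z = 0"
        show ?thesis by (rule listedI[OF v3_81_def]) (simp, simp, (use e 1 2 s in algebra)+)
      next
        assume 2: "2 * y + surd 5 * z = 0"
        show ?thesis by (rule listedI[OF v4_81_def]) (simp, simp, (use e 1 2 s in algebra)+)
      qed
    qed
  qed
qed

lemma meets_81_23: "meets_in vs_81 f2_81 f3_81"
proof (rule meets_inI)
  fix x y z assume "eval3 f2_81 (vector [x, y, z]) = 0" "eval3 f3_81 (vector [x, y, z]) = 0"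
  note e = this[unfolded f_81, simplified]
  have s: "surd 5 * surd 5 = 5" "surd 2 * surd 2 = 2" by (simp_all add: surd_mult)
  show "listed vs_81 x y z"
  proof -
    \<comment> \<open>From f3 - 3 f2 = - x (2x + 3z).\<close>
    have "2 * x + 3 * z = 0 \<or> x = 0" using e s by algebra
    then show ?thesis
    proof
      assume 1: "2 * x + 3 * z = 0"
      have "2 * y - surd 5 * z = 0 \<or> 2 * y + surd 5 * z = 0" using e 1 s by algebra
      then show ?thesis
      proof
        assume 2: "2 * y - surd 5 * z = 0"
        show ?thesis by (rule listedI[OF v0_81_def]) (simp, simp, (use e 1 2 s in algebra)+)
      next
        assume 2: "2 * y + surd 5 * z = 0"
        show ?thesis by (rule listedI[OF v1_81_def]) (simp, simp, (use e 1 2 s in algebra)+)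
      qed
    next
      assume 1: "x = 0"
      have "y - surd 2 * z = 0 \<or> y + surd 2 * z = 0" using e 1 s by algebra
      then show ?thesis
      proof
        assume 2: "y - surd 2 * z = 0"
        show ?thesis by (rule listedI[OF v5_81_def]) (simp, simp, (use e 1 2 s in algebra)+)
      next
        assume 2: "y + surd 2 * z = 0"
        show ?thesis by (rule listedI[OF v6_81_def]) (simp, simp, (use e 1 2 s in algebra)+)
      qed
    qed
  qed
qed

lemma arrangement_81: "arrangement fs_81 [2, 2, 2] vs_81 (map set inc_81)"
  by (rule arrangementI[OF _ degrees_81 tests_81])
    (simp_all add: meets_81_12 meets_81_13 meets_81_23 All_less_Suc,
     simp add: distinct_points_def v_81 surd_simps)

lemma triple_81: 
  "same_topological_type (prod_list fs_81) (abs_cp2 v0_81) (X * Y * (X + Y)) (abs_cp2 origin)" 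
  "same_topological_type (prod_list fs_81) (abs_cp2 v1_81) (X * Y * (X + Y)) (abs_cp2 origin)"
proof -
  \<comment> \<open>Elimination of 2x + 3z, the line through both triple points, from f1 + f2 = (2x
    + 3z)(x - z) and f3 - 3 f2 = - x (2x + 3z).\<close>
  have rel: "(X - Z) * fs_81 ! 2 = (- X) * fs_81 ! 0 + (2 * X - 3 * Z) * fs_81 ! 1"
    by (simp add: f_81) algebra
  have hom: "homogeneous 1 (- X)" "homogeneous 1 (2 * X - 3 * Z)" "homogeneous 1 (X - Z)"
    by (intro homogeneous_intros)+
  note triple = std.triple_of_arrangement[OF degrees_81 _ _ _ rel hom]
  show "same_topological_type (prod_list fs_81) (abs_cp2 v0_81) (X * Y * (X + Y)) (abs_cp2 origin)"
    using tests_81 by (intro triple) (simp_all add: std.jacobian_def f_81 v0_81_def surd_simps)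
  show "same_topological_type (prod_list fs_81) (abs_cp2 v1_81) (X * Y * (X + Y)) (abs_cp2 origin)"
    using tests_81 by (intro triple) (simp_all add: std.jacobian_def f_81 v1_81_def surd_simps)
qed

lemma tacnode_81:
  "same_topological_type (prod_list fs_81) (abs_cp2 v2_81) (Y * (Y * Z - X^2)) (abs_cp2 origin)"
proof -
  \<comment> \<open>Modulo the common tangent x - z both conics are multiples of y^2: f1 = (x - z)(x
    + z) - y^2 and f2 = (x - z)(x + 2z) + y^2. Eliminating x - z gives the relation.\<close>
  have rel: "(X + Z) * fs_81 ! 1 = (X + 2 * Z) * fs_81 ! 0 + (2 * X + 3 * Z) * Y\<^sup>2"
    by (simp add: f_81) algebra
  have hom: "homogeneous 1 (X + 2 * Z)" "homogeneous 1 (X + Z)" "homogeneous 1 (2 * X + 3 * Z)" "homogeneous 1 Y"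
    by (intro homogeneous_intros)+
  show ?thesis
    using tests_81 by (intro std.tacnode_of_arrangement[OF degrees_81 _ _ _ rel hom])
      (simp_all add: std.jacobian_def f_81 v2_81_def surd_simps)
qed

lemma types_81:
  "list_all2 (\<lambda>v M. same_topological_type (prod_list fs_81) (abs_cp2 v) M (abs_cp2 origin)) vs_81
    [X * Y * (X + Y), X * Y * (X + Y), Y * (Y * Z - X^2), X * Y, X * Y, X * Y, X * Y]"
  using triple_81 tacnode_81
  by (intro types_of_arrangement[OF degrees_81 tests_81])
    (simp add: std.node_test_def std.jacobian_def f_81 v_81 surd_simps)

lemma product_81: "prod_list fs_81 = W30_81"
  by (simp add: W30_81_def f_81 mult_ac)

lemma homogeneous_81: "homogeneous 6 W30_81"
  using homogeneous_arrangement[OF degrees_81, unfolded product_81] by simp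


section \<open>The arrangement \<open>W30_82\<close>\<close>

lemma Const_surd_3: "Const (surd 3) * Const (surd 3) = 3" "Const (surd 3) * (Const (surd 3) * p) = 3 * p"
  by (simp_all add: surd_mult flip: Const_mult mult.assoc)

definition f1_82 :: poly3 where "f1_82 = X^2 + 3 * Y^2 - 3 * Z^2"
definition f2_82 :: poly3 where "f2_82 = 6 * X^2 + 6 * Y^2 - 2 * Const (surd 3) * X * Z + 6 * Const (surd 3) * Y * Z - 15 * Z^2"
definition f3_82 :: poly3 where "f3_82 = X^2 - Y^2 - 2 * Z^2"
text \<open>Numbered as for \<open>W30_81\<close>: two triple points, the tacnode, then the
  nodes.\<close>

definition v0_82 :: "complex ^ 3" where "v0_82 = vector [3, 1, 2]"
definition v1_82 :: "complex ^ 3" where "v1_82 = vector [- 3, - 1, 2]"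
definition v2_82 :: "complex ^ 3" where "v2_82 = vector [surd 3, surd 3, 2]"
definition v3_82 :: "complex ^ 3" where "v3_82 = vector [3, - 1, 2]"
definition v4_82 :: "complex ^ 3" where "v4_82 = vector [- 3, 1, 2]"
definition v5_82 :: "complex ^ 3" where "v5_82 = vector [7, - 5, 2 * surd 3]"
definition v6_82 :: "complex ^ 3" where "v6_82 = vector [- 5, - 1, 2 * surd 3]"

abbreviation vs_82 :: "(complex ^ 3) list" where
  "vs_82 \<equiv> [v0_82, v1_82, v2_82, v3_82, v4_82, v5_82, v6_82]"
abbreviation fs_82 :: "poly3 list" where "fs_82 \<equiv> [f1_82, f2_82, f3_82]"

lemmas f_82 = f1_82_def f2_82_def f3_82_def
lemmas v_82 = v0_82_def v1_82_def v2_82_def v3_82_def v4_82_def v5_82_def v6_82_def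

lemma smooth_f2_82: "smooth f2_82"
proof (rule smoothI)
  fix x y z
  assume "eval3 (pdiff 1 f2_82) (vector [x, y, z]) = 0" "eval3 (pdiff 2 f2_82) (vector [x, y, z]) = 0"
    "eval3 (pdiff 3 f2_82) (vector [x, y, z]) = 0"
  note e = this[unfolded f_82, simplified]
  have s: "surd 3 * surd 3 = 3" by (simp add: surd_mult)
  have "5760 * x = 0" "5760 * y = 0" "5760 * z = 0" using e s by algebra+
  then show "x = 0 \<and> y = 0 \<and> z = 0" by simp
qed

lemma degrees_82: "smooth_of_degrees fs_82 [2, 2, 2]"
proof -
  have "smooth f1_82" "smooth f3_82"
    by (rule smoothI, simp add: f_82)+
  moreover have "homogeneous 2 f1_82" "homogeneous 2 f2_82" "homogeneous 2 f3_82"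
    unfolding f_82 by (intro homogeneous_intros)+
  ultimately show ?thesis by (simp add: smooth_of_degrees_def smooth_f2_82)
qed

lemma tests_82: "list_all2 (component_tests fs_82) vs_82 inc_81"
  by (simp add: component_tests_def All_less_Suc f_82 v_82 vec_eq_iff forall_3 surd_simps)

lemma meets_82_12: "meets_in vs_82 f1_82 f2_82"
proof (rule meets_inI)
  fix x y z assume "eval3 f1_82 (vector [x, y, z]) = 0" "eval3 f2_82 (vector [x, y, z]) = 0"
  note e = this[unfolded f_82, simplified]
  have s: "surd 3 * surd 3 = 3" by (simp add: surd_mult)
  show "listed vs_82 x y z"
  proof -
    \<comment> \<open>With s the root of 3, f2 - 5 f1 = (x - 3y)(x + 3y - 2sz): the chord through
      the triple points and the common tangent at the tacnode.\<close>
    have "x - 3 * y = 0 \<or> x + 3 * y - 2 * surd 3 * z = 0" using e s by algebra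
    then show ?thesis
    proof
      assume 1: "x - 3 * y = 0"
      have "2 * y - z = 0 \<or> 2 * y + z = 0" using e 1 s by algebra
      then show ?thesis
      proof
        assume 2: "2 * y - z = 0"
        show ?thesis by (rule listedI[OF v0_82_def]) (simp, simp, (use e 1 2 s in algebra)+)
      next
        assume 2: "2 * y + z = 0"
        show ?thesis by (rule listedI[OF v1_82_def]) (simp, simp, (use e 1 2 s in algebra)+)
      qed
    next
      assume 1: "x + 3 * y - 2 * surd 3 * z = 0"
      have "(2 * y - surd 3 * z) * (2 * y - surd 3 * z) = 0" using e 1 s by algebra
      then have 2: "2 * y - surd 3 * z = 0" by simp
      show ?thesis by (rule listedI[OF v2_82_def]) (simp, simp, (use e 1 2 s in algebra)+)
    qed
  qed
qed

lemma meets_82_13: "meets_in vs_82 f1_82 f3_82"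
proof (rule meets_inI)
  fix x y z assume "eval3 f1_82 (vector [x, y, z]) = 0" "eval3 f3_82 (vector [x, y, z]) = 0"
  note e = this[unfolded f_82, simplified]
  have s: "surd 3 * surd 3 = 3" by (simp add: surd_mult)
  show "listed vs_82 x y z"
  proof -
    \<comment> \<open>From f1 - f3 = 4 y^2 - z^2.\<close>
    have "2 * y - z = 0 \<or> 2 * y + z = 0" using e s by algebra
    then show ?thesis
    proof
      assume 1: "2 * y - z = 0"
      have "2 * x - 3 * z = 0 \<or> 2 * x + 3 * z = 0" using e 1 s by algebra
      then show ?thesis
      proof
        assume 2: "2 * x - 3 * z = 0"
        show ?thesis by (rule listedI[OF v0_82_def]) (simp, simp, (use e 1 2 s in algebra)+)
      next
        assume 2: "2 * x + 3 * z = 0"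
        show ?thesis by (rule listedI[OF v4_82_def]) (simp, simp, (use e 1 2 s in algebra)+)
      qed
    next
      assume 1: "2 * y + z = 0"
      have "2 * x - 3 * z = 0 \<or> 2 * x + 3 * z = 0" using e 1 s by algebra
      then show ?thesis
      proof
        assume 2: "2 * x - 3 * z = 0"
        show ?thesis by (rule listedI[OF v3_82_def]) (simp, simp, (use e 1 2 s in algebra)+)
      next
        assume 2: "2 * x + 3 * z = 0"
        show ?thesis by (rule listedI[OF v1_82_def]) (simp, simp, (use e 1 2 s in algebra)+)
      qed
    qed
  qed
qed

lemma meets_82_23: "meets_in vs_82 f2_82 f3_82"
proof (rule meets_inI)
  fix x y z assume "eval3 f2_82 (vector [x, y, z]) = 0" "eval3 f3_82 (vector [x, y, z]) = 0"
  note e = this[unfolded f_82, simplified]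
  have s: "surd 3 * surd 3 = 3" by (simp add: surd_mult)
  show "listed vs_82 x y z"
  proof -
    \<comment> \<open>With s the root of 3, 15 f3 - 2 f2 = (x - 3y)(3x + 9y + 4sz).\<close>
    have "x - 3 * y = 0 \<or> 3 * x + 9 * y + 4 * surd 3 * z = 0" using e s by algebra
    then show ?thesis
    proof
      assume 1: "x - 3 * y = 0"
      have "2 * y - z = 0 \<or> 2 * y + z = 0" using e 1 s by algebra
      then show ?thesis
      proof
        assume 2: "2 * y - z = 0"
        show ?thesis by (rule listedI[OF v0_82_def]) (simp, simp, (use e 1 2 s in algebra)+)
      next
        assume 2: "2 * y + z = 0"
        show ?thesis by (rule listedI[OF v1_82_def]) (simp, simp, (use e 1 2 s in algebra)+)
      qed
    next
      assume 1: "3 * x + 9 * y + 4 * surd 3 * z = 0"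
      have "2 * surd 3 * y + z = 0 \<or> 2 * surd 3 * y + 5 * z = 0" using e 1 s by algebra
      then show ?thesis
      proof
        assume 2: "2 * surd 3 * y + z = 0"
        show ?thesis by (rule listedI[OF v6_82_def]) (simp, simp, (use e 1 2 s in algebra)+)
      next
        assume 2: "2 * surd 3 * y + 5 * z = 0"
        show ?thesis by (rule listedI[OF v5_82_def]) (simp, simp, (use e 1 2 s in algebra)+)
      qed
    qed
  qed
qed

lemma arrangement_82: "arrangement fs_82 [2, 2, 2] vs_82 (map set inc_81)"
  by (rule arrangementI[OF _ degrees_82 tests_82])
    (simp_all add: meets_82_12 meets_82_13 meets_82_23 All_less_Suc,
     simp add: distinct_points_def v_82 surd_simps)

lemma triple_82: 
  "same_topological_type (prod_list fs_82) (abs_cp2 v0_82) (X * Y * (X + Y)) (abs_cp2 origin)" 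
  "same_topological_type (prod_list fs_82) (abs_cp2 v1_82) (X * Y * (X + Y)) (abs_cp2 origin)"
proof -
  \<comment> \<open>Elimination of x - 3y, the line through both triple points, from the
    factorizations of f2 - 5 f1 and 15 f3 - 2 f2.\<close>
  have rel: "(3 * X + 9 * Y - 6 * Const (surd 3) * Z) * fs_82 ! 2 = (- 3 * X - 9 * Y - 4 * Const (surd 3) * Z) * fs_82 ! 0 + (X + 3 * Y) * fs_82 ! 1"
    by (simp add: f_82 algebra_simps power2_eq_square Const_surd_3)
  have hom: "homogeneous 1 (- 3 * X - 9 * Y - 4 * Const (surd 3) * Z)" "homogeneous 1 (X + 3 * Y)" "homogeneous 1 (3 * X + 9 * Y - 6 * Const (surd 3) * Z)"
    by (intro homogeneous_intros)+
  note triple = std.triple_of_arrangement[OF degrees_82 _ _ _ rel hom]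
  show "same_topological_type (prod_list fs_82) (abs_cp2 v0_82) (X * Y * (X + Y)) (abs_cp2 origin)"
    using tests_82 by (intro triple) (simp_all add: std.jacobian_def f_82 v0_82_def surd_simps)
  show "same_topological_type (prod_list fs_82) (abs_cp2 v1_82) (X * Y * (X + Y)) (abs_cp2 origin)"
    using tests_82 by (intro triple) (simp_all add: std.jacobian_def f_82 v1_82_def surd_simps)
qed

lemma tacnode_82:
  "same_topological_type (prod_list fs_82) (abs_cp2 v2_82) (Y * (Y * Z - X^2)) (abs_cp2 origin)"
proof -
  \<comment> \<open>With s the root of 3 and the common tangent t = x + 3y - 2sz, 4 f1 = t (x + 3y +
    2sz) + 3 (x - y)^2 and 4 f2 = t (9x + 3y + 10sz) + 15 (x - y)^2. Eliminating t gives the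
    relation.\<close>
  have rel: "(X + 3 * Y + 2 * Const (surd 3) * Z) * fs_82 ! 1 = (9 * X + 3 * Y + 10 * Const (surd 3) * Z) * fs_82 ! 0 + (9 * Y - 3 * X) * (X - Y)\<^sup>2"
    by (simp add: f_82 algebra_simps power2_eq_square Const_surd_3)
  have hom: "homogeneous 1 (9 * X + 3 * Y + 10 * Const (surd 3) * Z)" "homogeneous 1 (X + 3 * Y + 2 * Const (surd 3) * Z)" "homogeneous 1 (9 * Y - 3 * X)" "homogeneous 1 (X - Y)"
    by (intro homogeneous_intros)+
  show ?thesis
    using tests_82 by (intro std.tacnode_of_arrangement[OF degrees_82 _ _ _ rel hom])
      (simp_all add: std.jacobian_def f_82 v2_82_def surd_simps)
qed

lemma types_82:
  "list_all2 (\<lambda>v M. same_topological_type (prod_list fs_82) (abs_cp2 v) M (abs_cp2 origin)) vs_82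
    [X * Y * (X + Y), X * Y * (X + Y), Y * (Y * Z - X^2), X * Y, X * Y, X * Y, X * Y]"
  using triple_82 tacnode_82
  by (intro types_of_arrangement[OF degrees_82 tests_82])
    (simp add: std.node_test_def std.jacobian_def f_82 v_82 surd_simps)

lemma product_82: "prod_list fs_82 = W30_82"
  by (simp add: W30_82_def surd_3 f_82 mult_ac)

lemma homogeneous_82: "homogeneous 6 W30_82"
  using homogeneous_arrangement[OF degrees_82, unfolded product_82] by simp


section \<open>The arrangement \<open>W22_41\<close>\<close>

definition f1_41 :: poly3 where "f1_41 = X^2 + 3 * Y^2 - 4 * Z^2"
definition f2_41 :: poly3 where "f2_41 = 3 * X^2 + Y^2 - 4 * Z^2"
definition f3_41 :: poly3 where "f3_41 = X - Y + Z"
definition f4_41 :: poly3 where "f4_41 = X - Y"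
definition v0_41 :: "complex ^ 3" where "v0_41 = vector [1, 1, 1]"
definition v1_41 :: "complex ^ 3" where "v1_41 = vector [- 1, - 1, 1]"
definition v2_41 :: "complex ^ 3" where "v2_41 = vector [1, - 1, 1]"
definition v3_41 :: "complex ^ 3" where "v3_41 = vector [- 1, 1, 1]"
definition v4_41 :: "complex ^ 3" where "v4_41 = vector [- 3 + surd 13, 1 + surd 13, 4]"
definition v5_41 :: "complex ^ 3" where "v5_41 = vector [- 3 - surd 13, 1 - surd 13, 4]"
definition v6_41 :: "complex ^ 3" where "v6_41 = vector [- 1 + surd 13, 3 + surd 13, 4]"
definition v7_41 :: "complex ^ 3" where "v7_41 = vector [- 1 - surd 13, 3 - surd 13, 4]"
text \<open>The two lines meet on z = 0, outside the standard chart; this node is tested in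
  \<open>ychart\<close>.\<close>

definition v8_41 :: "complex ^ 3" where "v8_41 = vector [1, 1, 0]"

abbreviation vs_41 :: "(complex ^ 3) list" where
  "vs_41 \<equiv> [v0_41, v1_41, v2_41, v3_41, v4_41, v5_41, v6_41, v7_41, v8_41]"
abbreviation fs_41 :: "poly3 list" where "fs_41 \<equiv> [f1_41, f2_41, f3_41, f4_41]"
abbreviation inc_41 :: "nat list list" where
  "inc_41 \<equiv> [[0, 1, 3], [0, 1, 3], [0, 1], [0, 1], [0, 2], [0, 2], [1, 2], [1, 2], [2, 3]]"

lemmas f_41 = f1_41_def f2_41_def f3_41_def f4_41_def
lemmas v_41 = v0_41_def v1_41_def v2_41_def v3_41_def v4_41_def v5_41_def v6_41_def v7_41_def v8_41_def

lemma degrees_41: "smooth_of_degrees fs_41 [2, 2, 1, 1]"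
proof -
  have "smooth f1_41" "smooth f2_41" "smooth f3_41" "smooth f4_41"
    by (rule smoothI, simp add: f_41)+
  moreover have "homogeneous 2 f1_41" "homogeneous 2 f2_41" "homogeneous 1 f3_41" "homogeneous 1 f4_41"
    unfolding f_41 by (intro homogeneous_intros)+
  ultimately show ?thesis by (simp add: smooth_of_degrees_def)
qed

lemma tests_41: "list_all2 (component_tests fs_41) vs_41 inc_41"
  by (simp add: component_tests_def All_less_Suc f_41 v_41 vec_eq_iff forall_3 surd_simps)

lemma meets_41_12: "meets_in vs_41 f1_41 f2_41"
proof (rule meets_inI)
  fix x y z assume "eval3 f1_41 (vector [x, y, z]) = 0" "eval3 f2_41 (vector [x, y, z]) = 0"
  note e = this[unfolded f_41, simplified]
  show "listed vs_41 x y z"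
  proof -
    have "y - z = 0 \<or> y + z = 0" using e by algebra
    then show ?thesis
    proof
      assume 1: "y - z = 0"
      have "x - z = 0 \<or> x + z = 0" using e 1 by algebra
      then show ?thesis
      proof
        assume 2: "x - z = 0"
        show ?thesis by (rule listedI[OF v0_41_def]) (simp, simp, (use e 1 2 in algebra)+)
      next
        assume 2: "x + z = 0"
        show ?thesis by (rule listedI[OF v3_41_def]) (simp, simp, (use e 1 2 in algebra)+)
      qed
    next
      assume 1: "y + z = 0"
      have "x - z = 0 \<or> x + z = 0" using e 1 by algebra
      then show ?thesis
      proof
        assume 2: "x - z = 0"
        show ?thesis by (rule listedI[OF v2_41_def]) (simp, simp, (use e 1 2 in algebra)+)
      next
        assume 2: "x + z = 0"
        show ?thesis by (rule listedI[OF v1_41_def]) (simp, simp, (use e 1 2 in algebra)+)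
      qed
    qed
  qed
qed

lemma meets_41_13: "meets_in vs_41 f1_41 f3_41"
proof (rule meets_inI)
  fix x y z assume "eval3 f1_41 (vector [x, y, z]) = 0" "eval3 f3_41 (vector [x, y, z]) = 0"
  note e = this[unfolded f_41, simplified]
  have s: "surd 13 * surd 13 = 13" by (simp add: surd_mult)
  show "listed vs_41 x y z"
  proof -
    \<comment> \<open>Substituting y = x + z leaves 4 x^2 + 6 x z - z^2, of discriminant 52
      z^2.\<close>
    have "4 * x + 3 * z - surd 13 * z = 0 \<or> 4 * x + 3 * z + surd 13 * z = 0" using e s by algebra
    then show ?thesis
    proof
      assume 1: "4 * x + 3 * z - surd 13 * z = 0"
      show ?thesis by (rule listedI[OF v4_41_def]) (simp, simp, (use e 1 s in algebra)+)
    next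
      assume 1: "4 * x + 3 * z + surd 13 * z = 0"
      show ?thesis by (rule listedI[OF v5_41_def]) (simp, simp, (use e 1 s in algebra)+)
    qed
  qed
qed

lemma meets_41_23: "meets_in vs_41 f2_41 f3_41"
proof (rule meets_inI)
  fix x y z assume "eval3 f2_41 (vector [x, y, z]) = 0" "eval3 f3_41 (vector [x, y, z]) = 0"
  note e = this[unfolded f_41, simplified]
  have s: "surd 13 * surd 13 = 13" by (simp add: surd_mult)
  show "listed vs_41 x y z"
  proof -
    \<comment> \<open>Substituting y = x + z leaves 4 x^2 + 2 x z - 3 z^2, again of discriminant 52
      z^2.\<close>
    have "4 * x + z - surd 13 * z = 0 \<or> 4 * x + z + surd 13 * z = 0" using e s by algebra
    then show ?thesis
    proof
      assume 1: "4 * x + z - surd 13 * z = 0"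
      show ?thesis by (rule listedI[OF v6_41_def]) (simp, simp, (use e 1 s in algebra)+)
    next
      assume 1: "4 * x + z + surd 13 * z = 0"
      show ?thesis by (rule listedI[OF v7_41_def]) (simp, simp, (use e 1 s in algebra)+)
    qed
  qed
qed

lemma meets_41_14: "meets_in vs_41 f1_41 f4_41"
proof (rule meets_inI)
  fix x y z assume "eval3 f1_41 (vector [x, y, z]) = 0" "eval3 f4_41 (vector [x, y, z]) = 0"
  note e = this[unfolded f_41, simplified]
  show "listed vs_41 x y z"
  proof -
    have "x - z = 0 \<or> x + z = 0" using e by algebra
    then show ?thesis
    proof
      assume 1: "x - z = 0"
      show ?thesis by (rule listedI[OF v0_41_def]) (simp, simp, (use e 1 in algebra)+)
    next
      assume 1: "x + z = 0"
      show ?thesis by (rule listedI[OF v1_41_def]) (simp, simp, (use e 1 in algebra)+)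
    qed
  qed
qed

lemma meets_41_24: "meets_in vs_41 f2_41 f4_41"
proof (rule meets_inI)
  fix x y z assume "eval3 f2_41 (vector [x, y, z]) = 0" "eval3 f4_41 (vector [x, y, z]) = 0"
  note e = this[unfolded f_41, simplified]
  show "listed vs_41 x y z"
  proof -
    have "x - z = 0 \<or> x + z = 0" using e by algebra
    then show ?thesis
    proof
      assume 1: "x - z = 0"
      show ?thesis by (rule listedI[OF v0_41_def]) (simp, simp, (use e 1 in algebra)+)
    next
      assume 1: "x + z = 0"
      show ?thesis by (rule listedI[OF v1_41_def]) (simp, simp, (use e 1 in algebra)+)
    qed
  qed
qed

lemma meets_41_34: "meets_in vs_41 f3_41 f4_41"
proof (rule meets_inI)
  fix x y z assume "eval3 f3_41 (vector [x, y, z]) = 0" "eval3 f4_41 (vector [x, y, z]) = 0"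
  note e = this[unfolded f_41, simplified]
  show "listed vs_41 x y z"
  proof -
    \<comment> \<open>The third coordinate is zero, so the scalar is read off from y instead of
      z.\<close>
    have "z = 0" "x = y" using e by simp_all
    then have "vector [x, y, z] = (y *s v8_41 :: complex ^ 3)"
      by (simp add: v8_41_def vec_eq_iff forall_3)
    then show ?thesis by (auto simp: listed_def)
  qed
qed

lemma arrangement_41: "arrangement fs_41 [2, 2, 1, 1] vs_41 (map set inc_41)"
  by (rule arrangementI[OF _ degrees_41 tests_41])
    (simp_all add: meets_41_12 meets_41_13 meets_41_23 meets_41_14 meets_41_24 meets_41_34 All_less_Suc,
     simp add: distinct_points_def v_41 surd_simps)

lemma triple_41: 
  "same_topological_type (prod_list fs_41) (abs_cp2 v0_41) (X * Y * (X + Y)) (abs_cp2 origin)" 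
  "same_topological_type (prod_list fs_41) (abs_cp2 v1_41) (X * Y * (X + Y)) (abs_cp2 origin)"
proof -
  \<comment> \<open>The line belongs to a reducible conic of the pencil: f2 - f1 = 2 (x - y)(x +
    y).\<close>
  have rel: "(2 * X + 2 * Y) * fs_41 ! 3 = (- 1) * fs_41 ! 0 + 1 * fs_41 ! 1"
    by (simp add: f_41) algebra
  have hom: "homogeneous 0 (- 1)" "homogeneous 0 1" "homogeneous 1 (2 * X + 2 * Y)"
    by (intro homogeneous_intros)+
  note triple = std.triple_of_arrangement[OF degrees_41 _ _ _ rel hom]
  show "same_topological_type (prod_list fs_41) (abs_cp2 v0_41) (X * Y * (X + Y)) (abs_cp2 origin)"
    using tests_41 by (intro triple) (simp_all add: std.jacobian_def f_41 v0_41_def surd_simps)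
  show "same_topological_type (prod_list fs_41) (abs_cp2 v1_41) (X * Y * (X + Y)) (abs_cp2 origin)"
    using tests_41 by (intro triple) (simp_all add: std.jacobian_def f_41 v1_41_def surd_simps)
qed

lemma types_41:
  "list_all2 (\<lambda>v M. same_topological_type (prod_list fs_41) (abs_cp2 v) M (abs_cp2 origin)) vs_41
    [X * Y * (X + Y), X * Y * (X + Y), X * Y, X * Y, X * Y, X * Y, X * Y, X * Y, X * Y]"
  using triple_41
  by (intro types_of_arrangement[OF degrees_41 tests_41])
    (simp add: std.node_test_def std.jacobian_def ychart.node_test_def ychart.jacobian_def f_41 v_41 surd_simps)

lemma product_41: "prod_list fs_41 = W22_41"
  by (simp add: W22_41_def f_41 mult_ac)

lemma homogeneous_41: "homogeneous 6 W22_41"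
  using homogeneous_arrangement[OF degrees_41, unfolded product_41] by simp


section \<open>The arrangement \<open>W22_42\<close>\<close>

definition f1_42 :: poly3 where "f1_42 = X^2 + 3 * Y^2 - 4 * Z^2"
definition f2_42 :: poly3 where "f2_42 = 3 * X^2 + Y^2 - 4 * Z^2"
text \<open>The two lines are listed in the opposite order to the product defining
  \<open>W22_42\<close>, so that the fourth component is the line through both triple points, as for
  \<open>W22_41\<close>.\<close>

definition f3_42 :: poly3 where "f3_42 = X"
definition f4_42 :: poly3 where "f4_42 = X + Z"
definition v0_42 :: "complex ^ 3" where "v0_42 = vector [- 1, 1, 1]"
definition v1_42 :: "complex ^ 3" where "v1_42 = vector [- 1, - 1, 1]"
definition v2_42 :: "complex ^ 3" where "v2_42 = vector [1, 1, 1]"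
definition v3_42 :: "complex ^ 3" where "v3_42 = vector [1, - 1, 1]"
definition v4_42 :: "complex ^ 3" where "v4_42 = vector [0, 2 * surd 3, 3]"
definition v5_42 :: "complex ^ 3" where "v5_42 = vector [0, - 2 * surd 3, 3]"
definition v6_42 :: "complex ^ 3" where "v6_42 = vector [0, 2, 1]"
definition v7_42 :: "complex ^ 3" where "v7_42 = vector [0, - 2, 1]"
definition v8_42 :: "complex ^ 3" where "v8_42 = vector [0, 1, 0]"

abbreviation vs_42 :: "(complex ^ 3) list" where
  "vs_42 \<equiv> [v0_42, v1_42, v2_42, v3_42, v4_42, v5_42, v6_42, v7_42, v8_42]"
abbreviation fs_42 :: "poly3 list" where "fs_42 \<equiv> [f1_42, f2_42, f3_42, f4_42]"

lemmas f_42 = f1_42_def f2_42_def f3_42_def f4_42_def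
lemmas v_42 = v0_42_def v1_42_def v2_42_def v3_42_def v4_42_def v5_42_def v6_42_def v7_42_def v8_42_def

lemma degrees_42: "smooth_of_degrees fs_42 [2, 2, 1, 1]"
proof -
  have "smooth f1_42" "smooth f2_42" "smooth f3_42" "smooth f4_42"
    by (rule smoothI, simp add: f_42)+
  moreover have "homogeneous 2 f1_42" "homogeneous 2 f2_42" "homogeneous 1 f3_42" "homogeneous 1 f4_42"
    unfolding f_42 by (intro homogeneous_intros)+
  ultimately show ?thesis by (simp add: smooth_of_degrees_def)
qed

lemma tests_42: "list_all2 (component_tests fs_42) vs_42 inc_41"
  by (simp add: component_tests_def All_less_Suc f_42 v_42 vec_eq_iff forall_3 surd_simps)

lemma meets_42_12: "meets_in vs_42 f1_42 f2_42"
proof (rule meets_inI)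
  fix x y z assume "eval3 f1_42 (vector [x, y, z]) = 0" "eval3 f2_42 (vector [x, y, z]) = 0"
  note e = this[unfolded f_42, simplified]
  show "listed vs_42 x y z"
  proof -
    have "y - z = 0 \<or> y + z = 0" using e by algebra
    then show ?thesis
    proof
      assume 1: "y - z = 0"
      have "x - z = 0 \<or> x + z = 0" using e 1 by algebra
      then show ?thesis
      proof
        assume 2: "x - z = 0"
        show ?thesis by (rule listedI[OF v2_42_def]) (simp, simp, (use e 1 2 in algebra)+)
      next
        assume 2: "x + z = 0"
        show ?thesis by (rule listedI[OF v0_42_def]) (simp, simp, (use e 1 2 in algebra)+)
      qed
    next
      assume 1: "y + z = 0"
      have "x - z = 0 \<or> x + z = 0" using e 1 by algebra
      then show ?thesis
      proof
        assume 2: "x - z = 0"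
        show ?thesis by (rule listedI[OF v3_42_def]) (simp, simp, (use e 1 2 in algebra)+)
      next
        assume 2: "x + z = 0"
        show ?thesis by (rule listedI[OF v1_42_def]) (simp, simp, (use e 1 2 in algebra)+)
      qed
    qed
  qed
qed

lemma meets_42_13: "meets_in vs_42 f1_42 f3_42"
proof (rule meets_inI)
  fix x y z assume "eval3 f1_42 (vector [x, y, z]) = 0" "eval3 f3_42 (vector [x, y, z]) = 0"
  note e = this[unfolded f_42, simplified]
  have s: "surd 3 * surd 3 = 3" by (simp add: surd_mult)
  show "listed vs_42 x y z"
  proof -
    have "3 * y - 2 * surd 3 * z = 0 \<or> 3 * y + 2 * surd 3 * z = 0" using e s by algebra
    then show ?thesis
    proof
      assume 1: "3 * y - 2 * surd 3 * z = 0"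
      show ?thesis by (rule listedI[OF v4_42_def]) (simp, simp, (use e 1 s in algebra)+)
    next
      assume 1: "3 * y + 2 * surd 3 * z = 0"
      show ?thesis by (rule listedI[OF v5_42_def]) (simp, simp, (use e 1 s in algebra)+)
    qed
  qed
qed

lemma meets_42_23: "meets_in vs_42 f2_42 f3_42"
proof (rule meets_inI)
  fix x y z assume "eval3 f2_42 (vector [x, y, z]) = 0" "eval3 f3_42 (vector [x, y, z]) = 0"
  note e = this[unfolded f_42, simplified]
  show "listed vs_42 x y z"
  proof -
    have "y - 2 * z = 0 \<or> y + 2 * z = 0" using e by algebra
    then show ?thesis
    proof
      assume 1: "y - 2 * z = 0"
      show ?thesis by (rule listedI[OF v6_42_def]) (simp, simp, (use e 1 in algebra)+)
    next
      assume 1: "y + 2 * z = 0"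
      show ?thesis by (rule listedI[OF v7_42_def]) (simp, simp, (use e 1 in algebra)+)
    qed
  qed
qed

lemma meets_42_14: "meets_in vs_42 f1_42 f4_42"
proof (rule meets_inI)
  fix x y z assume "eval3 f1_42 (vector [x, y, z]) = 0" "eval3 f4_42 (vector [x, y, z]) = 0"
  note e = this[unfolded f_42, simplified]
  show "listed vs_42 x y z"
  proof -
    have "y - z = 0 \<or> y + z = 0" using e by algebra
    then show ?thesis
    proof
      assume 1: "y - z = 0"
      show ?thesis by (rule listedI[OF v0_42_def]) (simp, simp, (use e 1 in algebra)+)
    next
      assume 1: "y + z = 0"
      show ?thesis by (rule listedI[OF v1_42_def]) (simp, simp, (use e 1 in algebra)+)
    qed
  qed
qed

lemma meets_42_24: "meets_in vs_42 f2_42 f4_42"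
proof (rule meets_inI)
  fix x y z assume "eval3 f2_42 (vector [x, y, z]) = 0" "eval3 f4_42 (vector [x, y, z]) = 0"
  note e = this[unfolded f_42, simplified]
  show "listed vs_42 x y z"
  proof -
    have "y - z = 0 \<or> y + z = 0" using e by algebra
    then show ?thesis
    proof
      assume 1: "y - z = 0"
      show ?thesis by (rule listedI[OF v0_42_def]) (simp, simp, (use e 1 in algebra)+)
    next
      assume 1: "y + z = 0"
      show ?thesis by (rule listedI[OF v1_42_def]) (simp, simp, (use e 1 in algebra)+)
    qed
  qed
qed

lemma meets_42_34: "meets_in vs_42 f3_42 f4_42"
proof (rule meets_inI)
  fix x y z assume "eval3 f3_42 (vector [x, y, z]) = 0" "eval3 f4_42 (vector [x, y, z]) = 0"
  note e = this[unfolded f_42, simplified]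
  show "listed vs_42 x y z"
  proof -
    have "z = 0" "x = 0" using e by simp_all
    then have "vector [x, y, z] = (y *s v8_42 :: complex ^ 3)"
      by (simp add: v8_42_def vec_eq_iff forall_3)
    then show ?thesis by (auto simp: listed_def)
  qed
qed

lemma arrangement_42: "arrangement fs_42 [2, 2, 1, 1] vs_42 (map set inc_41)"
  by (rule arrangementI[OF _ degrees_42 tests_42])
    (simp_all add: meets_42_12 meets_42_13 meets_42_23 meets_42_14 meets_42_24 meets_42_34 All_less_Suc,
     simp add: distinct_points_def v_42 surd_simps)

lemma triple_42: 
  "same_topological_type (prod_list fs_42) (abs_cp2 v0_42) (X * Y * (X + Y)) (abs_cp2 origin)" 
  "same_topological_type (prod_list fs_42) (abs_cp2 v1_42) (X * Y * (X + Y)) (abs_cp2 origin)"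
proof -
  \<comment> \<open>The line belongs to a reducible conic of the pencil: 3 f2 - f1 = 8 (x - z)(x +
    z).\<close>
  have rel: "(8 * X - 8 * Z) * fs_42 ! 3 = (- 1) * fs_42 ! 0 + 3 * fs_42 ! 1"
    by (simp add: f_42) algebra
  have hom: "homogeneous 0 (- 1)" "homogeneous 0 3" "homogeneous 1 (8 * X - 8 * Z)"
    by (intro homogeneous_intros)+
  note triple = std.triple_of_arrangement[OF degrees_42 _ _ _ rel hom]
  show "same_topological_type (prod_list fs_42) (abs_cp2 v0_42) (X * Y * (X + Y)) (abs_cp2 origin)"
    using tests_42 by (intro triple) (simp_all add: std.jacobian_def f_42 v0_42_def surd_simps)
  show "same_topological_type (prod_list fs_42) (abs_cp2 v1_42) (X * Y * (X + Y)) (abs_cp2 origin)"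
    using tests_42 by (intro triple) (simp_all add: std.jacobian_def f_42 v1_42_def surd_simps)
qed

lemma types_42:
  "list_all2 (\<lambda>v M. same_topological_type (prod_list fs_42) (abs_cp2 v) M (abs_cp2 origin)) vs_42
    [X * Y * (X + Y), X * Y * (X + Y), X * Y, X * Y, X * Y, X * Y, X * Y, X * Y, X * Y]"
  using triple_42
  by (intro types_of_arrangement[OF degrees_42 tests_42])
    (simp add: std.node_test_def std.jacobian_def ychart.node_test_def ychart.jacobian_def f_42 v_42 surd_simps)

lemma product_42: "prod_list fs_42 = W22_42"
  by (simp add: W22_42_def f_42 mult_ac)

lemma homogeneous_42: "homogeneous 6 W22_42"
  using homogeneous_arrangement[OF degrees_42, unfolded product_42] by simp


section \<open>The three pairs\<close>

lemma (in arrangement) reduced_prod_list: "reduced_curve (prod_list Ps)"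
  using reduced by (simp add: curve_def)

lemma partials_51: "partials W30_51 (P1_51, P2_51, P3_51)"
  unfolding partials_def prod.case W30_51_def
  by (intro conjI; simp add: P1_51_def P2_51_def P3_51_def; algebra)

lemma partials_52: "partials W30_52 (P1_52, P2_52, P3_52)"
  unfolding partials_def prod.case W30_52_def
  by (intro conjI; simp add: P1_52_def P2_52_def P3_52_def; algebra)

lemma partials_81: "partials W30_81 (P1_81, P2_81, P3_81)"
  unfolding partials_def prod.case W30_81_def
  by (intro conjI; simp add: P1_81_def P2_81_def P3_81_def; algebra)

lemma partials_42: "partials W22_42 (P1_42, P2_42, P3_42)"
  unfolding partials_def prod.case W22_42_def
  by (intro conjI; simp add: P1_42_def P2_42_def P3_42_def; algebra)

definition U41 :: poly3 where
  "U41 = (X^2 + Y^2 - X * Y - 4 * Z^2) * (X^2 + Y^2 + X * Y - 4 * Z^2) * (X + Z) * X"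

definition U82 :: poly3 where
  "U82 = (X^2 + 3 * Y^2 - 9 * Z^2) * (6 * X^2 + 6 * Y^2 - 6 * X * Z + 18 * Y * Z - 45 * Z^2)
     * (X^2 - Y^2 - 6 * Z^2)"

lemma partials_41: "partials U41 (P1_41, P2_41, P3_41)"
  unfolding partials_def prod.case U41_def
  by (intro conjI; simp add: P1_41_def P2_41_def P3_41_def; algebra)

lemma partials_82: "partials U82 (P1_82, P2_82, P3_82)"
  unfolding partials_def prod.case U82_def
  by (intro conjI; simp add: P1_82_def P2_82_def P3_82_def; algebra)

lemma homogeneous_U82: "homogeneous 6 U82"
proof -
  have "homogeneous 2 (X^2 + 3 * Y^2 - 9 * Z^2)" "homogeneous 2 (X^2 - Y^2 - 6 * Z^2)"
    "homogeneous 2 (6 * X^2 + 6 * Y^2 - 6 * X * Z + 18 * Y * Z - 45 * Z^2)"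
    by (intro homogeneous_intros)+
  from homogeneous_mult[OF homogeneous_mult[OF this(1,3)] this(2)] show ?thesis by (simp add: U82_def)
qed

lemma homogeneous_U41: "homogeneous 6 U41"
proof -
  have "homogeneous 2 (X^2 + Y^2 - X * Y - 4 * Z^2)" "homogeneous 2 (X^2 + Y^2 + X * Y - 4 * Z^2)"
    "homogeneous 1 (X + Z)" "homogeneous 1 X"
    by (intro homogeneous_intros)+
  from homogeneous_mult[OF homogeneous_mult[OF homogeneous_mult[OF this(1,2)] this(3)] this(4)]
  show ?thesis by (simp add: U41_def)
qed

text \<open>In the coordinates \<open>X - Y\<close> and \<open>X + Y\<close> the curve of \<open>W22_41\<close> has an equation even in the
  second one; scaling \<open>Z\<close> by \<open>surd 3\<close> gives the curve of \<open>W30_82\<close> an integral equation.\<close>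

definition rotate :: "3 \<Rightarrow> poly3" where
  "rotate i = (if i = 1 then X - Y else if i = 2 then X + Y else Z)"

definition unrotate :: "3 \<Rightarrow> poly3" where
  "unrotate i = (if i = 1 then Const (1/2) * (X + Y) else if i = 2 then Const (1/2) * (Y - X) else Z)"

definition stretch :: "3 \<Rightarrow> poly3" where
  "stretch i = (if i = 3 then Const (surd 3 / 3) * Z else Var i)"

definition unstretch :: "3 \<Rightarrow> poly3" where
  "unstretch i = (if i = 3 then Const (surd 3) * Z else Var i)"

lemma Const_half: "Const (1/2) * p + Const (1/2) * p = p"
proof -
  have "Const (1/2) * p + Const (1/2) * p = Const (1/2 + 1/2) * p"
    by (simp only: Const_add distrib_right)
  then show ?thesis by simp
qed

lemma rotate_inverse: "subst unrotate (rotate i) = Var i" "subst rotate (unrotate i) = Var i"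
proof -
  have "Const (1/2) * (X + Y) - Const (1/2) * (Y - X) = X" "Const (1/2) * (X + Y) + Const (1/2) * (Y - X) = Y"
    "Const (1/2) * (X - Y + (X + Y)) = X" "Const (1/2) * (X + Y - (X - Y)) = Y"
    using Const_half[of X] Const_half[of Y] by (simp_all add: algebra_simps)
  then show "subst unrotate (rotate i) = Var i" "subst rotate (unrotate i) = Var i"
    using exhaust_3[of i] by (auto simp: rotate_def unrotate_def subst_simps)
qed

lemma stretch_inverse: "subst unstretch (stretch i) = Var i" "subst stretch (unstretch i) = Var i"
proof -
  have "Const (surd 3 / 3) * Const (surd 3) = 1" "Const (surd 3) * Const (surd 3 / 3) = 1"
    by (simp_all add: surd_mult flip: Const_mult)
  then have "Const (surd 3 / 3) * (Const (surd 3) * Z) = Z" "Const (surd 3) * (Const (surd 3 / 3) * Z) = Z"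
    by (simp_all flip: mult.assoc)
  then show "subst unstretch (stretch i) = Var i" "subst stretch (unstretch i) = Var i"
    using exhaust_3[of i] by (auto simp: stretch_def unstretch_def subst_simps)
qed

lemma homogeneous_Const_mult: "homogeneous 1 p \<Longrightarrow> homogeneous 1 (Const c * p)"
  using homogeneous_mult[OF homogeneous_Const, of 1 p c] by simp

lemma homogeneous_coordinates: "homogeneous 1 (rotate i)" "homogeneous 1 (unrotate i)"
    "homogeneous 1 (stretch i)" "homogeneous 1 (unstretch i)"
  unfolding rotate_def unrotate_def stretch_def unstretch_def
  by (auto intro!: homogeneous_Const_mult homogeneous_add homogeneous_diff)

lemma subst_U41: "subst rotate U41 = W22_41"
proof -
  have "subst rotate U41 = ((X - Y)^2 + (X + Y)^2 - (X - Y) * (X + Y) - 4 * Z^2)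
      * ((X - Y)^2 + (X + Y)^2 + (X - Y) * (X + Y) - 4 * Z^2) * (X - Y + Z) * (X - Y)"
    by (simp add: U41_def subst_simps rotate_def)
  also have "\<dots> = W22_41" unfolding W22_41_def by algebra
  finally show ?thesis .
qed

lemma subst_U82: "subst stretch U82 = W30_82"
proof -
  let ?k = "Const (surd 3 / 3)"
  \<comment> \<open>Here \<open>?k\<close> is the inverse of the root of 3: its square makes
    coefficients rational, while its first power leaves one root of 3 as in
    \<open>W30_82\<close>.\<close>
  have k: "9 * ?k^2 = 3" "6 * ?k = 2 * Const (surd 3)" "18 * ?k = 6 * Const (surd 3)"
      "45 * ?k^2 = 15" "6 * ?k^2 = 2"
    by (simp_all add: surd_mult power2_eq_square power_divide flip: Const_mult Const_numeral)
  have 1: "n * (?k * p) = (n * ?k) * p" "n * (?k * p)^2 = (n * ?k^2) * p^2" for n p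
    by (simp_all add: algebra_simps power2_eq_square)
  have "subst stretch U82 = (X^2 + 3 * Y^2 - 9 * (?k * Z)^2)
      * (6 * X^2 + 6 * Y^2 - 6 * X * (?k * Z) + 18 * Y * (?k * Z) - 45 * (?k * Z)^2)
      * (X^2 - Y^2 - 6 * (?k * Z)^2)"
    by (simp add: U82_def subst_simps stretch_def)
  also have "6 * X * (?k * Z) = 2 * Const (surd 3) * X * Z"
    using arg_cong[OF k(2), of "\<lambda>p. p * (X * Z)"] by (simp only: mult_ac)
  also have "18 * Y * (?k * Z) = 6 * Const (surd 3) * Y * Z"
    using arg_cong[OF k(3), of "\<lambda>p. p * (Y * Z)"] by (simp only: mult_ac)
  finally show ?thesis by (simp only: 1 k W30_82_def surd_3)
qed

text \<open>A socle element would be carried by the inverse coordinate change to \<open>U41\<close>,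
  where the certificate excludes it.\<close>

lemma no_socle_elem_W22_41: "\<nexists>g. socle_elem 7 (jacobian_ideal W22_41) g"
proof
  assume "\<exists>g. socle_elem 7 (jacobian_ideal W22_41) g"
  then obtain g where "socle_elem 7 (jacobian_ideal (subst rotate U41)) g" by (auto simp: subst_U41)
  from subst_socle_elem[OF rotate_inverse(2,1) homogeneous_coordinates(2,1) this]
  have "socle_elem 7 (jacobian_ideal U41) (subst unrotate g)"
    by (simp add: subst_inverse rotate_inverse)
  then show False using no_socle_41[OF homogeneous_U41 partials_41] by simp
qed

lemma socle_elem_W30_82: "socle_elem 7 (jacobian_ideal W30_82) (subst stretch (tri_poly G_82 7))"
  using subst_socle_elem[OF stretch_inverse homogeneous_coordinates(3,4) socle_82[OF homogeneous_U82 partials_82]]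
  by (simp add: subst_U82)

text \<open>The common list \<open>Ms\<close> of model curves, ordered like the singular points,
  links the germs of the two curves: each pair is compared through its model.\<close>

lemma strong_ziegler_pairI:
  assumes "arrangement Ps ds vs inc" "arrangement Qs ds ws inc"
    and "list_all2 (\<lambda>v M. same_topological_type (prod_list Ps) (abs_cp2 v) M (abs_cp2 origin)) vs Ms"
    and "list_all2 (\<lambda>w M. same_topological_type (prod_list Qs) (abs_cp2 w) M (abs_cp2 origin)) ws Ms"
    and "homogeneous d (prod_list Ps)" "homogeneous e (prod_list Qs)"
    and "\<nexists>g. socle_elem k (jacobian_ideal (prod_list Ps)) g" "socle_elem k (jacobian_ideal (prod_list Qs)) h"
  shows "strong_ziegler_pair (prod_list Ps) (prod_list Qs)"
  unfolding strong_ziegler_pair_def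
proof (intro conjI)
  show "reduced_curve (prod_list Ps)" by (rule arrangement.reduced_prod_list[OF assms(1)])
  show "reduced_curve (prod_list Qs)" by (rule arrangement.reduced_prod_list[OF assms(2)])
  have "list_all2 (\<lambda>v w. same_topological_type (prod_list Ps) (abs_cp2 v) (prod_list Qs) (abs_cp2 w)) vs ws"
    unfolding list_all2_conv_all_nth
  proof (intro conjI allI impI)
    show "length vs = length ws" using assms(3,4) by (simp add: list_all2_lengthD)
    fix k assume k: "k < length vs"
    then have "k < length ws" using assms(3,4) by (simp add: list_all2_lengthD)
    from same_topological_typeI[OF list_all2_nthD[OF assms(3) k] list_all2_nthD[OF assms(4) this]]
    show "same_topological_type (prod_list Ps) (abs_cp2 (vs ! k)) (prod_list Qs) (abs_cp2 (ws ! k))" .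
  qed
  then show "same_strong_combinatorial_type (prod_list Ps) (prod_list Qs)"
    by (rule same_strong_combinatorial_typeI[OF assms(1,2)])
  show "\<not> same_graded_betti_numbers (jacobian_ideal (prod_list Ps)) (jacobian_ideal (prod_list Qs))"
    by (rule not_same_graded_betti_numbers[OF graded_ideal_jacobian[OF assms(5)]
          graded_ideal_jacobian[OF assms(6)] assms(7,8)])
qed

lemma pair_51_52: "strong_ziegler_pair W30_51 W30_52"
  by (rule strong_ziegler_pairI[OF arrangement_51 arrangement_52 types_51 types_52,
        unfolded product_51 product_52, OF homogeneous_51 homogeneous_52
        no_socle_51[OF homogeneous_51 partials_51] socle_52[OF homogeneous_52 partials_52]])

lemma pair_81_82: "strong_ziegler_pair W30_81 W30_82"
  by (rule strong_ziegler_pairI[OF arrangement_81 arrangement_82 types_81 types_82,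
        unfolded product_81 product_82, OF homogeneous_81 homogeneous_82
        no_socle_81[OF homogeneous_81 partials_81] socle_elem_W30_82])

lemma pair_41_42: "strong_ziegler_pair W22_41 W22_42"
  by (rule strong_ziegler_pairI[OF arrangement_41 arrangement_42 types_41 types_42,
        unfolded product_41 product_42, OF homogeneous_41 homogeneous_42
        no_socle_elem_W22_41 socle_42[OF homogeneous_42 partials_42]])

theorem proposition5p8:
  shows "strong_ziegler_pair W30_51 W30_52 \<and>
         strong_ziegler_pair W30_81 W30_82 \<and>
         strong_ziegler_pair W22_41 W22_42"
  using pair_51_52 pair_81_82 pair_41_42 by blast

end
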